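(* There are absolute constants $C,A>0$ such that the following holds. Let $q$ be a prime power and let $f$ be a multiplicative function in the class $\mathcal{C}(1)$. Let $n\ge2$ be an integer, let $$\mathcal{F}^\perp(z)=\exp\Big(\sum_{k=1}^{n-1}\frac{\chi(k)}{k}(qz)^k\Big),$$ and choose $\theta\in[0,1)$ for which $|\mathcal{F}^\perp(e(-\theta)/q)|$ is maximal. Then for every integer $\ell$ with $1\le\ell\le n$, $$|\sigma_\theta(n+\ell)-\sigma_\theta(n)|\le C\Big(\Big(\frac{\ell}{n}\Big)^{1-\frac2\pi}\log\frac{2n}{\ell}+\frac{(\log n)^{A}}{n^{1-c_m}}\Big),$$ where $\sigma_\theta(k)=\sigma(k)e(-k\theta)$, $m$ is the smallest odd positive integer not dividing $\ell$, and $c_m=\dfrac{1}{m\sin(\frac{\pi}{2m})}$.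
   Context: $e(t)=e^{2\pi i t}$. Let $\mathcal{M}$ be the set of monic polynomials in $\mathbb{F}_q[x]$ and $\mathcal{M}_n$ those of degree $n$. A function $f:\mathcal{M}\to\mathbb{C}$ is multiplicative if $f(FG)=f(F)f(G)$ whenever $F,G$ are coprime. Define $\Lambda(F)=\deg P$ if $F=P^k$ ($k\ge1$) for a monic irreducible $P$, and $\Lambda(F)=0$ otherwise. For multiplicative $f$ with $f(1)=1$, the coefficients $\Lambda_f(F)$ (zero unless $F$ is a power of a monic irreducible) are defined by $\log\big(1+\sum_{k\ge1}f(P^k)z^{k\deg P}\big)=\sum_{k\ge1}\frac{\Lambda_f(P^k)}{k\deg P}z^{k\deg P}$ for each monic irreducible $P$. The class $\mathcal{C}(\kappa)$ consists of multiplicative $f$ with $f(1)=1$ and $|\Lambda_f(F)|\le\kappa\Lambda(F)$ for all $F$. Define $\sigma(n)=q^{-n}\sum_{M\in\mathcal{M}_n}f(M)$ and $\chi(n)=q^{-n}\sum_{F\in\mathcal{M}_n}\Lambda_f(F)$. *)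

theory Defs
  imports "HOL-Algebra.Polynomial_Divisibility"
    "HOL-Computational_Algebra.Formal_Power_Series"
begin

text \<open>
  The ring \<open>R\<close> below is a finite field. The constants of the theorem have to be independent of
  the field, so the theorem quantifies over fields inside the formula, and one type has to hold
  all of them: hence the record-based fields, which the theorem takes with carrier in
  \<^typ>\<open>nat\<close>. Every finite field is isomorphic to such a one. Polynomials over \<open>R\<close> are the
  elements of \<^term>\<open>poly_ring R\<close>, i.e. coefficient lists starting with the leading coefficient.
\<close>

definition monic_polys :: "('a, 'b) ring_scheme \<Rightarrow> 'a list set" where
  "monic_polys R = {F \<in> carrier (poly_ring R). F \<noteq> [] \<and> lead_coeff F = \<one>\<^bsub>R\<^esub>}"

definition monic_polys_deg :: "('a, 'b) ring_scheme \<Rightarrow> nat \<Rightarrow> 'a list set" where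
  "monic_polys_deg R n = {F \<in> monic_polys R. degree F = n}"

definition monic_irreducibles :: "('a, 'b) ring_scheme \<Rightarrow> 'a list set" where
  "monic_irreducibles R = {P \<in> monic_polys R. pirreducible\<^bsub>R\<^esub> (carrier R) P}"

definition poly_coprime :: "('a, 'b) ring_scheme \<Rightarrow> 'a list \<Rightarrow> 'a list \<Rightarrow> bool" where
  "poly_coprime R F G \<longleftrightarrow> \<one>\<^bsub>poly_ring R\<^esub> gcdof\<^bsub>poly_ring R\<^esub> F G"

text \<open>Only the values of \<open>f\<close> on monic polynomials matter.\<close>

definition multiplicative :: "('a, 'b) ring_scheme \<Rightarrow> ('a list \<Rightarrow> complex) \<Rightarrow> bool" where
  "multiplicative R f \<longleftrightarrow>
     (\<forall>F\<in>monic_polys R. \<forall>G\<in>monic_polys R.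
        poly_coprime R F G \<longrightarrow> f (F \<otimes>\<^bsub>poly_ring R\<^esub> G) = f F * f G)"

definition power_of_irreducible :: "('a, 'b) ring_scheme \<Rightarrow> 'a list \<Rightarrow> 'a list \<Rightarrow> bool" where
  "power_of_irreducible R P F \<longleftrightarrow>
     P \<in> monic_irreducibles R \<and> (\<exists>k::nat. 1 \<le> k \<and> F = P [^]\<^bsub>poly_ring R\<^esub> k)"

text \<open>The description is proper: see \<open>power_of_irreducible_unique\<close>.\<close>

definition irreducible_base :: "('a, 'b) ring_scheme \<Rightarrow> 'a list \<Rightarrow> 'a list" where
  "irreducible_base R F = (THE P. power_of_irreducible R P F)"

definition mangoldt :: "('a, 'b) ring_scheme \<Rightarrow> 'a list \<Rightarrow> real" where
  "mangoldt R F =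
     (if \<exists>P. power_of_irreducible R P F then real (degree (irreducible_base R F)) else 0)"

text \<open>The formal power series $\sum_{k \ge 1} f(P^k) z^{k \deg P}$.\<close>

definition local_series :: "('a, 'b) ring_scheme \<Rightarrow> ('a list \<Rightarrow> complex) \<Rightarrow> 'a list \<Rightarrow> complex fps" where
  "local_series R f P =
     Abs_fps (\<lambda>j. if 1 \<le> j \<and> degree P dvd j
                  then f (P [^]\<^bsub>poly_ring R\<^esub> (j div degree P)) else 0)"

text \<open>
  \<^term>\<open>fps_ln 1\<close> is the series of $\log(1+X)$. For $F = P^k$ the coefficient of
  $z^{k \deg P} = z^{\deg F}$ in $\log(1 + \sum_{k \ge 1} f(P^k) z^{k \deg P})$ is
  $\Lambda_f(F) / \deg F$; the defining identity is \<open>log_local_series\<close> below.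
\<close>

definition mangoldt_of :: "('a, 'b) ring_scheme \<Rightarrow> ('a list \<Rightarrow> complex) \<Rightarrow> 'a list \<Rightarrow> complex" where
  "mangoldt_of R f F =
     (if \<exists>P. power_of_irreducible R P F
      then of_nat (degree F) *
             fps_nth (fps_ln 1 oo local_series R f (irreducible_base R F)) (degree F)
      else 0)"

definition class_C :: "('a, 'b) ring_scheme \<Rightarrow> real \<Rightarrow> ('a list \<Rightarrow> complex) set" where
  "class_C R \<kappa> =
     {f. multiplicative R f \<and> f \<one>\<^bsub>poly_ring R\<^esub> = 1 \<and>
         (\<forall>F\<in>monic_polys R. cmod (mangoldt_of R f F) \<le> \<kappa> * mangoldt R F)}"

definition mean_value :: "('a, 'b) ring_scheme \<Rightarrow> ('a list \<Rightarrow> complex) \<Rightarrow> nat \<Rightarrow> complex" where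
  "mean_value R f n = (\<Sum>M\<in>monic_polys_deg R n. f M) / of_nat (card (carrier R)) ^ n"

definition prime_mean_value :: "('a, 'b) ring_scheme \<Rightarrow> ('a list \<Rightarrow> complex) \<Rightarrow> nat \<Rightarrow> complex" where
  "prime_mean_value R f n =
     (\<Sum>F\<in>monic_polys_deg R n. mangoldt_of R f F) / of_nat (card (carrier R)) ^ n"

definition unit_exp :: "real \<Rightarrow> complex" where
  "unit_exp t = exp (2 * of_real pi * \<i> * of_real t)"

definition twisted_mean_value ::
    "('a, 'b) ring_scheme \<Rightarrow> ('a list \<Rightarrow> complex) \<Rightarrow> real \<Rightarrow> nat \<Rightarrow> complex" where
  "twisted_mean_value R f \<theta> k = mean_value R f k * unit_exp (- (real k * \<theta>))"

definition F_perp :: "('a, 'b) ring_scheme \<Rightarrow> ('a list \<Rightarrow> complex) \<Rightarrow> nat \<Rightarrow> complex \<Rightarrow> complex" where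
  "F_perp R f n z =
     exp (\<Sum>k=1..n-1. prime_mean_value R f k / of_nat k * (of_nat (card (carrier R)) * z) ^ k)"

definition least_odd_nondivisor :: "nat \<Rightarrow> nat" where
  "least_odd_nondivisor l = (LEAST m. odd m \<and> \<not> m dvd l)"

definition c_const :: "nat \<Rightarrow> real" where
  "c_const m = 1 / (real m * sin (pi / (2 * real m)))"


lemma (in field) monic_irreducible_degree:
  assumes "P \<in> monic_irreducibles R"
  shows "degree P \<ge> 1" "P \<in> carrier (poly_ring R)" "P \<noteq> []"
proof -
  show c: "P \<in> carrier (poly_ring R)" "P \<noteq> []"
    using assms by (auto simp: monic_irreducibles_def monic_polys_def)
  show "degree P \<ge> 1"
    using pirreducible_degree[OF carrier_is_subfield c(1)] assms
    by (auto simp: monic_irreducibles_def)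
qed

lemma (in field) degree_power:
  fixes k :: nat
  assumes "P \<in> carrier (poly_ring R)" "P \<noteq> []"
  shows "degree (P [^]\<^bsub>poly_ring R\<^esub> k) = k * degree P"
  using polynomial_pow_degree[OF assms(1)] by simp

lemma (in field) monic_associated_imp_eq:
  assumes "P \<in> monic_polys R" "Q \<in> monic_polys R"
    and "C \<in> Units (poly_ring R)" "Q = P \<otimes>\<^bsub>poly_ring R\<^esub> C"
  shows "P = Q"
proof -
  interpret UP: domain "poly_ring R"
    using univ_poly_is_domain[OF carrier_is_subring] .
  obtain c where c: "C = [c]" "c \<in> carrier R - {\<zero>}"
    using assms(3) univ_poly_carrier_units by auto
  have P: "polynomial (carrier R) P" "P \<noteq> []" "lead_coeff P = \<one>" "lead_coeff Q = \<one>"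
      "P \<in> carrier (poly_ring R)"
    using assms(1,2) by (auto simp: monic_polys_def univ_poly_carrier)
  have "polynomial (carrier R) C"
    using c by (auto simp: polynomial_def)
  then have "lead_coeff Q = lead_coeff P \<otimes> lead_coeff C"
    using poly_mult_lead_coeff[OF carrier_is_subring P(1)] P(2) c(1)
    unfolding assms(4) univ_poly_mult by simp
  then have "c = \<one>"
    using P(3,4) c by simp
  then show ?thesis
    using assms(4) c(1) P(5) UP.r_one by (simp add: univ_poly_one)
qed

lemma (in field) pirreducible_dvd_power:
  fixes k :: nat
  assumes "P \<in> carrier (poly_ring R)" "Q \<in> carrier (poly_ring R)" "pirreducible (carrier R) P"
    and "P pdivides (Q [^]\<^bsub>poly_ring R\<^esub> k)"
  shows "P pdivides Q"
proof -
  interpret UP: domain "poly_ring R"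
    using univ_poly_is_domain[OF carrier_is_subring] .
  have prime: "pprime (carrier R) P"
    using assms(1,3) pprime_iff_pirreducible[OF carrier_is_subfield] by simp
  note E = pprimeE[OF carrier_is_subfield assms(1) prime]
  show ?thesis
    using assms(4)
  proof (induction k)
    case 0
    then have "P \<in> Units (poly_ring R)"
      using UP.divides_one[OF assms(1)] by (simp add: pdivides_def)
    then show ?case
      using E(2) by simp
  next
    case (Suc k)
    then show ?case
      using E(3)[of "Q [^]\<^bsub>poly_ring R\<^esub> k" Q] assms(2) by auto
  qed
qed

lemma (in field) power_of_irreducible_unique:
  assumes "power_of_irreducible R P F" "power_of_irreducible R Q F"
  shows "P = Q"
proof -
  interpret UP: domain "poly_ring R"
    using univ_poly_is_domain[OF carrier_is_subring] .
  obtain k j :: nat where kj: "1 \<le> k" "F = P [^]\<^bsub>poly_ring R\<^esub> k" "F = Q [^]\<^bsub>poly_ring R\<^esub> j"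
    using assms by (auto simp: power_of_irreducible_def)
  have P: "P \<in> carrier (poly_ring R)" "Q \<in> carrier (poly_ring R)"
     "P \<in> monic_polys R" "Q \<in> monic_polys R"
     "pirreducible (carrier R) P" "pirreducible (carrier R) Q"
    using assms by (auto simp: power_of_irreducible_def monic_irreducibles_def monic_polys_def)
  have "P pdivides (Q [^]\<^bsub>poly_ring R\<^esub> j)"
    using polynomial_pow_division[OF P(1) kj(1)] P(1) kj(2,3) by simp
  then have "P pdivides Q"
    using pirreducible_dvd_power P by blast
  then obtain C where C: "C \<in> carrier (poly_ring R)" "Q = P \<otimes>\<^bsub>poly_ring R\<^esub> C"
    by (auto simp: pdivides_def factor_def)
  then have "C \<in> Units (poly_ring R)"
    using pirreducibleE(3)[OF carrier_is_subring P(2,6) P(1) C(1)]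
      pirreducibleE(2)[OF carrier_is_subring P(1,5)] by simp
  then show ?thesis
    using monic_associated_imp_eq P C by blast
qed

lemma (in field) irreducible_base_eq:
  assumes "power_of_irreducible R P F"
  shows "irreducible_base R F = P"
  unfolding irreducible_base_def using assms power_of_irreducible_unique by blast

lemma fps_nth_compose_eq_0:
  fixes a b :: "complex fps"
  assumes "\<And>j. \<not> d dvd j \<Longrightarrow> fps_nth b j = 0" and "\<not> d dvd n"
  shows "fps_nth (a oo b) n = 0"
proof -
  have "fps_nth (b ^ i) j = 0" if "\<not> d dvd j" for i j
    using that
  proof (induction i arbitrary: j)
    case 0
    then show ?case by (cases "j = 0") auto
  next
    case (Suc i)
    have "fps_nth b l * fps_nth (b ^ i) (j - l) = 0" if "l \<le> j" for l
    proof (cases "d dvd l")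
      case True
      then have "\<not> d dvd (j - l)"
        using Suc.prems that by (metis dvd_add le_add_diff_inverse)
      then show ?thesis using Suc.IH by simp
    qed (use assms(1) in simp)
    then show ?case
      by (auto simp: fps_mult_nth intro!: sum.neutral simp del: mult_eq_0_iff)
  qed
  then show ?thesis
    using assms(2) by (simp add: fps_compose_nth)
qed

lemma (in field) log_local_series:
  assumes P: "P \<in> monic_irreducibles R"
  shows "fps_ln 1 oo local_series R f P =
     Abs_fps (\<lambda>j. if 1 \<le> j \<and> degree P dvd j
                  then mangoldt_of R f (P [^]\<^bsub>poly_ring R\<^esub> (j div degree P)) / of_nat j else 0)"
proof (rule fps_ext)
  fix j
  let ?F = "P [^]\<^bsub>poly_ring R\<^esub> (j div degree P)"
  show "fps_nth (fps_ln 1 oo local_series R f P) j =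
     fps_nth (Abs_fps (\<lambda>j. if 1 \<le> j \<and> degree P dvd j
                  then mangoldt_of R f (P [^]\<^bsub>poly_ring R\<^esub> (j div degree P)) / of_nat j else 0)) j"
  proof (cases "1 \<le> j \<and> degree P dvd j")
    case True
    then have "1 \<le> j div degree P"
      using monic_irreducible_degree(1)[OF P] by (auto simp: dvd_def)
    then have pp: "power_of_irreducible R P ?F"
      using P by (auto simp: power_of_irreducible_def)
    have "degree ?F = j"
      using degree_power[OF monic_irreducible_degree(2,3)[OF P]] True by simp
    then have "mangoldt_of R f ?F = of_nat j * fps_nth (fps_ln 1 oo local_series R f P) j"
      using pp irreducible_base_eq[OF pp] by (auto simp: mangoldt_of_def)
    then show ?thesis
      using True by simp
  next
    case False
    then have "j = 0 \<or> \<not> degree P dvd j" by auto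
    then have "fps_nth (fps_ln 1 oo local_series R f P) j = 0"
      using fps_nth_compose_eq_0[of "degree P" "local_series R f P" j]
      by (auto simp: local_series_def)
    then show ?thesis
      using False by auto
  qed
qed

end

theory Submission
  imports "HOL-Complex_Analysis.Conformal_Mappings" "HOL-Analysis.Kronecker_Approximation_Theorem" Defs
begin

text \<open>
  Comparing coefficients in the logarithmic derivative of the Euler product gives
  $n \sigma(n) = \sum_{k=1}^n \chi(k) \sigma(n-k)$, and the same identity for $f = 1$ gives
  $|\chi(k)| \le 1$. Nothing else about $f$ is needed, and replacing $\chi(k)$ by
  $\chi(k) e(-k\theta)$ one may take $\theta = 0$.

  Let $F_K$ be the exponential of the sum of $\chi(k) z^k / k$ over $k \le K$. Expressing
  $n \sigma(n)$ by the recurrence twice and applying Cauchy--Schwarz and Parseval on dyadic blocks,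
  one bounds $n |\sigma(n+\ell) - \sigma(n)|$ by $\log(2n/\ell)$ times the maximum of
  $|1 - z^\ell| |F_K(z)|$ on the unit circle, up to $O(\ell \log(2n/\ell))$. Moving to the radius $1 - 1/K$ and using
  the maximum modulus principle one may take $K = n - 1$.

  Since $|F_{n-1}|$ is maximal at $1$, $|F_{n-1}(e(\phi))|$ is at most the geometric mean of its
  values at $1$ and $e(\phi)$, hence at most the exponential of $\sum_{k<n} |\cos(\pi k \phi)| / k$.
  The Fourier series of $|\cos|$ turns this sum into a combination of logarithms of the distances
  of $r \phi$ to the integers. If $\phi$ is close to $a/b$ with $b$ of logarithmic size, only the
  multiples $r$ of $b$ matter: they contribute nothing positive for even $b$ and lead to the
  exponent $c_b$ for odd $b$. The factor $1 - z^\ell$ is small near $a/b$ when $b$ divides $\ell$,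
  so the critical case is the least odd $b$ that does not divide $\ell$.
\<close>

section \<open>The Fourier series of the absolute value of the cosine\<close>

text \<open>The exponents are means of |cos|. Over a full period the mean is 2/pi, which gives the
  generic size n powr (2/pi); over the points pi k / b with b odd it is c_b, which gives the size n
  powr c_b near a/b. Near b = 1 the excess c_1 - 2/pi = 1 - 2/pi is traded against the zero of 1 -
  z^l at 1; this leaves l powr (1 - 2/pi) and, after division by n, the first term of the bound.

  The number R of Fourier terms should be at least log n, since the truncation error 2/R multiplies
  a harmonic sum, but not much larger, since the denominators b run up to 2R and the estimate near
  a/b loses a factor b.

  The first use of the recurrence bounds one difference by the sum of all earlier ones; the second
  puts the weight 1/M on them, which lets mean squares be summed over dyadic blocks. Indices up to l
  contribute O(l) trivially, so only the blocks above l count: hence log (2n/l) and not log n. The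
  exponent A = 3 collects a square of log n from the circle bound and one more from the number of
  blocks.\<close>

definition sq_wave :: "nat \<Rightarrow> real \<Rightarrow> real" where
  "sq_wave R x = (\<Sum>r<R. sin (real (2*r+1) * x) / real (2*r+1))"

text \<open>\<open>sq_wave\<close> is a partial Fourier sum of the square wave pi/4 * sgn (sin x),
  so \<open>sin x\<close> times it approximates pi/4 * |sin x|. Product-to-sum formulas give cos (2
  r x) the coefficient 1 / (2 r + 1) - 1 / (2 r - 1) = - 2 / (4 r^2 - 1); the last cosine is left
  over.\<close>

lemma sin_times_sq_wave:
  "2 * sin x * sq_wave R x =
     1 - 2 * (\<Sum>r=1..R. cos (2 * real r * x) / (4 * (real r)^2 - 1)) - cos (2 * real R * x) / (2 * real R + 1)"
proof (induction R)
  case 0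
  then show ?case by (simp add: sq_wave_def)
next
  case (Suc R)
  have 1: "2 * sin x * sin (real (2*R+1) * x) = cos (2 * real R * x) - cos (2 * real (Suc R) * x)"
  proof -
    have "2 * real R * x = real (2*R+1) * x - x" "2 * real (Suc R) * x = real (2*R+1) * x + x"
      by (simp_all add: algebra_simps)
    then show ?thesis by (simp only: cos_add cos_diff) (simp add: algebra_simps)
  qed
  have 2: "4 * (real (Suc R))^2 - 1 = (2 * real R + 1) * (2 * real R + 3)"
    by (simp add: power2_eq_square algebra_simps)
  have "2 * sin x * sq_wave (Suc R) x
      = 2 * sin x * sq_wave R x + (2 * sin x * sin (real (2*R+1) * x)) / real (2*R+1)"
    by (simp add: sq_wave_def algebra_simps)
  also have "\<dots> = 1 - 2 * (\<Sum>r=1..R. cos (2 * real r * x) / (4 * (real r)^2 - 1))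
       - cos (2 * real (Suc R) * x) / (2 * real R + 1)"
    unfolding 1 Suc.IH by (simp add: diff_divide_distrib add.commute)
  also have "cos (2 * real (Suc R) * x) / (2 * real R + 1) =
      2 * (cos (2 * real (Suc R) * x) / (4 * (real (Suc R))^2 - 1)) + cos (2 * real (Suc R) * x) / (2 * real (Suc R) + 1)"
  proof -
    have "c / (2 * real R + 1) = 2 * (c / ((2 * real R + 1) * (2 * real R + 3))) + c / (2 * real R + 3)" for c
      by (simp add: divide_simps) (simp add: algebra_simps)
    moreover have "2 * real (Suc R) + 1 = 2 * real R + 3" by simp
    ultimately show ?thesis unfolding 2 by simp
  qed
  finally show ?case
    by (simp add: algebra_simps)
qed

lemma sq_wave_deriv_sum: "2 * sin x * (\<Sum>r<R. cos (real (2*r+1) * x)) = sin (2 * real R * x)"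
proof (induction R)
  case (Suc R)
  have "2 * real R * x = real (2*R+1) * x - x" "2 * real (Suc R) * x = real (2*R+1) * x + x"
    by (simp_all add: algebra_simps)
  then have "2 * sin x * cos (real (2*R+1) * x) = sin (2 * real (Suc R) * x) - sin (2 * real R * x)"
    by (simp only: sin_add sin_diff) (simp add: algebra_simps)
  then show ?case using Suc by (simp add: algebra_simps)
qed simp

text \<open>At pi/2 the wave is the Leibniz series for pi/4, whose error is at most the first
  omitted term.\<close>

lemma sq_wave_pi_half: "\<bar>sq_wave R (pi/2) - pi/4\<bar> \<le> 1 / (2 * real R + 1)"
proof -
  have s: "sin (real (2*r+1) * (pi/2)) = (-1)^r" for r
  proof -
    have "real (2*r+1) * (pi/2) = real r * pi + pi/2" by (simp add: algebra_simps)
    then show ?thesis by (simp only: sin_add) simp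
  qed
  define a where "a = (\<lambda>r::nat. 1 / real (r*2+1))"
  have S: "sq_wave R (pi/2) = (\<Sum>r<R. (-1)^r * a r)"
    unfolding sq_wave_def s a_def by (simp add: mult.commute)
  have a0: "a \<longlonglongrightarrow> 0" unfolding a_def by real_asymp
  have an: "a r \<ge> 0" "a (Suc r) \<le> a r" for r by (auto simp: a_def frac_le)
  have P: "pi/4 = (\<Sum>k. (-1)^k * a k)" using pi_series by (simp add: a_def)
  note L = summable_Leibniz'[of a, OF a0 an]
  have aR: "a R = 1 / (2 * real R + 1)" by (simp add: a_def mult.commute)
  have "\<bar>(\<Sum>r<R. (-1)^r * a r) - (\<Sum>k. (-1)^k * a k)\<bar> \<le> a R"
  proof (cases "even R")
    case True
    then obtain k where k: "R = 2*k" by auto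
    have "(\<Sum>r<2*k+1. (-1)^r * a r) = (\<Sum>r<R. (-1)^r * a r) + a R" using k by simp
    then show ?thesis using L(2)[of k] L(4)[of k] an(1)[of R] k by (simp add: lessThan_atLeast0)
  next
    case False
    then obtain k where k: "R = 2*k+1" by (auto elim: oddE)
    have "(\<Sum>r<2*Suc k. (-1)^r * a r) = (\<Sum>r<R. (-1)^r * a r) - a R" using k by simp
    then show ?thesis using L(2)[of "Suc k"] L(4)[of k] an(1)[of R] k by (simp add: lessThan_atLeast0)
  qed
  then show ?thesis unfolding S P aR by simp
qed

text \<open>Near 0 the wave itself does not converge uniformly (Gibbs phenomenon); the factor
  \<open>sin x\<close> compensates for this. The point pi/2 is the reference because the value there
  is known from the Leibniz series.\<close>

lemma sq_wave_near:
  assumes "0 < x" "x \<le> pi/2" "R \<ge> 1"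
  shows "sin x * \<bar>sq_wave R x - sq_wave R (pi/2)\<bar> \<le> 1 / (2 * real R)"
proof -
  have sp: "sin y > 0" if "x \<le> y" "y \<le> pi/2" for y using that assms by (intro sin_gt_zero) auto
  have cp: "cos y \<ge> 0" if "x \<le> y" "y \<le> pi/2" for y using that assms by (intro cos_ge_zero) auto
  have R: "real R > 0" using assms by simp
  \<comment> \<open>The correction term removes the oscillation of the derivative of the wave up to order $1/R$; the
    remaining derivative is dominated by that of the monotone function $-1/(4 R \sin y)$.\<close>
  define H where "H = (\<lambda>y. sq_wave R y + cos (2 * real R * y) / (4 * real R * sin y))"
  define H' where "H' = (\<lambda>y. - cos (2 * real R * y) * cos y / (4 * real R * (sin y)^2))"
  have dW: "(sq_wave R has_real_derivative (\<Sum>r<R. cos (real (2*r+1) * y))) (at y)" for y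
    unfolding sq_wave_def
    by (rule derivative_eq_intros refl | simp)+
  have W: "(\<Sum>r<R. cos (real (2*r+1) * y)) = sin (2 * real R * y) / (2 * sin y)" if "sin y > 0" for y
    using sq_wave_deriv_sum[of y R] that by (simp add: field_simps)
  have dH: "(H has_real_derivative H' y) (at y)" if "x \<le> y" "y \<le> pi/2" for y
  proof -
    have "((\<lambda>y. cos (2 * real R * y) / (4 * real R * sin y)) has_real_derivative
       ((- sin (2 * real R * y) * (2 * real R)) * (4 * real R * sin y) - cos (2 * real R * y) * (4 * real R * cos y)) / (4 * real R * sin y)^2) (at y)"
      using sp[OF that] R by (auto intro!: derivative_eq_intros simp: power2_eq_square)
    then have "(H has_real_derivative sin (2 * real R * y) / (2 * sin y) + ((- sin (2 * real R * y) * (2 * real R)) * (4 * real R * sin y) - cos (2 * real R * y) * (4 * real R * cos y)) / (4 * real R * sin y)^2) (at y)"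
      unfolding H_def using dW[of y] unfolding W[OF sp[OF that]] by (intro DERIV_add)
    also have "sin (2 * real R * y) / (2 * sin y) + ((- sin (2 * real R * y) * (2 * real R)) * (4 * real R * sin y) - cos (2 * real R * y) * (4 * real R * cos y)) / (4 * real R * sin y)^2 = H' y"
      unfolding H'_def using sp[OF that] R by (simp add: divide_simps power2_eq_square)
    finally show ?thesis .
  qed
  have dG: "((\<lambda>y. - 1 / (4 * real R * sin y)) has_real_derivative cos y / (4 * real R * (sin y)^2)) (at y)" if "x \<le> y" "y \<le> pi/2" for y
    using sp[OF that] R by (auto intro!: derivative_eq_intros simp: power2_eq_square divide_simps)
  have b: "\<bar>H' y\<bar> \<le> cos y / (4 * real R * (sin y)^2)" if "x \<le> y" "y \<le> pi/2" for y
  proof -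
    have "\<bar>H' y\<bar> = \<bar>cos (2 * real R * y)\<bar> * cos y / (4 * real R * (sin y)^2)"
      using cp[OF that] R by (simp add: H'_def abs_mult)
    also have "\<dots> \<le> 1 * cos y / (4 * real R * (sin y)^2)"
      using cp[OF that] R by (intro divide_right_mono mult_right_mono) auto
    finally show ?thesis by simp
  qed
  have up: "H x - (- 1 / (4 * real R * sin x)) \<ge> H (pi/2) - (- 1 / (4 * real R * sin (pi/2)))"
    by (rule DERIV_nonpos_imp_nonincreasing[OF assms(2)])
       (use DERIV_diff[OF dH dG] b in \<open>fastforce simp: abs_le_iff\<close>)
  have lo: "H x + (- 1 / (4 * real R * sin x)) \<le> H (pi/2) + (- 1 / (4 * real R * sin (pi/2)))"
    by (rule DERIV_nonneg_imp_nondecreasing[OF assms(2)])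
       (use DERIV_add[OF dH dG] b in \<open>fastforce simp: abs_le_iff\<close>)
  define u where "u = 1 / (4 * real R)"
  have s: "0 < sin x" "sin x \<le> 1" using sp[of x] assms by auto
  have "\<bar>H x - H (pi/2)\<bar> \<le> u / sin x - u"
    using up lo by (simp add: u_def abs_le_iff algebra_simps)
  then have 1: "sin x * \<bar>H x - H (pi/2)\<bar> \<le> u - u * sin x"
    using s by (simp add: field_simps mult_left_mono)
  have "sq_wave R x - sq_wave R (pi/2) = (H x - H (pi/2)) - u * cos (2 * real R * x) / sin x + u * cos (real R * pi)"
    by (simp add: H_def u_def)
  then have "sin x * (sq_wave R x - sq_wave R (pi/2)) = sin x * (H x - H (pi/2)) - u * cos (2 * real R * x) + u * sin x * cos (real R * pi)"
    using s by (simp add: divide_simps) (simp add: algebra_simps)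
  moreover have "\<bar>u * cos (2 * real R * x)\<bar> \<le> u * 1" "\<bar>u * sin x * cos (real R * pi)\<bar> \<le> u * sin x * 1"
    using s R unfolding abs_mult by (auto simp: u_def intro!: mult_mono divide_right_mono)
  moreover have "\<bar>sin x * (H x - H (pi/2))\<bar> \<le> u - u * sin x"
    using 1 s by (simp add: abs_mult)
  ultimately have "\<bar>sin x * (sq_wave R x - sq_wave R (pi/2))\<bar> \<le> 2 * u"
    by linarith
  then show ?thesis using s by (simp add: abs_mult u_def)
qed

lemma sin_sq_wave_first_quadrant:
  assumes "0 < x" "x \<le> pi/2" "R \<ge> 1"
  shows "\<bar>sin x * sq_wave R x - pi/4 * \<bar>sin x\<bar>\<bar> \<le> 1 / real R"
proof -
  have s: "0 < sin x" "sin x \<le> 1" using assms by (auto intro: sin_gt_zero)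
  have "sin x * sq_wave R x - pi/4 * \<bar>sin x\<bar> = sin x * (sq_wave R x - sq_wave R (pi/2)) + sin x * (sq_wave R (pi/2) - pi/4)"
    using s by (simp add: algebra_simps)
  moreover have "\<bar>sin x * (sq_wave R x - sq_wave R (pi/2))\<bar> \<le> 1 / (2 * real R)"
    using sq_wave_near[OF assms] s by (simp add: abs_mult)
  moreover have "\<bar>sin x * (sq_wave R (pi/2) - pi/4)\<bar> \<le> 1 * (1 / (2 * real R + 1))"
    unfolding abs_mult using sq_wave_pi_half[of R] s by (intro mult_mono) auto
  moreover have "1 / (2 * real R + 1) \<le> 1 / (2 * real R)" using assms by (simp add: frac_le)
  moreover have "1 / real R = 1 / (2 * real R) + 1 / (2 * real R)" by simp
  ultimately show ?thesis by linarith
qed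

lemma sq_wave_uminus: "sq_wave R (-x) = - sq_wave R x"
  by (simp add: sq_wave_def sum_negf)

lemma sq_wave_pi: "sq_wave R (x + of_int k * pi) = (if even k then 1 else -1) * sq_wave R x"
proof -
  have "sin (real (2*r+1) * (x + of_int k * pi)) = (if even k then 1 else -1) * sin (real (2*r+1) * x)" for r
  proof -
    have e: "real (2*r+1) * (x + of_int k * pi) = real (2*r+1) * x + pi * of_int ((2 * int r + 1) * k)"
      by (simp add: algebra_simps)
    have "sin (pi * of_int ((2 * int r + 1) * k)) = 0"
      by (rule sin_npi_int)
    moreover have "cos (pi * of_int ((2 * int r + 1) * k)) = (if even k then 1 else -1)"
      unfolding cos_npi_int by simp
    ultimately show ?thesis unfolding e sin_add by simp
  qed
  then show ?thesis unfolding sq_wave_def by (simp add: sum_negf)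
qed

lemma sin_sq_wave:
  assumes "R \<ge> 1"
  shows "\<bar>sin x * sq_wave R x - pi/4 * \<bar>sin x\<bar>\<bar> \<le> 1 / real R"
proof -
  \<comment> \<open>Translation by a multiple of pi multiplies \<open>sin\<close> and
    \<open>sq_wave\<close> by the same sign, and both are odd, so their product depends only on the
    distance of x to the nearest multiple of pi.\<close>
  define k where "k = round (x / pi)"
  define y where "y = x - of_int k * pi"
  have y: "\<bar>y\<bar> \<le> pi/2"
  proof -
    have "\<bar>of_int k - x / pi\<bar> \<le> 1/2" unfolding k_def by (rule of_int_round_abs_le)
    then have "\<bar>of_int k - x / pi\<bar> * pi \<le> 1/2 * pi" by (intro mult_right_mono) auto
    also have "\<bar>of_int k - x / pi\<bar> * pi = \<bar>(of_int k - x / pi) * pi\<bar>" by (simp add: abs_mult)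
    also have "(of_int k - x / pi) * pi = - y" by (simp add: y_def algebra_simps)
    finally show ?thesis by simp
  qed
  have x: "x = y + of_int k * pi" by (simp add: y_def)
  have "sin x = (if even k then 1 else -1) * sin y"
    unfolding x sin_add using cos_npi_int[of k] sin_npi_int[of k] by (simp add: mult.commute)
  then have e: "sin x * sq_wave R x = sin y * sq_wave R y" "\<bar>sin x\<bar> = \<bar>sin y\<bar>"
    using sq_wave_pi[of R y k] x by auto
  have "sin \<bar>y\<bar> * sq_wave R \<bar>y\<bar> = sin y * sq_wave R y" "\<bar>sin \<bar>y\<bar>\<bar> = \<bar>sin y\<bar>"
    by (auto simp: abs_if sq_wave_uminus)
  moreover have "\<bar>sin \<bar>y\<bar> * sq_wave R \<bar>y\<bar> - pi/4 * \<bar>sin \<bar>y\<bar>\<bar>\<bar> \<le> 1 / real R"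
    using sin_sq_wave_first_quadrant[of "\<bar>y\<bar>" R] y assms by (cases "y = 0") auto
  ultimately show ?thesis unfolding e by simp
qed

lemma abs_sin_fourier:
  assumes "R \<ge> 1"
  shows "\<bar>\<bar>sin x\<bar> - (2/pi - 4/pi * (\<Sum>r=1..R. cos (2 * real r * x) / (4 * (real r)^2 - 1)))\<bar> \<le> 2 / real R"
proof -
  define S where "S = (\<Sum>r=1..R. cos (2 * real r * x) / (4 * (real r)^2 - 1))"
  define c where "c = cos (2 * real R * x) / (2 * real R + 1)"
  have R: "real R \<ge> 1" using assms by simp
  have aux: "\<bar>w - (1/2 - S)\<bar> \<le> v + u / 2"
    if "a = 1/2 - S - c/2" "\<bar>c\<bar> \<le> u" "\<bar>a - w\<bar> \<le> v" for a w u v :: real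
    using that by linarith
  have "sin x * sq_wave R x = 1/2 - S - c/2"
    using sin_times_sq_wave[of x R] unfolding S_def[symmetric] c_def[symmetric] by linarith
  moreover have "\<bar>c\<bar> \<le> 1 / (2 * real R)"
    unfolding c_def abs_divide using R by (intro frac_le) auto
  ultimately have "\<bar>pi/4 * \<bar>sin x\<bar> - (1/2 - S)\<bar> \<le> 1 / real R + 1 / (2 * real R) / 2"
    using sin_sq_wave[OF assms, of x] by (rule aux)
  then have "\<bar>pi/4 * \<bar>sin x\<bar> - (1/2 - S)\<bar> * (4/pi) \<le> (1 / real R + 1 / (2 * real R) / 2) * (4/pi)"
    by (intro mult_right_mono) auto
  also have "\<bar>pi/4 * \<bar>sin x\<bar> - (1/2 - S)\<bar> * (4/pi) = \<bar>(pi/4 * \<bar>sin x\<bar> - (1/2 - S)) * (4/pi)\<bar>"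
    by (simp only: abs_mult[of _ "4/pi"]) simp
  also have "(pi/4 * \<bar>sin x\<bar> - (1/2 - S)) * (4/pi) = \<bar>sin x\<bar> - (2/pi - 4/pi * S)"
    by (simp add: field_simps)
  also have "(1 / real R + 1 / (2 * real R) / 2) * (4/pi) = (5 / pi) / real R"
    using R by (simp add: field_simps)
  also have "\<dots> \<le> 2 / real R"
    using pi_gt3 R by (intro divide_right_mono) (auto simp: field_simps)
  finally show ?thesis unfolding S_def .
qed

lemma abs_cos_fourier:
  assumes "R \<ge> 1"
  shows "\<bar>\<bar>cos x\<bar> - (2/pi + 4/pi * (\<Sum>r=1..R. (-1)^Suc r / (4 * (real r)^2 - 1) * cos (2 * real r * x)))\<bar> \<le> 2 / real R"
proof -
  have "cos (2 * real r * (x + pi/2)) = (-1)^r * cos (2 * real r * x)" for r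
  proof -
    have "2 * real r * (x + pi/2) = 2 * real r * x + real r * pi" by (simp add: algebra_simps)
    then show ?thesis by (simp only: cos_add) simp
  qed
  then have "(\<Sum>r=1..R. cos (2 * real r * (x + pi/2)) / (4 * (real r)^2 - 1)) =
     - (\<Sum>r=1..R. (-1)^Suc r / (4 * (real r)^2 - 1) * cos (2 * real r * x))"
    by (simp add: sum_negf)
  moreover have "sin (x + pi/2) = cos x" by (simp add: sin_add)
  ultimately show ?thesis using abs_sin_fourier[OF assms, of "x + pi/2"] by (simp only:)
qed

text \<open>At x = 0 the left side of \<open>sin_times_sq_wave\<close> vanishes, and the identity
  evaluates the sum.\<close>

lemma sum_coeff_le_half: "(\<Sum>r=1..R. 1 / (4 * (real r)^2 - 1)) \<le> 1/2"
proof -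
  have "1 - 2 * (\<Sum>r=1..R. 1 / (4 * (real r)^2 - 1)) = 1 / (2 * real R + 1)"
    using sin_times_sq_wave[of 0 R] by simp
  moreover have "1 / (2 * real R + 1) \<ge> 0" by simp
  ultimately show ?thesis by linarith
qed

section \<open>Cosine sums and rational approximation\<close>

text \<open>Together with \<open>geometric_tail_le\<close> this exchanges a sharp cutoff at K for
  the damping factor t^k: with 1 - t = 1/K the head changes by at most 1 and the damped tail is at
  most 1.\<close>

lemma smoothing_head:
  assumes "0 \<le> t" "t \<le> (1::real)"
  shows "(\<Sum>k=1..K. (1 - t^k) / real k) \<le> real K * (1 - t)"
proof -
  have "(1 - t^k) / real k \<le> 1 - t" if "k \<ge> 1" for k
  proof -
    have "1 - t^k = (1 - t) * (\<Sum>i<k. t^i)" by (simp add: one_diff_power_eq)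
    also have "\<dots> \<le> (1 - t) * (\<Sum>i<k. 1)"
      using assms by (intro mult_left_mono sum_mono power_le_one) auto
    finally show ?thesis using that by (simp add: field_simps)
  qed
  then have "(\<Sum>k=1..K. (1 - t^k) / real k) \<le> (\<Sum>k=1..K. 1 - t)"
    by (intro sum_mono) auto
  then show ?thesis by simp
qed

lemma geometric_tail_le:
  assumes "0 \<le> t" "t < (1::real)" "K \<ge> 1"
  shows "(\<Sum>k=K..N. t^k / real k) \<le> 1 / (real K * (1 - t))"
proof -
  have "(\<Sum>k=K..N. t^k / real k) \<le> (\<Sum>k=K..N. t^k / real K)"
    using assms by (intro sum_mono divide_left_mono) auto
  also have "\<dots> = (\<Sum>k=K..N. t^k) / real K" by (simp add: sum_divide_distrib)
  also have "(\<Sum>k=K..N. t^k) \<le> (\<Sum>k. t^k)"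
    using assms by (intro sum_le_suminf summable_geometric) auto
  also have "(\<Sum>k. t^k) = 1 / (1 - t)" using assms by (intro suminf_geometric) auto
  finally show ?thesis using assms by (simp add: divide_right_mono field_simps)
qed

text \<open>Up to a bounded error this is $\log \min(n, 1/\|\alpha\|)$, where $\|\alpha\|$ is the distance to the nearest integer.\<close>
definition log_dist :: "nat \<Rightarrow> real \<Rightarrow> real" where
  "log_dist n \<alpha> = - ln (cmod (1 - of_real (1 - 1 / real n) * cis (2 * pi * \<alpha>)))"

text \<open>With t = 1 - 1/n the damped cosine series is the real part of - log (1 - t e(\<alpha>)),
  which is \<open>log_dist n \<alpha>\<close>. Damping the terms below n costs 1, and the tail from
  n on costs 1.\<close>

lemma sum_cos_log_dist:
  assumes "n \<ge> 2"
  shows "\<bar>(\<Sum>k=1..n-1. cos (2 * pi * \<alpha> * real k) / real k) - log_dist n \<alpha>\<bar> \<le> 2"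
proof -
  define t where "t = 1 - 1 / real n"
  have t: "0 \<le> t" "t < 1" using assms by (auto simp: t_def)
  define z where "z = of_real t * cis (2 * pi * \<alpha>)"
  have z: "cmod z < 1" using t by (simp add: z_def norm_mult)
  have nz: "1 - z \<noteq> 0" using z by auto
  have zk: "Re (z^k) = t^k * cos (2 * pi * \<alpha> * real k)" for k
    by (simp add: z_def power_mult_distrib Complex.DeMoivre mult.commute flip: of_real_power)
  have "(\<lambda>k. - ((- (-z))^k) / of_nat k) sums ln (1 + (-z))"
    using z by (intro Ln_series') auto
  then have "(\<lambda>k. Re (- ((- (-z))^k) / of_nat k)) sums Re (ln (1 + (-z)))"
    by (rule sums_Re)
  then have "(\<lambda>k. - (- (t^k * cos (2 * pi * \<alpha> * real k)) / real k)) sums - Re (ln (1 - z))"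
    by (intro sums_minus) (simp add: zk)
  then have s: "(\<lambda>k. t^k * cos (2 * pi * \<alpha> * real k) / real k) sums log_dist n \<alpha>"
    using nz by (simp add: log_dist_def z_def t_def)
  then have s': "(\<lambda>k. (\<Sum>k<k. t^k * cos (2 * pi * \<alpha> * real k) / real k)) \<longlonglongrightarrow> log_dist n \<alpha>"
    by (simp add: sums_def)
  have "\<bar>(\<Sum>k=1..n-1. cos (2 * pi * \<alpha> * real k) / real k) - (\<Sum>k<N. t^k * cos (2 * pi * \<alpha> * real k) / real k)\<bar> \<le> 2"
    if "N \<ge> n" for N
  proof -
    let ?c = "\<lambda>k. cos (2 * pi * \<alpha> * real k)"
    define M where "M = N - 1"
    have M: "N = Suc M" using that assms by (simp add: M_def)
    have "{..<N} = insert 0 ({1..n-1} \<union> {n..M})" using M that assms by auto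
    moreover have "{1..n-1} \<inter> {n..M} = {}" using assms by auto
    ultimately have "(\<Sum>k<N. t^k * ?c k / real k) = (\<Sum>k=1..n-1. t^k * ?c k / real k) + (\<Sum>k=n..M. t^k * ?c k / real k)"
      using assms by (simp add: sum.union_disjoint)
    then have "\<bar>(\<Sum>k=1..n-1. ?c k / real k) - (\<Sum>k<N. t^k * ?c k / real k)\<bar> =
       \<bar>(\<Sum>k=1..n-1. (1 - t^k) / real k * ?c k) - (\<Sum>k=n..M. t^k / real k * ?c k)\<bar>"
      by (simp add: sum_subtractf algebra_simps diff_divide_distrib)
    also have "\<dots> \<le> \<bar>\<Sum>k=1..n-1. (1 - t^k) / real k * ?c k\<bar> + \<bar>\<Sum>k=n..M. t^k / real k * ?c k\<bar>"
      by linarith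
    also have "\<dots> \<le> (\<Sum>k=1..n-1. (1 - t^k) / real k) + (\<Sum>k=n..M. t^k / real k)"
      using t by (intro add_mono sum_abs[THEN order_trans] sum_mono)
         (auto simp: abs_mult power_le_one intro!: divide_right_mono mult_left_le)
    also have "(\<Sum>k=1..n-1. (1 - t^k) / real k) \<le> 1"
    proof -
      have "(\<Sum>k=1..n-1. (1 - t^k) / real k) \<le> real (n-1) * (1 - t)"
        using t by (intro smoothing_head) auto
      also have "\<dots> \<le> 1" using assms by (simp add: t_def)
      finally show ?thesis .
    qed
    also have "(\<Sum>k=n..M. t^k / real k) \<le> 1"
      using geometric_tail_le[of t n M] t assms by (simp add: t_def)
    finally show ?thesis by simp
  qed
  then have ev: "\<forall>\<^sub>F N in sequentially. \<bar>(\<Sum>k=1..n-1. cos (2 * pi * \<alpha> * real k) / real k) - (\<Sum>k<N. t^k * cos (2 * pi * \<alpha> * real k) / real k)\<bar> \<le> 2"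
    using eventually_ge_at_top[of n] by (rule eventually_mono[rotated]) auto
  show ?thesis
    by (rule tendsto_upperbound[OF _ ev]) (intro tendsto_intros s', simp)
qed

section \<open>Elementary bounds for \<open>log_dist\<close>\<close>

lemma log_dist_le:
  assumes "n \<ge> 2"
  shows "log_dist n \<alpha> \<le> ln (real n)"
proof -
  have "1 / real n = cmod 1 - cmod (of_real (1 - 1 / real n) * cis (2 * pi * \<alpha>))"
    using assms by (simp only: norm_mult norm_of_real) simp
  also have "\<dots> \<le> cmod (1 - of_real (1 - 1 / real n) * cis (2 * pi * \<alpha>))"
    by (rule norm_triangle_ineq2)
  finally have "ln (1 / real n) \<le> ln (cmod (1 - of_real (1 - 1 / real n) * cis (2 * pi * \<alpha>)))"
    using assms by (intro ln_mono) auto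
  then show ?thesis using assms by (simp add: log_dist_def ln_div)
qed

lemma log_dist_arg_pos:
  assumes "n \<ge> 2"
  shows "0 < cmod (1 - of_real (1 - 1 / real n) * cis (2 * pi * \<alpha>))"
proof -
  have "cmod (of_real (1 - 1 / real n) * cis (2 * pi * \<alpha>)) < 1"
    using assms by (simp only: norm_mult norm_of_real) simp
  then show ?thesis by auto
qed

lemma norm_one_minus_cis: "cmod (1 - cis x) = 2 * \<bar>sin (x / 2)\<bar>"
proof -
  have "cmod (1 - cis x) ^ 2 = (1 - cos x)^2 + (sin x)^2" by (simp add: cmod_power2)
  also have "\<dots> = 2 - 2 * cos x" by (simp add: power2_eq_square algebra_simps sin_cos_squared_add3)
  also have "cos x = 1 - 2 * (sin (x/2))^2" using cos_double_sin[of "x/2"] by simp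
  finally have "cmod (1 - cis x) ^ 2 = (2 * \<bar>sin (x / 2)\<bar>)^2" by (simp add: power_mult_distrib)
  then show ?thesis by (rule power2_eq_imp_eq) auto
qed

lemma log_dist_ge:
  assumes "n \<ge> 2"
  shows "log_dist n \<alpha> \<ge> - ln (1 / real n + 2 * pi * \<bar>\<alpha>\<bar>)"
proof -
  have "1 - of_real (1 - 1 / real n) * cis (2 * pi * \<alpha>) = of_real (1 / real n) + of_real (1 - 1 / real n) * (1 - cis (2 * pi * \<alpha>))"
    by (simp add: algebra_simps)
  then have "cmod (1 - of_real (1 - 1 / real n) * cis (2 * pi * \<alpha>)) \<le> cmod (of_real (1 / real n)) + cmod (of_real (1 - 1 / real n) * (1 - cis (2 * pi * \<alpha>)))"
    by (simp only: norm_triangle_ineq)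
  also have "\<dots> = 1 / real n + (1 - 1 / real n) * cmod (1 - cis (2 * pi * \<alpha>))"
    using assms by (simp only: norm_mult norm_of_real) simp
  also have "\<dots> \<le> 1 / real n + 1 * cmod (1 - cis (2 * pi * \<alpha>))"
    by (intro add_left_mono mult_right_mono) auto
  also have "cmod (1 - cis (2 * pi * \<alpha>)) \<le> \<bar>2 * pi * \<alpha>\<bar>"
    unfolding norm_one_minus_cis using abs_sin_x_le_abs_x[of "2 * pi * \<alpha> / 2"] by simp
  finally have "cmod (1 - of_real (1 - 1 / real n) * cis (2 * pi * \<alpha>)) \<le> 1 / real n + 2 * pi * \<bar>\<alpha>\<bar>"
    by (simp add: abs_mult)
  then show ?thesis unfolding log_dist_def using log_dist_arg_pos[OF assms, of \<alpha>]
    by (simp add: ln_mono)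
qed

lemma log_dist_ge_ln2: "n \<ge> 2 \<Longrightarrow> log_dist n \<alpha> \<ge> - ln 2"
proof -
  assume n: "n \<ge> 2"
  have "cmod (1 - of_real (1 - 1 / real n) * cis (2 * pi * \<alpha>)) \<le> cmod 1 + cmod (of_real (1 - 1 / real n) * cis (2 * pi * \<alpha>))"
    by (rule norm_triangle_ineq4)
  also have "\<dots> \<le> 2" using n by (simp only: norm_mult norm_of_real) simp
  finally show ?thesis using log_dist_arg_pos[OF n, of \<alpha>] by (simp add: log_dist_def ln_mono)
qed

text \<open>The reason is |1 - t e(\<alpha>)|^2 = (1 - t)^2 + 4 t sin^2 (pi \<alpha>), where t = 1 -
  1/n is at least 1/2.\<close>

lemma log_dist_le_sin:
  assumes "n \<ge> 2" "sin (pi * \<alpha>) \<noteq> 0"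
  shows "log_dist n \<alpha> \<le> - ln \<bar>sin (pi * \<alpha>)\<bar>"
proof -
  define t where "t = 1 - 1 / real n"
  have t: "t \<ge> 1/2" using assms by (simp add: t_def field_simps)
  have "cmod (1 - of_real t * cis (2 * pi * \<alpha>)) ^ 2 = (1 - t * cos (2 * pi * \<alpha>))^2 + (t * sin (2 * pi * \<alpha>))^2"
    by (simp add: cmod_power2)
  also have "\<dots> = 1 - 2 * t * cos (2 * pi * \<alpha>) + t^2 * ((cos (2 * pi * \<alpha>))^2 + (sin (2 * pi * \<alpha>))^2)"
    by (simp only: power_mult_distrib distrib_left) (simp add: power2_eq_square algebra_simps)
  also have "\<dots> = (1 - t)^2 + 4 * t * (sin (pi * \<alpha>))^2"
  proof -
    have c: "cos (2 * pi * \<alpha>) = 1 - 2 * (sin (pi * \<alpha>))^2"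
      using cos_double_sin[of "pi * \<alpha>"] by (simp add: mult.assoc)
    have "(cos (2 * pi * \<alpha>))^2 + (sin (2 * pi * \<alpha>))^2 = 1" by simp
    then show ?thesis unfolding c by (simp add: power2_eq_square algebra_simps)
  qed
  also have "\<dots> \<ge> 0 + 1 * (sin (pi * \<alpha>))^2"
    using t by (intro add_mono mult_right_mono) auto
  finally have "\<bar>sin (pi * \<alpha>)\<bar> ^ 2 \<le> cmod (1 - of_real t * cis (2 * pi * \<alpha>)) ^ 2" by simp
  then have "\<bar>sin (pi * \<alpha>)\<bar> \<le> cmod (1 - of_real t * cis (2 * pi * \<alpha>))"
    by (rule power2_le_imp_le) auto
  then show ?thesis using assms by (simp add: log_dist_def t_def ln_mono)
qed

text \<open>Needed twice: for the lower bound |sin (pi x)| \<ge> 2 |x| and for the monotonicity of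
  c_b. The derivative of sin u / u is (u cos u - sin u) / u^2, and sin u - u cos u grows from
  0.\<close>

lemma sin_times_antimono:
  fixes x y :: real
  assumes "0 < x" "x \<le> y" "y \<le> pi"
  shows "x * sin y \<le> y * sin x"
proof -
  have A: "u * cos u \<le> sin u" if u: "0 \<le> u" "u \<le> pi" for u :: real
  proof -
    have "sin 0 - 0 * cos 0 \<le> sin u - u * cos u"
    proof (rule DERIV_nonneg_imp_nondecreasing[OF u(1)])
      fix v assume v: "0 \<le> v" "v \<le> u"
      have "((\<lambda>v. sin v - v * cos v) has_real_derivative v * sin v) (at v)"
        by (auto intro!: derivative_eq_intros)
      moreover have "v * sin v \<ge> 0" using v u by (intro mult_nonneg_nonneg sin_ge_zero) auto
      ultimately show "\<exists>D. ((\<lambda>v. sin v - v * cos v) has_real_derivative D) (at v) \<and> 0 \<le> D" by blast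
    qed
    then show ?thesis by simp
  qed
  have "sin y / y \<le> sin x / x"
  proof (rule DERIV_nonpos_imp_nonincreasing[OF assms(2)])
    fix v assume v: "x \<le> v" "v \<le> y"
    have "((\<lambda>v. sin v / v) has_real_derivative (v * cos v - sin v) / (v * v)) (at v)"
      using v assms by (auto intro!: derivative_eq_intros simp: algebra_simps)
    moreover have "(v * cos v - sin v) / (v * v) \<le> 0"
      using A[of v] v assms by (intro divide_nonpos_nonneg) auto
    ultimately show "\<exists>D. ((\<lambda>v. sin v / v) has_real_derivative D) (at v) \<and> D \<le> 0" by blast
  qed
  then show ?thesis using assms by (simp add: field_simps)
qed

lemma abs_sin_pi_ge:
  assumes "\<bar>x\<bar> \<le> 1/2"
  shows "\<bar>sin (pi * x)\<bar> \<ge> 2 * \<bar>x\<bar>"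
proof -
  have "2 * y \<le> sin (pi * y)" if y: "0 < y" "y \<le> 1/2" for y
    using sin_times_antimono[of "pi * y" "pi / 2"] y by (simp add: field_simps)
  from this[of "\<bar>x\<bar>"] assms show ?thesis
    by (cases x "0 :: real" rule: linorder_cases) auto
qed

lemma abs_sin_pi_ge_dist:
  assumes "\<And>j::int. \<delta> \<le> \<bar>x - of_int j\<bar>"
  shows "\<bar>sin (pi * x)\<bar> \<ge> 2 * \<delta>"
proof -
  define j where "j = round x"
  have "\<bar>x - of_int j\<bar> \<le> 1/2" using of_int_round_abs_le[of x] by (simp add: j_def abs_minus_commute)
  then have "2 * \<bar>x - of_int j\<bar> \<le> \<bar>sin (pi * (x - of_int j))\<bar>" by (rule abs_sin_pi_ge)
  also have "sin (pi * (x - of_int j)) = sin (pi * x) * (if even j then 1 else -1)"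
    unfolding right_diff_distrib sin_diff by (simp add: sin_npi_int cos_npi_int)
  finally show ?thesis using assms[of j] by (auto simp: abs_mult split: if_splits)
qed

text \<open>Up to the factor 4/pi this is the Fourier coefficient of |cos x| at cos (2 r x), for r
  \<ge> 1. Its sign, positive for odd r and negative for even r, is the source of the later
  distinction by the parity of the denominator.\<close>

definition abs_cos_coeff :: "nat \<Rightarrow> real" where
  "abs_cos_coeff r = (-1)^Suc r / (4 * (real r)^2 - 1)"

lemma abs_cos_coeff_denom_pos: "r \<ge> 1 \<Longrightarrow> 4 * (real r)^2 - 1 > 0"
proof -
  assume "r \<ge> 1"
  then have "(real r)^2 \<ge> 1" by simp
  then show ?thesis by linarith
qed

lemma abs_cos_bounds:
  assumes "R \<ge> 1"
  defines "S \<equiv> \<lambda>x. \<Sum>r=1..R. abs_cos_coeff r * cos (2 * real r * x)"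
  shows "\<bar>cos x\<bar> \<le> 2/pi + 4/pi * S x + 2 / real R" "2/pi + 4/pi * S x \<le> \<bar>cos x\<bar> + 2 / real R"
  using abs_cos_fourier[OF assms(1), of x] unfolding S_def abs_cos_coeff_def by linarith+

lemma abs_abs_cos_coeff: "r \<ge> 1 \<Longrightarrow> \<bar>abs_cos_coeff r\<bar> = 1 / (4 * (real r)^2 - 1)"
  using abs_cos_coeff_denom_pos[of r] by (simp add: abs_cos_coeff_def abs_divide power_abs)

lemma sum_inverse_le_ln:
  "m \<ge> 1 \<Longrightarrow> (\<Sum>k=1..m. 1 / real k) \<le> 1 + ln (real m)"
proof (induction m rule: nat_induct_at_least)
  case (Suc m)
  have "ln (real m / real (Suc m)) \<le> real m / real (Suc m) - 1"
    using Suc by (intro ln_le_minus_one) auto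
  also have "\<dots> = - (1 / real (Suc m))" by (simp add: field_simps)
  finally have "1 / real (Suc m) \<le> ln (real (Suc m)) - ln (real m)"
    using Suc by (simp add: ln_div)
  then show ?case using Suc by simp
qed simp

text \<open>The truncation error 2/R is multiplied by a harmonic sum of size at most 1 + ln n, so R
  \<ge> ln n keeps it bounded. Replacing each cosine sum by \<open>log_dist\<close> costs 2
  |\<open>abs_cos_coeff r\<close>|, in total at most 1 by \<open>sum_coeff_le_half\<close>.\<close>

lemma sum_abs_cos_le:
  assumes "n \<ge> 2" "R \<ge> 1" "ln (real n) \<le> real R"
  shows "(\<Sum>k=1..n-1. \<bar>cos (pi * \<phi> * real k)\<bar> / real k)
     \<le> 2/pi * ln (real n) + 7 + 4/pi * (\<Sum>r=1..R. abs_cos_coeff r * log_dist n (real r * \<phi>))"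
proof -
  define H where "H = (\<Sum>k=1..n-1. 1 / real k)"
  have H: "0 \<le> H" "H \<le> 1 + ln (real n)"
  proof -
    have "H \<le> 1 + ln (real (n-1))" unfolding H_def using assms by (intro sum_inverse_le_ln) auto
    also have "ln (real (n-1)) \<le> ln (real n)" using assms by (intro ln_mono) auto
    finally show "H \<le> 1 + ln (real n)" by simp
  qed (auto simp: H_def intro: sum_nonneg)
  define C where "C = (\<lambda>r. \<Sum>k=1..n-1. cos (2 * pi * (real r * \<phi>) * real k) / real k)"
  have "(\<Sum>k=1..n-1. \<bar>cos (pi * \<phi> * real k)\<bar> / real k)
     \<le> (\<Sum>k=1..n-1. (2/pi + 4/pi * (\<Sum>r=1..R. abs_cos_coeff r * cos (2 * real r * (pi * \<phi> * real k))) + 2 / real R) / real k)"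
    using abs_cos_bounds(1)[OF assms(2), of "pi * \<phi> * real _"]
    by (intro sum_mono divide_right_mono) auto
  also have "\<dots> = (2/pi + 2 / real R) * H + 4/pi * (\<Sum>k=1..n-1. \<Sum>r=1..R. abs_cos_coeff r * (cos (2 * pi * (real r * \<phi>) * real k) / real k))"
    by (simp add: H_def sum.distrib sum_distrib_left sum_distrib_right sum_divide_distrib add_divide_distrib algebra_simps)
  also have "(\<Sum>k=1..n-1. \<Sum>r=1..R. abs_cos_coeff r * (cos (2 * pi * (real r * \<phi>) * real k) / real k))
     = (\<Sum>r=1..R. abs_cos_coeff r * C r)"
    unfolding C_def sum_distrib_left by (rule sum.swap)
  finally have 0: "(\<Sum>k=1..n-1. \<bar>cos (pi * \<phi> * real k)\<bar> / real k) \<le> (2/pi + 2 / real R) * H +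
     4/pi * (\<Sum>r=1..R. abs_cos_coeff r * C r)" .
  have "(\<Sum>r=1..R. abs_cos_coeff r * C r) \<le>
      (\<Sum>r=1..R. abs_cos_coeff r * log_dist n (real r * \<phi>) + 2 * (1 / (4 * (real r)^2 - 1)))"
  proof (intro sum_mono)
    fix r assume r: "r \<in> {1..R}"
    have "abs_cos_coeff r * (C r - log_dist n (real r * \<phi>)) \<le> \<bar>abs_cos_coeff r * (C r - log_dist n (real r * \<phi>))\<bar>"
      by simp
    also have "\<dots> = \<bar>C r - log_dist n (real r * \<phi>)\<bar> * (1 / (4 * (real r)^2 - 1))"
      using r by (simp add: abs_mult abs_abs_cos_coeff)
    also have "\<dots> \<le> 2 * (1 / (4 * (real r)^2 - 1))"
      using sum_cos_log_dist[OF assms(1), of "real r * \<phi>"] abs_cos_coeff_denom_pos[of r] r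
      unfolding C_def by (intro mult_right_mono) auto
    finally show "abs_cos_coeff r * C r \<le> abs_cos_coeff r * log_dist n (real r * \<phi>) + 2 * (1 / (4 * (real r)^2 - 1))"
      by (simp add: algebra_simps)
  qed
  also have "\<dots> = (\<Sum>r=1..R. abs_cos_coeff r * log_dist n (real r * \<phi>)) + 2 * (\<Sum>r=1..R. 1 / (4 * (real r)^2 - 1))"
    by (simp add: sum.distrib sum_distrib_left)
  also have "(\<Sum>r=1..R. 1 / (4 * (real r)^2 - 1)) \<le> 1/2" by (rule sum_coeff_le_half)
  finally have 1: "(\<Sum>r=1..R. abs_cos_coeff r * C r) \<le> (\<Sum>r=1..R. abs_cos_coeff r * log_dist n (real r * \<phi>)) + 1"
    by simp
  have "4/pi * (\<Sum>r=1..R. abs_cos_coeff r * C r) \<le> 4/pi * ((\<Sum>r=1..R. abs_cos_coeff r * log_dist n (real r * \<phi>)) + 1)"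
    using 1 by (intro mult_left_mono) auto
  note 1 = this[unfolded distrib_left]
  have "(2/pi + 2 / real R) * H \<le> (2/pi + 2 / real R) * (1 + ln (real n))"
    using H by (intro mult_left_mono) auto
  also have "\<dots> = 2/pi * ln (real n) + 2/pi + 2 / real R + 2 * (ln (real n) / real R)"
    by (simp add: algebra_simps add_divide_distrib)
  also have "\<dots> \<le> 2/pi * ln (real n) + 1 + 2 + 2 * 1"
    using assms pi_gt3 by (intro add_mono mult_left_mono) (auto simp: field_simps)
  finally have 2: "(2/pi + 2 / real R) * H \<le> 2/pi * ln (real n) + 5" by simp
  have "4/pi \<le> 2" using pi_gt3 by (simp add: field_simps)
  then show ?thesis using 0 1 2 by linarith
qed

section \<open>Averages over the residues modulo b\<close>

lemma cis_eq_1_iff: "cis x = 1 \<longleftrightarrow> (\<exists>n::int. x = of_int n * 2 * pi)"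
proof
  assume "cis x = 1"
  then have "cos x = 1" by (simp add: complex_eq_iff)
  then show "\<exists>n::int. x = of_int n * 2 * pi" by (simp add: cos_one_2pi_int)
next
  assume "\<exists>n::int. x = of_int n * 2 * pi"
  then obtain n :: int where "x = 2 * pi * of_int n" by (auto simp: mult_ac)
  then show "cis x = 1" by simp
qed

lemma sum_cis_residues:
  assumes "b \<ge> 1"
  shows "(\<Sum>k<b. cis (2 * pi * (of_int j / real b) * real k)) = (if int b dvd j then of_nat b else 0)"
proof -
  define w where "w = cis (2 * pi * (of_int j / real b))"
  have wk: "cis (2 * pi * (of_int j / real b) * real k) = w ^ k" for k
    by (simp add: w_def Complex.DeMoivre mult_ac)
  have wb: "w ^ b = 1"
    using assms by (simp add: w_def Complex.DeMoivre cis_multiple_2pi)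
  have "w = 1 \<longleftrightarrow> int b dvd j"
  proof
    assume "w = 1"
    then obtain n :: int where "2 * pi * (of_int j / real b) = of_int n * 2 * pi"
      unfolding w_def cis_eq_1_iff by auto
    then have "(of_int j :: real) = of_int (n * int b)" using assms by (simp add: field_simps)
    then have "j = n * int b" by (simp only: of_int_eq_iff)
    then show "int b dvd j" by simp
  next
    assume "int b dvd j"
    then obtain n where "j = int b * n" by auto
    then show "w = 1" using assms by (simp add: w_def cis_multiple_2pi)
  qed
  then show ?thesis
    unfolding wk using wb by (cases "w = 1") (simp_all add: sum_gp_strict)
qed

lemma sum_cos_residues:
  assumes "b \<ge> 1"
  shows "(\<Sum>k<b. cos (2 * pi * (real r / real b) * real k)) = (if b dvd r then real b else 0)"
proof -
  have "Re (\<Sum>k<b. cis (2 * pi * (of_int (int r) / real b) * real k)) = (\<Sum>k<b. cos (2 * pi * (real r / real b) * real k))"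
    by simp
  then show ?thesis unfolding sum_cis_residues[OF assms] by (auto split: if_splits)
qed

text \<open>This is the origin of c_b: the mean of |cos| over the points pi k / b. The symmetry of k
  and b - k removes the absolute values and leaves a Dirichlet kernel with 2h + 1 = b terms at the
  angle x = pi / (2b), whose numerator sin (b x) equals 1.\<close>

lemma sum_abs_cos_residues:
  assumes "odd b"
  shows "(\<Sum>k<b. \<bar>cos (pi * real k / real b)\<bar>) = real b * c_const b"
proof -
  obtain h where b: "b = 2 * h + 1" using assms by (auto elim: oddE)
  define x where "x = pi / (2 * real b)"
  have bpos: "real b > 0" using b by simp
  then have bx: "real b * x = pi / 2" by (simp add: x_def)
  have "pi * 1 < pi * (2 * real b)" using b by (intro mult_strict_left_mono) auto
  then have xs: "0 < x" "x < pi" using bpos by (simp_all add: x_def divide_less_eq)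
  then have sx: "sin x > 0" by (intro sin_gt_zero)
  have px: "pi * real k / real b = 2 * real k * x" for k by (simp add: x_def)
  have tel: "sin x * (1 + 2 * (\<Sum>k=1..m. cos (2 * real k * x))) = sin ((2 * real m + 1) * x)" for m
  proof (induction m)
    case (Suc m)
    have "(2 * real m + 1) * x = 2 * real (Suc m) * x - x" "(2 * real (Suc m) + 1) * x = 2 * real (Suc m) * x + x"
      by (simp_all add: algebra_simps)
    then have "2 * sin x * cos (2 * real (Suc m) * x) = sin ((2 * real (Suc m) + 1) * x) - sin ((2 * real m + 1) * x)"
      by (simp only: sin_add sin_diff) (simp add: algebra_simps)
    then show ?case using Suc by (simp add: algebra_simps)
  qed simp
  have "(\<Sum>k<b. \<bar>cos (pi * real k / real b)\<bar>) = (\<Sum>k\<in>insert 0 ({1..h} \<union> {h+1..2*h}). \<bar>cos (pi * real k / real b)\<bar>)"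
    using b by (intro sum.cong) auto
  also have "\<dots> = 1 + ((\<Sum>k=1..h. \<bar>cos (pi * real k / real b)\<bar>) + (\<Sum>k=h+1..2*h. \<bar>cos (pi * real k / real b)\<bar>))"
    by (subst sum.insert, simp, simp, subst sum.union_disjoint) auto
  also have "(\<Sum>k=h+1..2*h. \<bar>cos (pi * real k / real b)\<bar>) = (\<Sum>k=1..h. \<bar>cos (pi * real k / real b)\<bar>)"
  proof (rule sum.reindex_bij_witness[where i = "\<lambda>k. b - k" and j = "\<lambda>k. b - k"])
    fix k assume "k \<in> {h+1..2*h}"
    then have "pi * real (b - k) / real b = pi - pi * real k / real b"
      using b by (simp add: of_nat_diff field_simps)
    then show "\<bar>cos (pi * real (b - k) / real b)\<bar> = \<bar>cos (pi * real k / real b)\<bar>" by simp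
  qed (use b in auto)
  also have "(\<Sum>k=1..h. \<bar>cos (pi * real k / real b)\<bar>) = (\<Sum>k=1..h. cos (2 * real k * x))"
  proof (intro sum.cong refl)
    fix k assume k: "k \<in> {1..h}"
    have "2 * real k * x \<le> real b * x" using k b xs by (intro mult_right_mono) auto
    then have "2 * real k * x \<le> pi / 2" using bx by simp
    moreover have "0 \<le> 2 * real k * x" using xs by simp
    then have "- (pi / 2) \<le> 2 * real k * x" using pi_gt_zero by linarith
    ultimately have "cos (2 * real k * x) \<ge> 0" by (intro cos_ge_zero)
    then show "\<bar>cos (pi * real k / real b)\<bar> = cos (2 * real k * x)" unfolding px by simp
  qed
  finally have "(\<Sum>k<b. \<bar>cos (pi * real k / real b)\<bar>) = 1 + 2 * (\<Sum>k=1..h. cos (2 * real k * x))" by simp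
  moreover have "(2 * real h + 1) * x = pi / 2" using bx b by (simp add: algebra_simps)
  ultimately have "sin x * (\<Sum>k<b. \<bar>cos (pi * real k / real b)\<bar>) = 1"
    using tel[of h] by (simp only: sin_pi_half)
  then show ?thesis using sx bpos unfolding c_const_def x_def[symmetric] by (simp add: field_simps)
qed

text \<open>Averaging the Fourier expansion over the points $\pi k / b$ isolates the multiples of $b$.\<close>
lemma sum_coeff_multiples_le:
  assumes "odd b" "R \<ge> 1"
  shows "(\<Sum>r\<in>{1..R} \<inter> {r. b dvd r}. abs_cos_coeff r) \<le> pi/4 * (c_const b - 2/pi + 2 / real R)"
proof -
  have b: "b \<ge> 1" using assms by (cases b) auto
  have "real b * (2/pi + 4/pi * (\<Sum>r\<in>{1..R} \<inter> {r. b dvd r}. abs_cos_coeff r)) =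
     real b * (2/pi) + 4/pi * (\<Sum>r=1..R. abs_cos_coeff r * (if b dvd r then real b else 0))"
    by (simp add: sum.inter_restrict sum_distrib_left distrib_left if_distrib[of "\<lambda>x. _ * x"] mult_ac cong: if_cong)
  also have "\<dots> = real b * (2/pi) + 4/pi * (\<Sum>r=1..R. \<Sum>k<b. abs_cos_coeff r * cos (2 * real r * (pi * real k / real b)))"
    unfolding sum_cos_residues[OF b, symmetric] by (simp add: sum_distrib_left mult_ac)
  also have "\<dots> = (\<Sum>k<b. 2/pi + 4/pi * (\<Sum>r=1..R. abs_cos_coeff r * cos (2 * real r * (pi * real k / real b))))"
    by (subst sum.swap) (simp add: sum.distrib sum_distrib_left)
  also have "\<dots> \<le> (\<Sum>k<b. \<bar>cos (pi * real k / real b)\<bar> + 2 / real R)"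
    by (intro sum_mono abs_cos_bounds(2)[OF assms(2)])
  also have "\<dots> = real b * (c_const b + 2 / real R)"
    using sum_abs_cos_residues[OF assms(1)] by (simp add: sum.distrib algebra_simps)
  finally have "2/pi + 4/pi * (\<Sum>r\<in>{1..R} \<inter> {r. b dvd r}. abs_cos_coeff r) \<le> c_const b + 2 / real R"
    using b by simp
  then have "pi/4 * (4/pi * (\<Sum>r\<in>{1..R} \<inter> {r. b dvd r}. abs_cos_coeff r)) \<le> pi/4 * (c_const b - 2/pi + 2 / real R)"
    by (intro mult_left_mono) auto
  then show ?thesis by simp
qed

text \<open>The weight ln (8 r) is the loss in \<open>log_dist_multiple\<close>. Since the
  coefficients decay quadratically, the total loss is bounded; the comparison series is that of r
  powr (-3/2).\<close>

lemma log_weighted_coeff_bounded: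
  "\<exists>C. \<forall>R. (\<Sum>r=1..R. ln (8 * real r) / (4 * (real r)^2 - 1)) \<le> C"
proof -
  have sm: "summable (\<lambda>r. 2 * real r powr (-3/2))"
    using summable_real_powr_iff[of "-3/2"] by (intro summable_mult) auto
  have t: "ln (8 * real r) / (4 * (real r)^2 - 1) \<le> 2 * real r powr (-3/2)" if r: "r \<ge> 1" for r
  proof -
    have "ln (8 * real r) = 2 * ln (sqrt (8 * real r))" using r by (simp add: ln_sqrt)
    also have "ln (sqrt (8 * real r)) \<le> sqrt (8 * real r) - 1" using r by (intro ln_le_minus_one) auto
    also have "sqrt (8 * real r) \<le> 3 * sqrt (real r)"
      by (simp add: real_sqrt_mult) (intro mult_right_mono real_le_lsqrt, auto)
    finally have l: "ln (8 * real r) \<le> 6 * sqrt (real r)" by simp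
    have d: "3 * (real r)^2 \<le> 4 * (real r)^2 - 1" using r by (simp add: power_le_one_iff)
    have "ln (8 * real r) / (4 * (real r)^2 - 1) \<le> 6 * sqrt (real r) / (3 * (real r)^2)"
      using l d r by (intro frac_le) auto
    also have "\<dots> = 2 * (real r powr (1/2) / real r powr 2)"
      using r by (simp add: powr_half_sqrt powr_numeral)
    also have "\<dots> = 2 * real r powr (-3/2)" unfolding powr_diff[symmetric] by simp
    finally show ?thesis .
  qed
  have "(\<Sum>r=1..R. ln (8 * real r) / (4 * (real r)^2 - 1)) \<le> (\<Sum>r. 2 * real r powr (-3/2))" for R
  proof -
    have "(\<Sum>r=1..R. ln (8 * real r) / (4 * (real r)^2 - 1)) \<le> (\<Sum>r=1..R. 2 * real r powr (-3/2))"
      using t by (intro sum_mono) auto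
    also have "\<dots> \<le> (\<Sum>r. 2 * real r powr (-3/2))"
      by (intro sum_le_suminf sm) auto
    finally show ?thesis .
  qed
  then show ?thesis by blast
qed

section \<open>Multiples of a point close to a rational\<close>

lemma one_div_le_one: "1 \<le> x \<Longrightarrow> 1 / x \<le> (1::real)"
  by simp

text \<open>This is log min (n, 1/|\<beta>|), to be used for the distance \<beta> to a rational
  point. The case \<beta> = 0 is separate because the value of \<open>ln\<close> at 0 is only a
  default; the intended value there is the cap ln n.\<close>

definition log_proximity :: "nat \<Rightarrow> real \<Rightarrow> real" where
  "log_proximity n \<beta> = (if \<beta> = 0 then ln (real n) else min (ln (real n)) (- ln \<bar>\<beta>\<bar>))"

lemma log_proximity_bounds:
  assumes "n \<ge> 2" "\<bar>\<beta>\<bar> \<le> 1"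
  shows "0 \<le> log_proximity n \<beta>" "log_proximity n \<beta> \<le> ln (real n)"
        "1 / real n \<le> exp (- log_proximity n \<beta>)" "\<bar>\<beta>\<bar> \<le> exp (- log_proximity n \<beta>)"
proof -
  show "0 \<le> log_proximity n \<beta>" using assms by (auto simp: log_proximity_def)
  show 1: "log_proximity n \<beta> \<le> ln (real n)" by (auto simp: log_proximity_def)
  have "1 / real n = exp (- ln (real n))" using assms by (simp add: exp_minus inverse_eq_divide)
  also have "\<dots> \<le> exp (- log_proximity n \<beta>)" using 1 by simp
  finally show "1 / real n \<le> exp (- log_proximity n \<beta>)" .
  show "\<bar>\<beta>\<bar> \<le> exp (- log_proximity n \<beta>)"
  proof (cases "\<beta> = 0")
    case False
    then have "\<bar>\<beta>\<bar> = exp (ln \<bar>\<beta>\<bar>)" by simp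
    also have "\<dots> \<le> exp (- log_proximity n \<beta>)"
      unfolding exp_le_cancel_iff using False by (simp add: log_proximity_def)
    finally show ?thesis .
  qed simp
qed

lemma log_dist_add_int: "log_dist n (\<alpha> + of_int j) = log_dist n \<alpha>"
proof -
  have "cis (2 * pi * (\<alpha> + of_int j)) = cis (2 * pi * \<alpha>) * cis (2 * pi * of_int j)"
    by (simp only: cis_mult distrib_left)
  then show ?thesis by (simp add: log_dist_def)
qed

text \<open>As a and b are coprime and b does not divide r, the number r a / b has distance at least
  1/b from every integer. Passing to r \<phi> moves it by at most 1 / (2b), so half of that distance
  remains.\<close>

lemma log_dist_away:
  assumes "n \<ge> 2" "b \<ge> 1" "coprime a (int b)" "\<bar>\<phi> - of_int a / real b\<bar> \<le> 1 / (2 * real b * real R)"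
    and "r \<le> R" "1 \<le> r" "\<not> b dvd r"
  shows "\<bar>log_dist n (real r * \<phi>)\<bar> \<le> ln (2 * real b)"
proof -
  define \<beta> where "\<beta> = \<phi> - of_int a / real b"
  have "1 / (2 * real b) \<le> \<bar>real r * \<phi> - of_int j\<bar>" for j
  proof -
    have "int r * a - j * int b \<noteq> 0"
    proof
      assume "int r * a - j * int b = 0"
      then have "int b dvd int r * a" by simp
      then have "int b dvd int r" using assms(3) by (simp add: coprime_dvd_mult_left_iff coprime_commute)
      then show False using assms(7) by simp
    qed
    then have "1 \<le> \<bar>real_of_int (int r * a - j * int b)\<bar>" by linarith
    then have "1 / real b \<le> \<bar>real_of_int (int r * a - j * int b)\<bar> / real b"
      using assms by (intro divide_right_mono) auto
    also have "\<dots> = \<bar>real_of_int (int r * a - j * int b) / real b\<bar>" by (simp add: abs_divide)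
    also have "real_of_int (int r * a - j * int b) / real b = real r * (of_int a / real b) - of_int j"
      using assms(2) by (simp add: diff_divide_distrib)
    also have "real r * (of_int a / real b) - of_int j = (real r * \<phi> - of_int j) - real r * \<beta>"
      by (simp add: \<beta>_def algebra_simps)
    also have "\<bar>\<dots>\<bar> \<le> \<bar>real r * \<phi> - of_int j\<bar> + real r * \<bar>\<beta>\<bar>"
      using abs_triangle_ineq4[of "real r * \<phi> - of_int j" "real r * \<beta>"] by (simp add: abs_mult)
    also have "real r * \<bar>\<beta>\<bar> \<le> real R * (1 / (2 * real b * real R))"
      using assms unfolding \<beta>_def by (intro mult_mono) auto
    also have "\<dots> = 1 / (2 * real b)" using assms by simp
    finally show ?thesis by (simp add: field_simps)
  qed
  then have "2 * (1 / (2 * real b)) \<le> \<bar>sin (pi * (real r * \<phi>))\<bar>" by (rule abs_sin_pi_ge_dist)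
  then have s: "1 / real b \<le> \<bar>sin (pi * (real r * \<phi>))\<bar>" by simp
  moreover have "1 / real b > 0" using assms by simp
  ultimately have nz: "sin (pi * (real r * \<phi>)) \<noteq> 0" by auto
  have "log_dist n (real r * \<phi>) \<le> - ln \<bar>sin (pi * (real r * \<phi>))\<bar>"
    using log_dist_le_sin[OF assms(1) nz] .
  also have "\<dots> \<le> - ln (1 / real b)" using s assms(2) by (simp add: ln_mono)
  also have "\<dots> = ln (real b)" using assms by (simp add: ln_div)
  also have "\<dots> \<le> ln (2 * real b)" using assms by (intro ln_mono) auto
  finally have 1: "log_dist n (real r * \<phi>) \<le> ln (2 * real b)" .
  have "ln 2 \<le> ln (2 * real b)" using assms by (intro ln_mono) auto
  then show ?thesis using 1 log_dist_ge_ln2[OF assms(1), of "real r * \<phi>"] by (simp add: abs_le_iff)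
qed

text \<open>Here r a / b is an integer, so only r \<beta> matters, with \<beta> = \<phi> - a/b. The
  upper bound is free of loss because r |\<beta>| \<le> 1/2 gives |sin (pi r \<beta>)| \<ge>
  |\<beta>|. The lower bound loses ln (8 r) because 1/n and |\<beta>| are both at most exp (- L) and
  1 + 2 pi r \<le> 8 r.\<close>

lemma log_dist_multiple:
  assumes "n \<ge> 2" "b \<ge> 1" "\<bar>\<phi> - of_int a / real b\<bar> \<le> 1 / (2 * real b * real R)"
    and "r \<le> R" "1 \<le> r" "b dvd r"
  defines "L \<equiv> log_proximity n (\<phi> - of_int a / real b)"
  shows "log_dist n (real r * \<phi>) \<le> L" "L - ln (8 * real r) \<le> log_dist n (real r * \<phi>)"
proof -
  define \<beta> where "\<beta> = \<phi> - of_int a / real b"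
  obtain s where s: "r = b * s" using assms by auto
  have "real r * \<phi> = real r * \<beta> + of_int (int s * a)"
    using assms(2) by (simp add: \<beta>_def s field_simps)
  then have eq: "log_dist n (real r * \<phi>) = log_dist n (real r * \<beta>)"
    by (simp only: log_dist_add_int)
  have "real r * \<bar>\<beta>\<bar> \<le> real R * (1 / (2 * real b * real R))"
    using assms unfolding \<beta>_def by (intro mult_mono) auto
  also have "\<dots> = 1 / (2 * real b)" using assms by simp
  also have "\<dots> \<le> 1 / 2" using assms by (simp add: field_simps)
  finally have rb: "real r * \<bar>\<beta>\<bar> \<le> 1/2" .
  have "1 * \<bar>\<beta>\<bar> \<le> real r * \<bar>\<beta>\<bar>" using assms by (intro mult_right_mono) auto
  then have b1: "\<bar>\<beta>\<bar> \<le> 1" using rb by simp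
  show "log_dist n (real r * \<phi>) \<le> L"
  proof (cases "\<beta> = 0")
    case True
    then show ?thesis using log_dist_le[OF assms(1)] unfolding eq L_def \<beta>_def[symmetric] by (simp add: log_proximity_def)
  next
    case False
    have "2 * \<bar>real r * \<beta>\<bar> \<le> \<bar>sin (pi * (real r * \<beta>))\<bar>"
      using rb by (intro abs_sin_pi_ge) (simp add: abs_mult)
    moreover have "1 * \<bar>\<beta>\<bar> \<le> 2 * \<bar>real r * \<beta>\<bar>"
      using assms unfolding abs_mult mult.assoc[symmetric] by (intro mult_right_mono) auto
    ultimately have s: "\<bar>\<beta>\<bar> \<le> \<bar>sin (pi * (real r * \<beta>))\<bar>" by linarith
    then have nz: "sin (pi * (real r * \<beta>)) \<noteq> 0" using False by auto
    have "log_dist n (real r * \<beta>) \<le> - ln \<bar>sin (pi * (real r * \<beta>))\<bar>"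
      using log_dist_le_sin[OF assms(1) nz] .
    also have "\<dots> \<le> - ln \<bar>\<beta>\<bar>" using s False by simp
    finally show ?thesis using log_dist_le[OF assms(1)] False
      unfolding eq L_def \<beta>_def[symmetric] by (simp add: log_proximity_def)
  qed
  note P = log_proximity_bounds[OF assms(1) b1]
  have L: "L = log_proximity n \<beta>" by (simp add: L_def \<beta>_def)
  have "1 / real n + 2 * pi * \<bar>real r * \<beta>\<bar> = 1 / real n + (2 * pi * real r) * \<bar>\<beta>\<bar>"
    by (simp add: abs_mult)
  also have "\<dots> \<le> exp (- L) + (2 * pi * real r) * exp (- L)"
    using P unfolding L by (intro add_mono mult_left_mono) auto
  also have "\<dots> = (1 + 2 * pi * real r) * exp (- L)" by (simp add: algebra_simps)
  also have "\<dots> \<le> (8 * real r) * exp (- L)"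
  proof (intro mult_right_mono)
    have "pi * real r \<le> 3.5 * real r" using pi_approx by (intro mult_right_mono) auto
    moreover have "real r \<ge> 1" using assms by simp
    ultimately show "1 + 2 * pi * real r \<le> 8 * real r" unfolding mult.assoc by linarith
  qed auto
  finally have "ln (1 / real n + 2 * pi * \<bar>real r * \<beta>\<bar>) \<le> ln ((8 * real r) * exp (- L))"
    using assms(1) by (intro ln_mono) (auto intro: add_pos_nonneg)
  also have "\<dots> = ln (8 * real r) - L" using assms by (simp add: ln_mult)
  finally show "L - ln (8 * real r) \<le> log_dist n (real r * \<phi>)"
    using log_dist_ge[OF assms(1), of "real r * \<beta>"] unfolding eq by linarith
qed

section \<open>The constants c_b\<close>

lemma c_const_ge: "b \<ge> 1 \<Longrightarrow> 2/pi \<le> c_const b"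
proof -
  assume b: "b \<ge> 1"
  define x where "x = pi / (2 * real b)"
  have bx: "real b * x = pi / 2" using b by (simp add: x_def)
  have "pi * 1 < pi * (2 * real b)" using b by (intro mult_strict_left_mono) auto
  then have x: "0 < x" "x < pi" using b by (simp_all add: x_def divide_less_eq)
  have s: "sin x > 0" using x by (intro sin_gt_zero)
  have "sin x \<le> x" using x by (intro sin_x_le_x) auto
  then have "real b * sin x \<le> real b * x" by (intro mult_left_mono) auto
  then have "1 / (real b * x) \<le> 1 / (real b * sin x)"
    using b s x by (intro divide_left_mono) auto
  then show ?thesis unfolding bx by (simp add: c_const_def x_def)
qed

text \<open>With x = pi / (2b) the denominator b sin x is pi/2 times sin x / x, which grows as x
  decreases. So c_b falls from c_1 = 1 towards 2/pi.\<close>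

lemma c_const_antimono:
  assumes "1 \<le> b" "b \<le> b'"
  shows "c_const b' \<le> c_const b"
proof -
  define x where "x = pi / (2 * real b)"
  define x' where "x' = pi / (2 * real b')"
  have bb: "real b > 0" "real b' > 0" using assms by auto
  have x: "0 < x'" "x' \<le> x" "x \<le> pi / 2"
  proof -
    show "0 < x'" using bb by (simp add: x'_def)
    show "x' \<le> x" unfolding x_def x'_def using assms bb by (intro divide_left_mono) auto
    show "x \<le> pi / 2" unfolding x_def using assms bb by (intro divide_left_mono) auto
  qed
  have s: "sin x > 0" "sin x' > 0" using x pi_half_less_two pi_gt_zero by (intro sin_gt_zero; linarith)+
  have "x' * sin x \<le> x * sin x'" using x by (intro sin_times_antimono) auto
  then have "pi / 2 * (real b * sin x) \<le> pi / 2 * (real b' * sin x')"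
    using bb by (simp add: x_def x'_def field_simps)
  then have "real b * sin x \<le> real b' * sin x'" by simp
  then show ?thesis
    unfolding c_const_def x_def[symmetric] x'_def[symmetric] using s bb by (intro divide_left_mono) auto
qed

lemma c_const_1: "c_const 1 = 1" by (simp add: c_const_def)

lemma c_const_3: "c_const 3 = 2/3" by (simp add: c_const_def sin_30)

text \<open>In the Fourier expansion each r not divisible by b contributes at most ln (2b) times its
  coefficient. These coefficients sum to at most 1/2 and 4/pi \<le> 2, so \<open>ln b\<close>
  appears with coefficient 1. The multiples of b share essentially the same logarithm L, so for odd
  b their coefficients can be summed first, which produces c_b - 2/pi.\<close>

lemma sum_abs_cos_rational:
  "\<exists>C. \<forall>n R \<phi> a b. n \<ge> 2 \<and> R \<ge> 1 \<and> ln (real n) \<le> real R \<and> b \<ge> 1 \<and> coprime a (int b) \<and>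
      \<bar>\<phi> - of_int a / real b\<bar> \<le> 1 / (2 * real b * real R) \<longrightarrow>
      (\<Sum>k=1..n-1. \<bar>cos (pi * \<phi> * real k)\<bar> / real k) \<le> 2/pi * ln (real n) + ln (real b) + C +
        (if even b then 0 else (c_const b - 2/pi) * log_proximity n (\<phi> - of_int a / real b))"
proof -
  obtain C0 where C0: "(\<Sum>r=1..R. ln (8 * real r) / (4 * (real r)^2 - 1)) \<le> C0" for R
    using log_weighted_coeff_bounded by blast
  have "(\<Sum>k=1..n-1. \<bar>cos (pi * \<phi> * real k)\<bar> / real k) \<le> 2/pi * ln (real n) + ln (real b) + (10 + 2 * \<bar>C0\<bar>) +
        (if even b then 0 else (c_const b - 2/pi) * log_proximity n (\<phi> - of_int a / real b))"
    if A: "n \<ge> 2" "R \<ge> 1" "ln (real n) \<le> real R" "b \<ge> 1" "coprime a (int b)"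
      "\<bar>\<phi> - of_int a / real b\<bar> \<le> 1 / (2 * real b * real R)" for n R :: nat and \<phi> :: real and a :: int and b :: nat
  proof -
    define d where "d = (\<lambda>r. 1 / (4 * (real r)^2 - 1))"
    have d0: "d r \<ge> 0" if "r \<ge> 1" for r using abs_cos_coeff_denom_pos[OF that] by (simp add: d_def)
    define M where "M = {1..R} \<inter> {r. b dvd r}"
    define N where "N = {1..R} \<inter> {r. \<not> b dvd r}"
    have MN: "{1..R} = M \<union> N" "M \<inter> N = {}" "finite M" "finite N" by (auto simp: M_def N_def)
    define T where "T = (\<lambda>r. abs_cos_coeff r * log_dist n (real r * \<phi>))"
    have l2: "ln 2 \<le> ln (2 * real b)" using A by (intro ln_mono) auto
    have l0: "0 \<le> ln (2 * real b)" using A by (intro ln_ge_zero) auto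
    have away: "T r \<le> d r * ln (2 * real b)" if "r \<in> N" for r
    proof -
      have r: "r \<ge> 1" "r \<le> R" "\<not> b dvd r" using that by (auto simp: N_def)
      have "T r \<le> \<bar>T r\<bar>" by simp
      also have "\<dots> \<le> d r * ln (2 * real b)"
      proof -
        have "\<bar>abs_cos_coeff r\<bar> = d r" using r by (simp add: abs_abs_cos_coeff d_def)
        then show ?thesis
          using log_dist_away[OF A(1,4,5,6) r(2,1,3)] d0[OF r(1)]
          unfolding T_def abs_mult by (auto intro: mult_left_mono)
      qed
      finally show ?thesis .
    qed
    have sumN: "sum T N \<le> ln (2 * real b) * sum d N"
      using sum_mono[of N T "\<lambda>r. d r * ln (2 * real b)", OF away] by (simp add: sum_distrib_right mult.commute)
    have sumd: "sum d M + sum d N \<le> 1/2"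
      using sum_coeff_le_half[of R] MN by (simp add: d_def sum.union_disjoint)
    have dM: "sum d M \<ge> 0" "sum d N \<ge> 0" using d0 by (auto simp: M_def N_def intro!: sum_nonneg)
    have ET: "sum T {1..R} = sum T M + sum T N" using MN by (simp add: sum.union_disjoint)
    have base: "(\<Sum>k=1..n-1. \<bar>cos (pi * \<phi> * real k)\<bar> / real k) \<le> 2/pi * ln (real n) + 7 + 4/pi * sum T {1..R}"
      unfolding T_def by (rule sum_abs_cos_le) (use A in auto)
    have l2b: "ln (2 * real b) \<le> 1 + ln (real b)" using A ln_2_less_1 by (simp add: ln_mult)
    have p: "4/pi \<le> 2" using pi_gt3 by (simp add: field_simps)
    show ?thesis
    proof (cases "even b")
      case True
      \<comment> \<open>Multiples of an even b are even and have negative coefficients, so the lower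
        bound - ln 2 for \<open>log_dist\<close> suffices, however close \<phi> is to a/b.\<close>
      have "T r \<le> d r * ln (2 * real b)" if "r \<in> M" for r
      proof -
        have r: "r \<ge> 1" "r \<le> R" "b dvd r" using that by (auto simp: M_def)
        then have ev: "even r" using True by (meson dvd_trans)
        have "T r = d r * (- log_dist n (real r * \<phi>))" using ev by (simp add: T_def abs_cos_coeff_def d_def)
        also have "\<dots> \<le> d r * ln (2 * real b)"
          using d0[OF r(1)] l2 log_dist_ge_ln2[OF A(1), of "real r * \<phi>"] by (intro mult_left_mono) auto
        finally show ?thesis .
      qed
      then have "sum T M \<le> ln (2 * real b) * sum d M"
        using sum_mono[of M T "\<lambda>r. d r * ln (2 * real b)"] by (simp add: sum_distrib_right mult.commute)
      then have "sum T {1..R} \<le> ln (2 * real b) * (sum d M + sum d N)"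
        using sumN unfolding ET distrib_left by linarith
      also have "\<dots> \<le> ln (2 * real b) * (1/2)" using sumd l0 by (intro mult_left_mono)
      finally have "4/pi * sum T {1..R} \<le> 4/pi * (ln (2 * real b) * (1/2))" by (intro mult_left_mono) auto
      also have "\<dots> \<le> 2 * (ln (2 * real b) * (1/2))" using p l0 by (intro mult_right_mono) auto
      finally show ?thesis using base True l2b by simp
    next
      case False
      define L where "L = log_proximity n (\<phi> - of_int a / real b)"
      have "2 * real b * real R \<ge> 1" using A by (simp add: mult_ge1_I)
      then have "1 / (2 * real b * real R) \<le> 1" by (rule one_div_le_one)
      then have b1: "\<bar>\<phi> - of_int a / real b\<bar> \<le> 1" using A(6) by linarith
      note P = log_proximity_bounds[OF A(1) b1, folded L_def]
      \<comment> \<open>The loss ln (8 r) arises for even r only, where a negative coefficient calls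
        for the lower bound of \<open>log_dist\<close>; for odd r the upper bound by L is free of
        loss.\<close>
      have "T r \<le> abs_cos_coeff r * L + ln (8 * real r) * d r" if "r \<in> M" for r
      proof -
        have r: "r \<ge> 1" "r \<le> R" "b dvd r" using that by (auto simp: M_def)
        note D = log_dist_multiple[OF A(1,4,6) r(2,1,3), folded L_def]
        have l8: "0 \<le> ln (8 * real r)" using r by (intro ln_ge_zero) auto
        show ?thesis
        proof (cases "even r")
          case True
          then have g: "abs_cos_coeff r = - d r" by (simp add: abs_cos_coeff_def d_def)
          have "d r * (L - ln (8 * real r)) \<le> d r * log_dist n (real r * \<phi>)"
            using D(2) d0[OF r(1)] by (intro mult_left_mono)
          then show ?thesis by (simp add: T_def g algebra_simps)
        next
          case False
          then have g: "abs_cos_coeff r = d r" by (simp add: abs_cos_coeff_def d_def)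
          have "d r * log_dist n (real r * \<phi>) \<le> d r * L"
            using D(1) d0[OF r(1)] by (intro mult_left_mono)
          moreover have "0 \<le> ln (8 * real r) * d r" using l8 d0[OF r(1)] by simp
          ultimately show ?thesis by (simp add: T_def g)
        qed
      qed
      then have "sum T M \<le> (\<Sum>r\<in>M. abs_cos_coeff r * L + ln (8 * real r) * d r)" by (rule sum_mono)
      also have "\<dots> = (\<Sum>r\<in>M. abs_cos_coeff r) * L + (\<Sum>r\<in>M. ln (8 * real r) * d r)"
        by (simp add: sum.distrib sum_distrib_right)
      also have "\<dots> \<le> pi/4 * (c_const b - 2/pi + 2 / real R) * L + \<bar>C0\<bar>"
      proof (intro add_mono mult_right_mono P)
        show "(\<Sum>r\<in>M. abs_cos_coeff r) \<le> pi/4 * (c_const b - 2/pi + 2 / real R)"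
          unfolding M_def using False A(2) by (rule sum_coeff_multiples_le)
        have "(\<Sum>r\<in>M. ln (8 * real r) * d r) \<le> (\<Sum>r=1..R. ln (8 * real r) * d r)"
          using d0 by (intro sum_mono2) (auto simp: M_def)
        also have "\<dots> \<le> \<bar>C0\<bar>" using C0[of R] by (simp add: d_def)
        finally show "(\<Sum>r\<in>M. ln (8 * real r) * d r) \<le> \<bar>C0\<bar>" .
      qed
      finally have sM: "sum T M \<le> pi/4 * (c_const b - 2/pi + 2 / real R) * L + \<bar>C0\<bar>" .
      have "ln (2 * real b) * sum d N \<le> ln (2 * real b) * (1/2)"
        using sumd dM l0 by (intro mult_left_mono) auto
      then have "sum T {1..R} \<le> pi/4 * (c_const b - 2/pi + 2 / real R) * L + (\<bar>C0\<bar> + ln (2 * real b) / 2)"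
        using sM sumN unfolding ET by linarith
      then have "4/pi * sum T {1..R} \<le> 4/pi * (pi/4 * (c_const b - 2/pi + 2 / real R) * L + (\<bar>C0\<bar> + ln (2 * real b) / 2))"
        by (intro mult_left_mono) auto
      also have "\<dots> = (c_const b - 2/pi + 2 / real R) * L + 4/pi * (\<bar>C0\<bar> + ln (2 * real b) / 2)"
        by (simp add: distrib_left mult.assoc[symmetric])
      also have "\<dots> \<le> (c_const b - 2/pi + 2 / real R) * L + 2 * (\<bar>C0\<bar> + ln (2 * real b) / 2)"
        using p l0 by (intro add_left_mono mult_right_mono) auto
      also have "(c_const b - 2/pi + 2 / real R) * L = (c_const b - 2/pi) * L + 2 * (L / real R)"
        by (simp add: algebra_simps)
      also have "L / real R \<le> 1" using P A by (simp add: divide_le_eq_1)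
      finally have "4/pi * sum T {1..R} \<le> (c_const b - 2/pi) * L + 2 * 1 + 2 * (\<bar>C0\<bar> + ln (2 * real b) / 2)" by simp
      then show ?thesis using base False l2b unfolding L_def[symmetric] by simp
    qed
  qed
  then show ?thesis by blast
qed

section \<open>The maximum over the unit circle\<close>

lemma least_odd_nondivisor:
  assumes "l \<ge> 1"
  shows "least_odd_nondivisor l \<ge> 3" "odd (least_odd_nondivisor l)"
    "\<And>b. odd b \<Longrightarrow> \<not> b dvd l \<Longrightarrow> least_odd_nondivisor l \<le> b"
proof -
  have "odd (2 * l + 1) \<and> \<not> (2 * l + 1) dvd l" using assms by (auto dest: dvd_imp_le)
  then have L: "odd (least_odd_nondivisor l) \<and> \<not> least_odd_nondivisor l dvd l"
    unfolding least_odd_nondivisor_def by (rule LeastI)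
  then show "odd (least_odd_nondivisor l)" by simp
  have "least_odd_nondivisor l \<noteq> 1" using L by auto
  moreover have "least_odd_nondivisor l \<noteq> 0" "least_odd_nondivisor l \<noteq> 2" using L by (metis even_zero, metis even_numeral)
  ultimately show "least_odd_nondivisor l \<ge> 3" by linarith
  show "least_odd_nondivisor l \<le> b" if "odd b" "\<not> b dvd l" for b
    unfolding least_odd_nondivisor_def using that by (intro Least_le) auto
qed

text \<open>The exponential is at most |\<beta>| powr (- \<kappa>), while the first factor is at
  most 7 min (1, y) with y = l |\<beta>|. Since 0 \<le> \<kappa> \<le> 1, that minimum is at most y
  powr \<kappa>, and the powers of |\<beta>| cancel. At \<beta> = 0 the first factor
  vanishes.\<close>

lemma proximity_decay:
  assumes "n \<ge> 2" "l \<ge> 1" "\<bar>\<beta>\<bar> \<le> 1" "0 \<le> \<kappa>" "\<kappa> \<le> 1"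
  shows "cmod (1 - cis (2 * pi * real l * \<beta>)) * exp (\<kappa> * log_proximity n \<beta>) \<le> 7 * real l powr \<kappa>"
proof (cases "\<beta> = 0")
  case False
  have l: "real l \<ge> 1" using assms by simp
  have "log_proximity n \<beta> \<le> - ln \<bar>\<beta>\<bar>" using False by (simp add: log_proximity_def)
  then have "\<kappa> * log_proximity n \<beta> \<le> \<kappa> * (- ln \<bar>\<beta>\<bar>)" using assms by (intro mult_left_mono)
  then have e: "exp (\<kappa> * log_proximity n \<beta>) \<le> \<bar>\<beta>\<bar> powr (-\<kappa>)" using False by (simp add: powr_def)
  define y where "y = real l * \<bar>\<beta>\<bar>"
  have y: "y > 0" using False l by (simp add: y_def)
  have yb: "y powr \<kappa> * \<bar>\<beta>\<bar> powr (-\<kappa>) = real l powr \<kappa>"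
    using False l by (simp add: y_def powr_mult powr_minus)
  have "cmod (1 - cis (2 * pi * real l * \<beta>)) \<le> 7 * y powr \<kappa>"
  proof (cases "y \<ge> 1")
    case True
    have "cmod (1 - cis (2 * pi * real l * \<beta>)) \<le> 1 + 1"
      using norm_triangle_ineq4[of 1 "cis (2 * pi * real l * \<beta>)"] by simp
    also have "\<dots> \<le> 7 * 1" by simp
    also have "\<dots> \<le> 7 * y powr \<kappa>" using True assms by (intro mult_left_mono ge_one_powr_ge_zero) auto
    finally show ?thesis .
  next
    case False
    have "cmod (1 - cis (2 * pi * real l * \<beta>)) \<le> 2 * \<bar>2 * pi * real l * \<beta> / 2\<bar>"
      unfolding norm_one_minus_cis by (intro mult_left_mono abs_sin_x_le_abs_x) auto
    also have "\<dots> = 2 * pi * y" by (simp add: y_def abs_mult)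
    also have "\<dots> \<le> 7 * y" using pi_approx y by (intro mult_right_mono) auto
    also have "y \<le> y powr \<kappa>"
      using powr_mono'[of \<kappa> 1 y] y False assms by simp
    finally show ?thesis by simp
  qed
  then have "cmod (1 - cis (2 * pi * real l * \<beta>)) * exp (\<kappa> * log_proximity n \<beta>) \<le> (7 * y powr \<kappa>) * \<bar>\<beta>\<bar> powr (-\<kappa>)"
    using e by (intro mult_mono) auto
  then show ?thesis using yb by (simp add: mult.assoc)
qed simp

lemma two_over_pi_bounds: "0.63 < 2/pi" "2/pi < 0.64"
  using pi_approx by (auto simp: field_simps)

text \<open>
  The rational case $b = 1$ must not lose any logarithm, as it produces the first term. For odd
  $b \ge 3$ dividing $\ell$ the exponent $c_b \le 2/3$ leaves a factor $\ell^{1/3}$ to spare, which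
  either absorbs the powers of $\log n$ or is itself at most a power of $\log n$.
\<close>
lemma circle_bound:
  "\<exists>C>0. \<forall>n l \<phi>. n \<ge> 2 \<and> 1 \<le> l \<longrightarrow>
     cmod (1 - cis (2 * pi * real l * \<phi>)) * exp (\<Sum>k=1..n-1. \<bar>cos (pi * \<phi> * real k)\<bar> / real k)
     \<le> C * (real n powr (2/pi) * real l powr (1 - 2/pi)
            + ln (real n) ^ 2 * real n powr c_const (least_odd_nondivisor l))"
proof -
  obtain C1 where C1: "\<And>n R \<phi> a b. n \<ge> 2 \<Longrightarrow> R \<ge> 1 \<Longrightarrow> ln (real n) \<le> real R \<Longrightarrow> b \<ge> 1 \<Longrightarrow> coprime a (int b) \<Longrightarrow>
      \<bar>\<phi> - of_int a / real b\<bar> \<le> 1 / (2 * real b * real R) \<Longrightarrow>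
      (\<Sum>k=1..n-1. \<bar>cos (pi * \<phi> * real k)\<bar> / real k) \<le> 2/pi * ln (real n) + ln (real b) + C1 +
        (if even b then 0 else (c_const b - 2/pi) * log_proximity n (\<phi> - of_int a / real b))"
    using sum_abs_cos_rational by blast
  \<comment> \<open>252 = 7 * 36, with 7 from \<open>proximity_decay\<close> and 36 from the square
    of L = 6 ln n below.\<close>
  define C where "C = 252 * exp C1"
  have "cmod (1 - cis (2 * pi * real l * \<phi>)) * exp (\<Sum>k=1..n-1. \<bar>cos (pi * \<phi> * real k)\<bar> / real k)
     \<le> C * (real n powr (2/pi) * real l powr (1 - 2/pi)
            + ln (real n) ^ 2 * real n powr c_const (least_odd_nondivisor l))"
    if n: "n \<ge> 2" and l: "1 \<le> l" for n l :: nat and \<phi> :: real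
  proof -
    define m where "m = least_odd_nondivisor l"
    note m = least_odd_nondivisor[OF l, folded m_def]
    \<comment> \<open>The smallest cutoff that keeps the truncation error bounded. Dirichlet
      approximation with 2R then gives exactly the required accuracy 1 / (2 b R), and b \<le> 2R
      \<le> 6 ln n because ln n > 0.6.\<close>
    define R where "R = nat \<lceil>ln (real n)\<rceil>"
    have "ln 2 \<le> ln (real n)" using n by (intro ln_mono) auto
    then have ln: "ln (real n) > 0.6" using ln2_ge_two_thirds by linarith
    have R1: "R \<ge> 1" "ln (real n) \<le> real R" "real R \<le> ln (real n) + 1"
      using ln unfolding R_def by linarith+
    define L where "L = 6 * ln (real n)"
    have L: "2 * real R \<le> L" "L \<ge> 1" using R1 ln by (simp_all add: L_def)
    obtain a k where ak: "coprime a k" "0 < k" "k \<le> int (2 * R)" "\<bar>of_int k * \<phi> - of_int a\<bar> < 1 / real (2 * R)"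
      using Dirichlet_approx_coprime[of "2 * R" \<phi>] R1 by auto
    define b where "b = nat k"
    have b: "b \<ge> 1" "coprime a (int b)" "real b \<le> L" "real b > 0"
      using ak L by (auto simp: b_def)
    define \<beta> where "\<beta> = \<phi> - of_int a / real b"
    have "\<bar>\<beta>\<bar> = \<bar>of_int k * \<phi> - of_int a\<bar> / real b"
      using ak b by (simp add: \<beta>_def b_def field_simps abs_divide[symmetric] flip: abs_mult)
    also have "\<dots> \<le> (1 / real (2 * R)) / real b"
      using ak b by (intro divide_right_mono) auto
    finally have \<beta>: "\<bar>\<beta>\<bar> \<le> 1 / (2 * real b * real R)" by (simp add: mult_ac)
    have "2 * real b * real R \<ge> 1" using b R1 by (simp add: mult_ge1_I)
    then have "1 / (2 * real b * real R) \<le> 1" by (rule one_div_le_one)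
    then have \<beta>1: "\<bar>\<beta>\<bar> \<le> 1" using \<beta> by linarith
    define E where "E = exp (\<Sum>k=1..n-1. \<bar>cos (pi * \<phi> * real k)\<bar> / real k)"
    define D where "D = cmod (1 - cis (2 * pi * real l * \<phi>))"
    have D2: "0 \<le> D" "D \<le> 2"
      using norm_triangle_ineq4[of 1 "cis (2 * pi * real l * \<phi>)"] by (simp_all add: D_def)
    define U where "U = real n powr (2/pi)"
    define V where "V = real n powr c_const m"
    have n1: "real n \<ge> 1" using n by simp
    have UV: "U \<le> V" "U > 0" "V > 0"
      using c_const_ge[of m] m n1 by (auto simp: U_def V_def intro!: powr_mono)
    have E0: "E \<le> exp C1 * real b * U * exp (if even b then 0 else (c_const b - 2/pi) * log_proximity n \<beta>)"
    proof -
      have "E \<le> exp (2/pi * ln (real n) + ln (real b) + C1 +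
        (if even b then 0 else (c_const b - 2/pi) * log_proximity n \<beta>))"
        unfolding E_def \<beta>_def using C1[OF n R1(1,2) b(1,2), of \<phi>] \<beta> by (simp add: \<beta>_def)
      also have "\<dots> = exp C1 * real b * U * exp (if even b then 0 else (c_const b - 2/pi) * log_proximity n \<beta>)"
        using b n by (simp only: exp_add) (simp add: U_def powr_def mult_ac)
      finally show ?thesis .
    qed
    have E1: "E > 0" by (simp add: E_def)
    have LL: "L \<le> L^2" using L by (simp add: power2_eq_square)
    note P = log_proximity_bounds[OF n \<beta>1]
    have goal: "D * E \<le> 7 * exp C1 * (U * real l powr (1 - 2/pi) + L^2 * V)"
    proof -
      have fin: ?thesis if "D * E \<le> 7 * exp C1 * (L * V)"
      proof -
        note that
        also have "7 * exp C1 * (L * V) \<le> 7 * exp C1 * (0 + L^2 * V)"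
          using LL UV by (intro mult_left_mono) auto
        also have "\<dots> \<le> 7 * exp C1 * (U * real l powr (1 - 2/pi) + L^2 * V)"
          using UV by (intro mult_left_mono add_right_mono) auto
        finally show ?thesis .
      qed
      \<comment> \<open>In the first two cases D \<le> 2 is enough; in the second, the minimality of
        m gives m \<le> b and hence c_b \<le> c_m. Only when b divides l does the smallness of D
        near a/b enter.\<close>
      consider "even b" | "odd b" "\<not> b dvd l" | "odd b" "b dvd l" by blast
      then show ?thesis
      proof cases
        case 1
        have "D * E \<le> 7 * (exp C1 * real b * U)"
          using D2 E0 E1 1 by (intro mult_mono) auto
        also have "\<dots> \<le> 7 * (exp C1 * L * V)"
          using b UV L by (intro mult_mono) auto
        finally show ?thesis by (intro fin) (simp add: mult_ac)
      next
        case 2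
        have "(c_const b - 2/pi) * log_proximity n \<beta> \<le> (c_const m - 2/pi) * ln (real n)"
          using P c_const_ge[OF b(1)] c_const_antimono[of m b] m(1) m(3)[OF 2] by (intro mult_mono) auto
        then have "exp ((c_const b - 2/pi) * log_proximity n \<beta>) \<le> exp ((c_const m - 2/pi) * ln (real n))" by simp
        also have "\<dots> = V / U" using n by (simp add: U_def V_def powr_def exp_diff[symmetric] algebra_simps)
        finally have ex: "exp ((c_const b - 2/pi) * log_proximity n \<beta>) \<le> V / U" .
        have "E \<le> exp C1 * real b * U * (V / U)"
          using E0 2 by (rule_tac order_trans[OF _ mult_left_mono[OF ex]]) (use UV in auto)
        also have "\<dots> = exp C1 * real b * V" using UV by simp
        also have "\<dots> \<le> exp C1 * L * V" using b UV by (intro mult_right_mono mult_left_mono) auto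
        finally have "D * E \<le> 7 * (exp C1 * L * V)" using D2 E1 by (intro mult_mono) auto
        then show ?thesis by (intro fin) (simp add: mult_ac)
      next
        case 3
        define \<kappa> where "\<kappa> = c_const b - 2/pi"
        have \<kappa>: "0 \<le> \<kappa>" "\<kappa> \<le> 1"
          using c_const_ge[OF b(1)] c_const_antimono[of 1 b] b two_over_pi_bounds c_const_1 by (auto simp: \<kappa>_def)
        obtain l' where l': "l = b * l'" using 3 by auto
        \<comment> \<open>As b divides l, the phase l a / b is an integer and drops out, so that 1 -
          z^l sees only \<beta>.\<close>
        have ar: "2 * pi * real l * \<phi> = 2 * pi * real l * \<beta> + 2 * pi * of_int (int l' * a)"
          using b by (simp add: \<beta>_def l' field_simps)
        have "cis (2 * pi * real l * \<phi>) = cis (2 * pi * real l * \<beta>)"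
          unfolding ar cis_mult[symmetric] by (subst cis_multiple_2pi) auto
        then have "D * exp (\<kappa> * log_proximity n \<beta>) \<le> 7 * real l powr \<kappa>"
          using proximity_decay[OF n l \<beta>1 \<kappa>] by (simp add: D_def)
        then have "exp C1 * real b * U * (D * exp (\<kappa> * log_proximity n \<beta>)) \<le> exp C1 * real b * U * (7 * real l powr \<kappa>)"
          using UV by (intro mult_left_mono) auto
        moreover have "D * E \<le> D * (exp C1 * real b * U * exp (\<kappa> * log_proximity n \<beta>))"
          using E0 3 D2 by (intro mult_left_mono) (auto simp: \<kappa>_def)
        ultimately have DE: "D * E \<le> 7 * exp C1 * (U * (real b * real l powr \<kappa>))"
          by (simp add: mult_ac)
        have l1: "real l \<ge> 1" using l by simp
        show ?thesis
        proof (cases "b = 1")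
          case True
          then have k1: "\<kappa> = 1 - 2/pi" by (simp add: \<kappa>_def c_const_1[simplified])
          note DE
          also have "7 * exp C1 * (U * (real b * real l powr \<kappa>)) \<le> 7 * exp C1 * (U * real l powr (1 - 2/pi) + L^2 * V)"
            using True UV k1 by (intro mult_left_mono) auto
          finally show ?thesis .
        next
          case False
          then have "b \<ge> 3" using 3(1) b(1) by (cases "b = 2") auto
          then have \<kappa>3: "\<kappa> \<le> 2/3 - 2/pi" using c_const_antimono[of 3 b] c_const_3 by (simp add: \<kappa>_def)
          show ?thesis
          proof (cases "L \<le> real l powr (1/3)")
            case True
            have "real b * real l powr \<kappa> \<le> real l powr (1/3) * real l powr (2/3 - 2/pi)"
              using b True \<kappa>3 l1 by (intro mult_mono powr_mono) auto
            also have "\<dots> = real l powr (1 - 2/pi)" by (simp add: powr_add[symmetric])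
            finally have "7 * exp C1 * (U * (real b * real l powr \<kappa>)) \<le> 7 * exp C1 * (U * real l powr (1 - 2/pi) + L^2 * V)"
              using UV by (intro mult_left_mono add_increasing2) auto
            then show ?thesis using DE by linarith
          next
            case F: False
            have "real l powr \<kappa> \<le> real l powr (1/3)"
              using \<kappa>3 l1 two_over_pi_bounds by (intro powr_mono) auto
            then have bl: "real b * real l powr \<kappa> \<le> L^2"
              using b F unfolding power2_eq_square by (intro mult_mono) auto
            have "U * (real b * real l powr \<kappa>) \<le> V * L^2"
              by (rule mult_mono[OF UV(1) bl]) (use UV in auto)
            then have "7 * exp C1 * (U * (real b * real l powr \<kappa>)) \<le> 7 * exp C1 * (U * real l powr (1 - 2/pi) + L^2 * V)"
              using UV by (intro mult_left_mono add_increasing) (auto simp: mult.commute)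
            then show ?thesis using DE by linarith
          qed
        qed
      qed
    qed
    have "7 * exp C1 * (U * real l powr (1 - 2/pi) + L^2 * V)
      \<le> 7 * exp C1 * (36 * (U * real l powr (1 - 2/pi)) + 36 * (ln (real n) ^ 2 * V))"
      using UV by (intro mult_left_mono add_mono) (auto simp: L_def power_mult_distrib)
    also have "\<dots> = C * (U * real l powr (1 - 2/pi) + ln (real n) ^ 2 * V)"
      by (simp add: C_def algebra_simps)
    finally show ?thesis using goal unfolding D_def E_def U_def V_def m_def by linarith
  qed
  moreover have "C > 0" by (simp add: C_def)
  ultimately show ?thesis by blast
qed

section \<open>From the circle bound to consecutive coefficients\<close>

text \<open>\<open>F_perp\<close> in the variable q z. The cutoff is a parameter because the
  Parseval argument on a block up to K needs the cutoff K, while maximality at 1 is given for n - 1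
  only.\<close>

definition trunc_series :: "(nat \<Rightarrow> complex) \<Rightarrow> nat \<Rightarrow> complex \<Rightarrow> complex" where
  "trunc_series a N z = exp (\<Sum>k=1..N. a k / of_nat k * z ^ k)"

lemma norm_trunc_series_le_sqrt:
  assumes a: "\<And>k. k \<ge> 1 \<Longrightarrow> cmod (a k) \<le> 1"
    and max: "cmod (trunc_series a N (cis (2 * pi * \<phi>))) \<le> cmod (trunc_series a N 1)"
  shows "cmod (trunc_series a N (cis (2 * pi * \<phi>))) \<le> exp (\<Sum>k=1..N. \<bar>cos (pi * \<phi> * real k)\<bar> / real k)"
proof -
  define w where "w = cis (2 * pi * \<phi>)"
  define S where "S = (\<Sum>k=1..N. \<bar>cos (pi * \<phi> * real k)\<bar> / real k)"
  have "cmod (trunc_series a N w) ^ 2 \<le> cmod (trunc_series a N w) * cmod (trunc_series a N 1)"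
    unfolding power2_eq_square using max by (intro mult_left_mono) (auto simp: w_def)
  also have "\<dots> = exp (Re (\<Sum>k=1..N. a k / of_nat k * (w ^ k + 1)))"
    by (simp add: trunc_series_def norm_mult[symmetric] exp_add[symmetric] sum.distrib distrib_left)
  also have "\<dots> \<le> exp (2 * S)"
  proof (intro exp_mono order_trans[OF complex_Re_le_cmod] order_trans[OF norm_sum])
    have "cmod (a k / of_nat k * (w ^ k + 1)) \<le> 2 * (\<bar>cos (pi * \<phi> * real k)\<bar> / real k)" if "k \<in> {1..N}" for k
    proof -
      \<comment> \<open>The shift of the argument by pi turns the sum into a difference, to which
        \<open>norm_one_minus_cis\<close> applies.\<close>
      have "w ^ k + 1 = 1 - cis (2 * (pi * \<phi> * real k) + pi)"
        by (simp add: w_def Complex.DeMoivre minus_cis[symmetric] mult_ac)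
      then have "cmod (w ^ k + 1) = 2 * \<bar>sin ((2 * (pi * \<phi> * real k) + pi) / 2)\<bar>"
        by (simp only: norm_one_minus_cis)
      also have "(2 * (pi * \<phi> * real k) + pi) / 2 = pi * \<phi> * real k + pi / 2" by simp
      also have "sin (pi * \<phi> * real k + pi / 2) = cos (pi * \<phi> * real k)" by (simp add: sin_add)
      finally have "cmod (w ^ k + 1) = 2 * \<bar>cos (pi * \<phi> * real k)\<bar>" .
      then have "cmod (a k / of_nat k * (w ^ k + 1)) = cmod (a k) * (2 * (\<bar>cos (pi * \<phi> * real k)\<bar> / real k))"
        by (simp add: norm_mult norm_divide)
      also have "\<dots> \<le> 1 * (2 * (\<bar>cos (pi * \<phi> * real k)\<bar> / real k))"
        using a[of k] that by (intro mult_right_mono) auto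
      finally show ?thesis by simp
    qed
    then show "(\<Sum>k=1..N. cmod (a k / of_nat k * (w ^ k + 1))) \<le> 2 * S"
      unfolding S_def sum_distrib_left by (rule sum_mono)
  qed
  also have "\<dots> = exp S ^ 2" by (simp add: exp_double)
  finally have "cmod (trunc_series a N w) ^ 2 \<le> exp S ^ 2" .
  then show ?thesis unfolding w_def S_def by (rule power2_le_imp_le) simp
qed

text \<open>At radius 1 - 1/K the two exponents differ by a bounded amount. The 6 is 1 + 4 + 1:
  damping the common terms, the terms from n to K (fewer than 4n, each at most 1/n), and the damped
  terms beyond K.\<close>

lemma trunc_series_smoothing:
  assumes a: "\<And>k. k \<ge> 1 \<Longrightarrow> cmod (a k) \<le> 1"
    and n: "n \<ge> 2" and K: "1 \<le> K" "K \<le> 4 * n" and z: "cmod z = 1"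
  shows "cmod (trunc_series a K z) \<le> exp 6 * cmod (trunc_series a (n-1) (of_real (1 - 1 / real K) * z))"
proof -
  define t where "t = 1 - 1 / real K"
  have t: "0 \<le> t" "t < 1" "1 - t = 1 / real K" using K by (auto simp: t_def)
  define c where "c = (\<lambda>k. a k / of_nat k * z ^ k)"
  have c: "cmod (c k) \<le> 1 / real k" if "k \<ge> 1" for k
    using a[OF that] z by (simp add: c_def norm_mult norm_divide norm_power divide_right_mono)
  have ct: "a k / of_nat k * (of_real t * z) ^ k = c k * of_real (t ^ k)" for k
    by (simp add: c_def power_mult_distrib)
  have A: "(\<Sum>k=1..K. c k) - (\<Sum>k=1..n-1. c k * of_real (t^k)) =
     (\<Sum>k\<in>{1..min K (n-1)}. c k * of_real (1 - t^k)) + (\<Sum>k=n..K. c k) - (\<Sum>k=K+1..n-1. c k * of_real (t^k))"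
  proof (cases "K \<ge> n")
    case True
    have "{1..K} = {1..n-1} \<union> {n..K}" using True n by auto
    then have "(\<Sum>k=1..K. c k) = (\<Sum>k=1..n-1. c k) + (\<Sum>k=n..K. c k)"
      by (simp only:) (rule sum.union_disjoint, auto)
    then show ?thesis using True by (simp add: min_absorb2 algebra_simps sum_subtractf)
  next
    case False
    have "{1..n-1} = {1..K} \<union> {K+1..n-1}" using False by auto
    then have "(\<Sum>k=1..n-1. c k * of_real (t^k)) = (\<Sum>k=1..K. c k * of_real (t^k)) + (\<Sum>k=K+1..n-1. c k * of_real (t^k))"
      by (simp only:) (rule sum.union_disjoint, auto)
    then show ?thesis using False by (simp add: min_absorb1 algebra_simps sum_subtractf)
  qed
  have "cmod (\<Sum>k\<in>{1..min K (n-1)}. c k * of_real (1 - t^k)) \<le> (\<Sum>k=1..min K (n-1). (1 - t^k) / real k)"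
  proof (rule sum_norm_le)
    fix k assume k: "k \<in> {1..min K (n-1)}"
    have p: "0 \<le> 1 - t^k" using t by (simp add: power_le_one)
    have "cmod (c k * of_real (1 - t^k)) = cmod (c k) * (1 - t^k)"
      using p by (simp only: norm_mult norm_of_real abs_of_nonneg)
    also have "\<dots> \<le> 1 / real k * (1 - t^k)" using c[of k] k p by (intro mult_right_mono) auto
    finally show "cmod (c k * of_real (1 - t^k)) \<le> (1 - t^k) / real k" by simp
  qed
  also have "\<dots> \<le> (\<Sum>k=1..K. (1 - t^k) / real k)"
    using t by (intro sum_mono2) (auto simp: power_le_one)
  also have "\<dots> \<le> real K * (1 - t)" using t by (intro smoothing_head) auto
  also have "\<dots> = 1" using K t by simp
  finally have 1: "cmod (\<Sum>k\<in>{1..min K (n-1)}. c k * of_real (1 - t^k)) \<le> 1" .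
  have "cmod (\<Sum>k=n..K. c k) \<le> (\<Sum>k=n..K. 1 / real n)"
    using n by (intro sum_norm_le order_trans[OF c] divide_left_mono) auto
  also have "\<dots> = real (K + 1 - n) / real n" by simp
  also have "\<dots> \<le> 4" using K n by (simp add: divide_le_eq)
  finally have 2: "cmod (\<Sum>k=n..K. c k) \<le> 4" .
  have "cmod (\<Sum>k=K+1..n-1. c k * of_real (t^k)) \<le> (\<Sum>k=K+1..n-1. t^k / real k)"
  proof (rule sum_norm_le)
    fix k assume k: "k \<in> {K+1..n-1}"
    have "cmod (c k * of_real (t^k)) = cmod (c k) * t^k"
      using t by (simp only: norm_mult norm_of_real abs_of_nonneg zero_le_power)
    also have "\<dots> \<le> 1 / real k * t^k" using c[of k] k t by (intro mult_right_mono) auto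
    finally show "cmod (c k * of_real (t^k)) \<le> t^k / real k" by simp
  qed
  also have "\<dots> \<le> (\<Sum>k=K..n-1. t^k / real k)" using t by (intro sum_mono2) auto
  also have "\<dots> \<le> 1" using geometric_tail_le[of t K "n-1"] t K by simp
  finally have 3: "cmod (\<Sum>k=K+1..n-1. c k * of_real (t^k)) \<le> 1" .
  define D where "D = (\<Sum>k=1..K. c k) - (\<Sum>k=1..n-1. c k * of_real (t^k))"
  have "cmod D \<le> 1 + 4 + 1"
    unfolding D_def A using 1 2 3 norm_triangle_ineq norm_triangle_ineq4 by (smt (verit))
  then have D: "Re D \<le> 6" using complex_Re_le_cmod[of D] by simp
  have "trunc_series a K z = exp D * trunc_series a (n-1) (of_real t * z)"
    unfolding trunc_series_def ct D_def c_def[symmetric] exp_add[symmetric] by (simp add: c_def)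
  then have "cmod (trunc_series a K z) = exp (Re D) * cmod (trunc_series a (n-1) (of_real t * z))"
    by (simp add: norm_mult)
  also have "\<dots> \<le> exp 6 * cmod (trunc_series a (n-1) (of_real t * z))"
    using D by (intro mult_right_mono) auto
  finally show ?thesis unfolding t_def .
qed

text \<open>The damped sum of t^k / k is at most 2 + ln K, whatever N is. This crude bound is
  multiplied below by the change l/K of the weight 1 - z^l, which explains its form K times a
  constant.\<close>

lemma norm_trunc_series_radius_le:
  assumes a: "\<And>k. k \<ge> 1 \<Longrightarrow> cmod (a k) \<le> 1" and K: "1 \<le> K" and z: "cmod z = 1"
  shows "cmod (trunc_series a N (of_real (1 - 1 / real K) * z)) \<le> exp 2 * real K"
proof -
  define t where "t = 1 - 1 / real K"
  have t: "0 \<le> t" "t < 1" "1 - t = 1 / real K" using K by (auto simp: t_def)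
  have "cmod (\<Sum>k=1..N. a k / of_nat k * (of_real t * z) ^ k) \<le> (\<Sum>k=1..N. t^k / real k)"
  proof (rule sum_norm_le)
    fix k assume k: "k \<in> {1..N}"
    have "cmod (a k / of_nat k * (of_real t * z) ^ k) = cmod (a k) * (t^k / real k)"
      using t z by (simp add: norm_mult norm_divide norm_power)
    also have "\<dots> \<le> 1 * (t^k / real k)" using a[of k] k t by (intro mult_right_mono) auto
    finally show "cmod (a k / of_nat k * (of_real t * z) ^ k) \<le> t^k / real k" by simp
  qed
  also have "\<dots> \<le> (\<Sum>k\<in>{1..K} \<union> {K..N}. t^k / real k)"
    using t by (intro sum_mono2) auto
  also have "\<dots> \<le> (\<Sum>k=1..K. t^k / real k) + (\<Sum>k=K..N. t^k / real k)"
    using sum.union_inter[of "{1..K}" "{K..N}" "\<lambda>k. t^k / real k"] t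
    by (smt (verit) finite_atLeastAtMost sum_nonneg divide_nonneg_nonneg of_nat_0_le_iff zero_le_power)
  also have "(\<Sum>k=K..N. t^k / real k) \<le> 1" using geometric_tail_le[of t K N] t K by simp
  also have "(\<Sum>k=1..K. t^k / real k) \<le> (\<Sum>k=1..K. 1 / real k)"
    using t by (intro sum_mono divide_right_mono) (auto simp: power_le_one)
  also have "\<dots> \<le> 1 + ln (real K)" by (rule sum_inverse_le_ln[OF K])
  finally have "cmod (\<Sum>k=1..N. a k / of_nat k * (of_real t * z) ^ k) \<le> 2 + ln (real K)" by simp
  then have "Re (\<Sum>k=1..N. a k / of_nat k * (of_real t * z) ^ k) \<le> 2 + ln (real K)"
    using complex_Re_le_cmod order_trans by blast
  then have "exp (Re (\<Sum>k=1..N. a k / of_nat k * (of_real t * z) ^ k)) \<le> exp (2 + ln (real K))"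
    by (rule exp_mono)
  then show ?thesis using K by (simp add: trunc_series_def exp_add flip: t_def)
qed

text \<open>The bound B holds on the circle, hence inside the disc, for the function including the
  weight. Moving the weight from w = t z back to z costs 1 - t^l \<le> l/K, which against the size
  exp 2 * K of the series gives the additional term l. The constant is exp 6 * exp 2.\<close>

lemma weighted_trunc_series_bound:
  assumes a: "\<And>k. k \<ge> 1 \<Longrightarrow> cmod (a k) \<le> 1" and n: "n \<ge> 2" and l: "l \<ge> 1"
    and B: "\<And>w. cmod w = 1 \<Longrightarrow> cmod ((1 - w ^ l) * trunc_series a (n-1) w) \<le> B"
    and K: "1 \<le> K" "K \<le> 4 * n" and z: "cmod z = 1"
  shows "cmod ((1 - z ^ l) * trunc_series a K z) \<le> exp 8 * (B + real l)"
proof -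
  define t where "t = 1 - 1 / real K"
  have t: "0 \<le> t" "t < 1" "1 - t = 1 / real K" using K by (auto simp: t_def)
  define w where "w = of_real t * z"
  have w: "cmod w < 1" using t z by (simp add: w_def norm_mult)
  define F where "F = (\<lambda>w. (1 - w ^ l) * trunc_series a (n-1) w)"
  have hol: "F holomorphic_on UNIV" unfolding F_def trunc_series_def by (intro holomorphic_intros)
  have Fw: "cmod (F w) \<le> B"
  proof (rule maximum_modulus_frontier[of F "ball 0 1"])
    show "F holomorphic_on interior (ball 0 1)" using hol holomorphic_on_subset by blast
    show "continuous_on (closure (ball 0 1)) F"
      using holomorphic_on_imp_continuous_on[OF hol] continuous_on_subset by blast
    show "cmod (F x) \<le> B" if "x \<in> frontier (ball 0 1)" for x
      using that B[of x] by (simp add: F_def frontier_ball)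
  qed (use w in auto)
  have "1 - t ^ l \<le> real l / real K"
  proof -
    have "1 - t ^ l = (1 - t) * (\<Sum>i<l. t ^ i)" by (simp add: one_diff_power_eq)
    also have "\<dots> \<le> (1 - t) * (\<Sum>i<l. 1)"
      using t by (intro mult_left_mono sum_mono) (auto simp: power_le_one)
    finally show ?thesis using t by simp
  qed
  moreover have "cmod (1 - z ^ l) \<le> cmod (1 - w ^ l) + (1 - t ^ l)"
  proof -
    have "1 - z ^ l = (1 - w ^ l) - z ^ l * of_real (1 - t ^ l)"
      by (simp add: w_def power_mult_distrib algebra_simps)
    then have "cmod (1 - z ^ l) \<le> cmod (1 - w ^ l) + cmod (z ^ l * of_real (1 - t ^ l))"
      by (simp only: norm_triangle_ineq4)
    moreover have "0 \<le> 1 - t ^ l" using t by (simp add: power_le_one)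
    then have "cmod (z ^ l * of_real (1 - t ^ l)) = 1 - t ^ l"
      using z by (simp only: norm_mult norm_power norm_of_real abs_of_nonneg) simp
    ultimately show ?thesis by simp
  qed
  ultimately have 1: "cmod (1 - z ^ l) \<le> cmod (1 - w ^ l) + real l / real K" by linarith
  define G where "G = cmod (trunc_series a (n-1) w)"
  have G: "0 \<le> G" "G \<le> exp 2 * real K"
    using norm_trunc_series_radius_le[OF a K(1) z, where N = "n-1"] by (simp_all add: G_def w_def t_def)
  have "cmod (1 - z ^ l) * G \<le> cmod (1 - w ^ l) * G + real l / real K * G"
    using mult_right_mono[OF 1 G(1)] by (simp add: distrib_right)
  also have "cmod (1 - w ^ l) * G \<le> B" using Fw by (simp add: F_def G_def norm_mult)
  also have "real l / real K * G \<le> real l / real K * (exp 2 * real K)"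
    using G by (intro mult_left_mono) auto
  also have "\<dots> = exp 2 * real l" using K by simp
  finally have 2: "cmod (1 - z ^ l) * G \<le> B + exp 2 * real l" by simp
  have B0: "B \<ge> 0" using Fw norm_ge_zero order_trans by blast
  have "cmod ((1 - z ^ l) * trunc_series a K z) \<le> cmod (1 - z ^ l) * (exp 6 * G)"
    unfolding norm_mult G_def w_def t_def using trunc_series_smoothing[OF a n K z] by (intro mult_left_mono) auto
  also have "\<dots> = exp 6 * (cmod (1 - z ^ l) * G)" by simp
  also have "\<dots> \<le> exp 6 * (B + exp 2 * real l)" using 2 by (intro mult_left_mono) auto
  also have "\<dots> \<le> exp 6 * (exp 2 * B + exp 2 * real l)"
    using B0 by (intro mult_left_mono add_right_mono) (auto simp: mult_le_cancel_right1)
  also have "\<dots> = exp 6 * exp 2 * (B + real l)" by (simp add: algebra_simps)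
  also have "exp 6 * exp 2 = exp (8::real)" by (simp add: exp_add[symmetric])
  finally show ?thesis .
qed

section \<open>Discrete Parseval and multiplication in mean square\<close>

lemma poly_parseval:
  fixes p :: "complex poly"
  assumes "Polynomial.degree p < Q"
  shows "(\<Sum>h<Q. (cmod (poly p (cis (2 * pi * real h / real Q))))^2) = real Q * (\<Sum>i<Q. (cmod (Polynomial.coeff p i))^2)"
proof -
  have Q: "Q \<ge> 1" using assms by simp
  let ?e = "\<lambda>h. cis (2 * pi * real h / real Q)"
  let ?c = "Polynomial.coeff p"
  have pe: "poly p (?e h) = (\<Sum>i<Q. ?c i * ?e h ^ i)" for h
  proof -
    have "poly p (?e h) = (\<Sum>i\<le>Polynomial.degree p. ?c i * ?e h ^ i)" by (rule poly_altdef)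
    also have "\<dots> = (\<Sum>i<Q. ?c i * ?e h ^ i)"
      using assms by (intro sum.mono_neutral_left) (auto simp: coeff_eq_0)
    finally show ?thesis .
  qed
  have ee: "?e h ^ i * cnj (?e h ^ j) = cis (2 * pi * (of_int (int i - int j) / real Q) * real h)" for h i j
    by (simp add: Complex.DeMoivre cis_cnj cis_mult) (simp add: diff_divide_distrib algebra_simps)
  have "of_real (\<Sum>h<Q. (cmod (poly p (?e h)))^2) = (\<Sum>h<Q. poly p (?e h) * cnj (poly p (?e h)))"
    by (simp only: of_real_sum complex_norm_square)
  also have "\<dots> = (\<Sum>h<Q. \<Sum>i<Q. \<Sum>j<Q. ?c i * cnj (?c j) * (?e h ^ i * cnj (?e h ^ j)))"
    unfolding pe by (simp add: sum_product mult_ac)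
  also have "\<dots> = (\<Sum>i<Q. \<Sum>h<Q. \<Sum>j<Q. ?c i * cnj (?c j) * (?e h ^ i * cnj (?e h ^ j)))"
    by (rule sum.swap)
  also have "\<dots> = (\<Sum>i<Q. \<Sum>j<Q. \<Sum>h<Q. ?c i * cnj (?c j) * (?e h ^ i * cnj (?e h ^ j)))"
    by (intro sum.cong refl sum.swap)
  also have "\<dots> = (\<Sum>i<Q. \<Sum>j<Q. ?c i * cnj (?c j) * (if int Q dvd int i - int j then of_nat Q else 0))"
    unfolding ee sum_distrib_left[symmetric] sum_cis_residues[OF Q] ..
  also have "\<dots> = (\<Sum>i<Q. \<Sum>j<Q. if j = i then ?c i * cnj (?c j) * of_nat Q else 0)"
  proof (intro sum.cong refl)
    fix i j assume ij: "i \<in> {..<Q}" "j \<in> {..<Q}"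
    \<comment> \<open>There is no aliasing: both indices are below Q, so congruence modulo Q is
      equality.\<close>
    have "int Q dvd int i - int j \<longleftrightarrow> j = i"
    proof
      assume d: "int Q dvd int i - int j"
      show "j = i"
      proof (rule ccontr)
        assume "j \<noteq> i"
        then have "int Q \<le> \<bar>int i - int j\<bar>" using d by (intro zdvd_imp_le) auto
        then show False using ij by auto
      qed
    qed simp
    then show "?c i * cnj (?c j) * (if int Q dvd int i - int j then of_nat Q else 0) = (if j = i then ?c i * cnj (?c j) * of_nat Q else 0)"
      by simp
  qed
  also have "\<dots> = (\<Sum>i<Q. ?c i * cnj (?c i) * of_nat Q)" by simp
  also have "\<dots> = of_real (real Q * (\<Sum>i<Q. (cmod (?c i))^2))"
    by (simp add: sum_distrib_left complex_norm_square mult_ac flip: of_real_power del: complex_mult_cnj)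
  finally show ?thesis by (simp only: of_real_eq_iff)
qed

text \<open>In mean square, multiplication by p has norm at most its maximum on the circle. The sums
  are taken over roots of unity of an order above both degrees, so that Parseval is exact for q and
  for p * q.\<close>

lemma poly_mult_coeff_norm_le:
  fixes p q :: "complex poly"
  assumes B: "\<And>z. cmod z = 1 \<Longrightarrow> cmod (poly p z) \<le> B"
  shows "(\<Sum>i\<le>K. (cmod (Polynomial.coeff (p * q) i))^2) \<le> B^2 * (\<Sum>i\<le>Polynomial.degree q. (cmod (Polynomial.coeff q i))^2)"
proof -
  define Q where "Q = Suc (K + Polynomial.degree p + Polynomial.degree q)"
  have Q: "Polynomial.degree (p * q) < Q" "Polynomial.degree q < Q"
    using degree_mult_le[of p q] by (auto simp: Q_def)
  let ?e = "\<lambda>h. cis (2 * pi * real h / real Q)"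
  have "real Q * (\<Sum>i\<le>K. (cmod (Polynomial.coeff (p * q) i))^2) \<le> real Q * (\<Sum>i<Q. (cmod (Polynomial.coeff (p * q) i))^2)"
    by (intro mult_left_mono sum_mono2) (auto simp: Q_def)
  also have "\<dots> = (\<Sum>h<Q. (cmod (poly (p * q) (?e h)))^2)" by (simp only: poly_parseval[OF Q(1)])
  also have "\<dots> \<le> (\<Sum>h<Q. B^2 * (cmod (poly q (?e h)))^2)"
    by (intro sum_mono) (auto simp: norm_mult power_mult_distrib intro!: mult_right_mono power_mono B)
  also have "\<dots> = B^2 * (real Q * (\<Sum>i<Q. (cmod (Polynomial.coeff q i))^2))"
    by (simp only: poly_parseval[OF Q(2)] sum_distrib_left[symmetric])
  also have "(\<Sum>i<Q. (cmod (Polynomial.coeff q i))^2) = (\<Sum>i\<le>Polynomial.degree q. (cmod (Polynomial.coeff q i))^2)"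
    using Q by (intro sum.mono_neutral_right) (auto simp: coeff_eq_0)
  finally have "real Q * (\<Sum>i\<le>K. (cmod (Polynomial.coeff (p * q) i))^2) \<le>
     real Q * (B^2 * (\<Sum>i\<le>Polynomial.degree q. (cmod (Polynomial.coeff q i))^2))" by (simp add: mult_ac)
  then show ?thesis by (simp add: Q_def)
qed

section \<open>Polynomial approximation of the generating function\<close>

definition log_poly :: "(nat \<Rightarrow> complex) \<Rightarrow> nat \<Rightarrow> complex poly" where
  "log_poly a K = (\<Sum>k=1..K. Polynomial.monom (a k / of_nat k) k)"

text \<open>This is z times the derivative of \<open>log_poly\<close>; multiplication by it realizes
  the convolution with \<open>a\<close> in the recurrence.\<close>

definition logderiv_poly :: "(nat \<Rightarrow> complex) \<Rightarrow> nat \<Rightarrow> complex poly" where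
  "logderiv_poly a K = (\<Sum>k=1..K. Polynomial.monom (a k) k)"

definition exp_poly :: "nat \<Rightarrow> complex poly \<Rightarrow> complex poly" where
  "exp_poly J p = (\<Sum>j\<le>J. Polynomial.smult (1 / fact j) (p ^ j))"

lemma coeff_log_poly: "Polynomial.coeff (log_poly a K) i = (if 1 \<le> i \<and> i \<le> K then a i / of_nat i else 0)"
  by (simp add: log_poly_def coeff_sum)

lemma coeff_logderiv_poly: "Polynomial.coeff (logderiv_poly a K) i = (if 1 \<le> i \<and> i \<le> K then a i else 0)"
  by (simp add: logderiv_poly_def coeff_sum)

lemma poly_log_poly: "poly (log_poly a K) z = (\<Sum>k=1..K. a k / of_nat k * z ^ k)"
  by (simp add: log_poly_def poly_sum poly_monom)

lemma poly_exp_poly: "poly (exp_poly J p) z = (\<Sum>j\<le>J. poly p z ^ j / fact j)"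
  by (simp add: exp_poly_def poly_sum)

lemma degree_logderiv_poly: "Polynomial.degree (logderiv_poly a K) \<le> K"
  by (rule degree_le) (simp add: coeff_logderiv_poly)

lemma coeff_power_eq_0:
  assumes "Polynomial.coeff p 0 = 0" "i < j"
  shows "Polynomial.coeff (p ^ j) i = 0"
  using assms(2)
proof (induction j arbitrary: i)
  case (Suc j)
  have "Polynomial.coeff p m * Polynomial.coeff (p ^ j) (i - m) = 0" if "m \<le> i" for m
    using Suc assms(1) that by (cases "m = 0") auto
  then show ?case by (simp add: coeff_mult del: mult_eq_0_iff)
qed simp

lemma exp_poly_Suc: "exp_poly (Suc J) p = exp_poly J p + Polynomial.smult (1 / fact (Suc J)) (p ^ Suc J)"
  by (simp add: exp_poly_def)

lemma pderiv_exp_poly: "pderiv (exp_poly (Suc J) p) = exp_poly J p * pderiv p"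
proof (induction J)
  case 0
  then show ?case by (simp add: exp_poly_def pderiv_add)
next
  case (Suc J)
  have "pderiv (exp_poly (Suc (Suc J)) p) = pderiv (exp_poly (Suc J) p) + Polynomial.smult (1 / fact (Suc (Suc J))) (pderiv (p ^ Suc (Suc J)))"
    by (subst exp_poly_Suc) (simp only: pderiv_add pderiv_smult)
  also have "Polynomial.smult (1 / fact (Suc (Suc J))) (pderiv (p ^ Suc (Suc J))) = Polynomial.smult (1 / fact (Suc J)) (p ^ Suc J) * pderiv p"
    unfolding pderiv_power_Suc by (simp add: field_simps del: power_Suc of_nat_Suc)
  finally show ?case unfolding Suc by (subst (2) exp_poly_Suc) (simp only: distrib_right)
qed

text \<open>Differentiation lowers the order of \<open>exp_poly\<close> by one and produces the
  factor p', so the coefficients obey the recurrence of s. The lower order is harmless: p has no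
  constant term, hence its top power does not reach the coefficients in question.\<close>

lemma coeff_exp_poly:
  assumes s0: "s 0 = 1" and rec: "\<And>N. N \<ge> 1 \<Longrightarrow> of_nat N * s N = (\<Sum>k=1..N. a k * s (N - k))"
    and "M \<le> K" "M \<le> J"
  shows "Polynomial.coeff (exp_poly J (log_poly a K)) M = s M"
  using assms(3,4)
proof (induction M rule: less_induct)
  case (less M)
  let ?p = "log_poly a K"
  have p0: "Polynomial.coeff ?p 0 = 0" by (simp add: coeff_log_poly)
  show ?case
  proof (cases M)
    case 0
    have "Polynomial.coeff (exp_poly J ?p) 0 = (\<Sum>j\<le>J. 1 / fact j * Polynomial.coeff (?p ^ j) 0)"
      by (simp add: exp_poly_def coeff_sum)
    also have "\<dots> = (\<Sum>j\<in>{0}. 1 / fact j * Polynomial.coeff (?p ^ j) 0)"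
      using coeff_power_eq_0[OF p0] by (intro sum.mono_neutral_right) auto
    finally show ?thesis using 0 s0 by simp
  next
    case (Suc M')
    then obtain J' where J: "J = Suc J'" using less.prems by (cases J) auto
    have lower: "Polynomial.coeff (exp_poly J' ?p) i = s i" if "i < M" for i
    proof -
      have "Polynomial.coeff (exp_poly J ?p) i = Polynomial.coeff (exp_poly J' ?p) i"
        unfolding J exp_poly_Suc using coeff_power_eq_0[OF p0, of i "Suc J'"] that less.prems J by simp
      then show ?thesis using less.IH[OF that] less.prems that by simp
    qed
    have "of_nat M * Polynomial.coeff (exp_poly J ?p) M = Polynomial.coeff (pderiv (exp_poly J ?p)) M'"
      by (simp add: coeff_pderiv Suc)
    also have "\<dots> = Polynomial.coeff (pderiv ?p * exp_poly J' ?p) M'"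
      by (simp only: J pderiv_exp_poly mult.commute)
    also have "\<dots> = (\<Sum>i\<le>M'. Polynomial.coeff (pderiv ?p) i * Polynomial.coeff (exp_poly J' ?p) (M' - i))"
      by (rule coeff_mult)
    also have "\<dots> = (\<Sum>i\<le>M'. a (Suc i) * s (M - Suc i))"
      using less.prems Suc by (intro sum.cong refl) (simp add: coeff_pderiv coeff_log_poly lower del: of_nat_Suc)
    also have "\<dots> = (\<Sum>k=1..M. a k * s (M - k))"
      unfolding Suc by (rule sum.reindex_bij_witness[where i = "\<lambda>k. k - 1" and j = Suc]) auto
    also have "\<dots> = of_nat M * s M" using rec[of M] Suc by simp
    finally show ?thesis using Suc by (simp del: of_nat_Suc)
  qed
qed

lemma exp_poly_uniform_approx:
  assumes "\<And>z. cmod z = 1 \<Longrightarrow> cmod (poly p z) \<le> r" "r \<ge> 0" "\<epsilon> > 0"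
  obtains J where "J \<ge> K" "\<And>z. cmod z = 1 \<Longrightarrow> cmod (exp (poly p z) - poly (exp_poly J p) z) \<le> \<epsilon>"
proof -
  have "(\<lambda>J. inverse (fact J) * r ^ J) \<longlonglongrightarrow> 0"
    using summable_LIMSEQ_zero[OF summable_exp] .
  then have "(\<lambda>J. (exp r * r) * (inverse (fact J) * r ^ J)) \<longlonglongrightarrow> 0"
    by (rule tendsto_mult_right_zero)
  then have "\<forall>\<^sub>F J in sequentially. (exp r * r) * (inverse (fact J) * r ^ J) < \<epsilon>"
    using assms(3) by (rule order_tendstoD)
  then have "\<forall>\<^sub>F J in sequentially. (exp r * r) * (inverse (fact J) * r ^ J) < \<epsilon> \<and> J \<ge> K"
    using eventually_ge_at_top[of K] by (rule eventually_conj)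
  then obtain J where J: "(exp r * r) * (inverse (fact J) * r ^ J) < \<epsilon>" "J \<ge> K"
    by (auto simp: eventually_sequentially)
  have "cmod (exp (poly p z) - poly (exp_poly J p) z) \<le> \<epsilon>" if z: "cmod z = 1" for z
  proof -
    have "cmod (exp (poly p z) - poly (exp_poly J p) z) \<le> exp (cmod (poly p z)) * (cmod (poly p z) ^ Suc J) / fact J"
      unfolding poly_exp_poly by (rule Taylor_exp_field)
    also have "\<dots> \<le> exp r * r ^ Suc J / fact J"
      using assms(1)[OF z] assms(2) by (intro divide_right_mono mult_mono power_mono) auto
    also have "\<dots> = (exp r * r) * (inverse (fact J) * r ^ J)" by (simp add: field_simps)
    finally show ?thesis using J by simp
  qed
  then show ?thesis using that J by blast
qed

text \<open>
  Working with the polynomials \<open>exp_poly\<close> instead of the entire function keeps Parseval finite; the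
  $+1$ pays for the approximation error.
\<close>
lemma convolution_norm_sum_le:
  assumes a: "\<And>k. k \<ge> 1 \<Longrightarrow> cmod (a k) \<le> 1"
    and s0: "s 0 = 1" and rec: "\<And>N. N \<ge> 1 \<Longrightarrow> of_nat N * s N = (\<Sum>k=1..N. a k * s (N - k))"
    and B: "\<And>z. cmod z = 1 \<Longrightarrow> cmod ((1 - z ^ l) * trunc_series a K z) \<le> B"
  shows "(\<Sum>M\<le>K. (cmod (\<Sum>k=1..M. a k * (s (M - k) - (if l \<le> M - k then s (M - k - l) else 0))))^2) \<le> (B + 1)^2 * real K"
proof -
  let ?p = "log_poly a K"
  have "cmod (poly ?p z) \<le> real K" if z: "cmod z = 1" for z
  proof -
    have "cmod (poly ?p z) \<le> (\<Sum>k=1..K. 1)"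
      unfolding poly_log_poly
    proof (rule sum_norm_le)
      fix k assume k: "k \<in> {1..K}"
      have "cmod (a k) / real k \<le> 1 / 1" using a[of k] k by (intro frac_le) auto
      then show "cmod (a k / of_nat k * z ^ k) \<le> 1" using z by (simp add: norm_mult norm_divide norm_power)
    qed
    then show ?thesis by simp
  qed
  \<comment> \<open>The accuracy 1/2 times the bound 2 for |1 - z^l| gives the +1 in the
    statement.\<close>
  then obtain J where J: "J \<ge> K" "\<And>z. cmod z = 1 \<Longrightarrow> cmod (exp (poly ?p z) - poly (exp_poly J ?p) z) \<le> 1/2"
    by (rule exp_poly_uniform_approx[where K = K and \<epsilon> = "1/2"]) auto
  \<comment> \<open>On the circle H is close to (1 - z^l) F_K, while its coefficients up to K are
    exactly the differences of s. Multiplying by \<open>logderiv_poly\<close> gives the sums to be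
    estimated.\<close>
  define H where "H = (1 - Polynomial.monom 1 l) * exp_poly J ?p"
  have H: "cmod (poly H z) \<le> B + 1" if z: "cmod z = 1" for z
  proof -
    have tw: "cmod (1 - z ^ l) \<le> 2"
      using norm_triangle_ineq4[of 1 "z ^ l"] z by (simp add: norm_power)
    have e: "trunc_series a K z = exp (poly ?p z)" by (simp add: trunc_series_def poly_log_poly)
    have "poly H z = (1 - z ^ l) * trunc_series a K z - (1 - z ^ l) * (exp (poly ?p z) - poly (exp_poly J ?p) z)"
      by (simp add: H_def e poly_monom algebra_simps)
    then have "cmod (poly H z) \<le> cmod ((1 - z ^ l) * trunc_series a K z) + cmod ((1 - z ^ l) * (exp (poly ?p z) - poly (exp_poly J ?p) z))"
      by (simp only: norm_triangle_ineq4)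
    also have "\<dots> \<le> B + 2 * (1/2)"
      unfolding norm_mult[of "1 - z ^ l" "exp (poly ?p z) - poly (exp_poly J ?p) z"]
      using B[OF z] tw J(2)[OF z] by (intro add_mono mult_mono) auto
    finally show ?thesis by simp
  qed
  have cE: "Polynomial.coeff (exp_poly J ?p) M = s M" if "M \<le> K" for M
    using coeff_exp_poly[OF s0 rec that, of J] that J(1) by simp
  have cH: "Polynomial.coeff H M = s M - (if l \<le> M then s (M - l) else 0)" if "M \<le> K" for M
    using that by (simp add: H_def left_diff_distrib coeff_monom_mult cE)
  have cG: "Polynomial.coeff (H * logderiv_poly a K) M = (\<Sum>k=1..M. a k * (s (M - k) - (if l \<le> M - k then s (M - k - l) else 0)))"
    if M: "M \<le> K" for M
  proof -
    have "Polynomial.coeff (H * logderiv_poly a K) M = (\<Sum>i\<le>M. Polynomial.coeff (logderiv_poly a K) i * Polynomial.coeff H (M - i))"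
      by (simp only: mult.commute[of H] coeff_mult)
    also have "\<dots> = (\<Sum>i=1..M. Polynomial.coeff (logderiv_poly a K) i * Polynomial.coeff H (M - i))"
      by (intro sum.mono_neutral_right) (auto simp: coeff_logderiv_poly)
    also have "\<dots> = (\<Sum>k=1..M. a k * (s (M - k) - (if l \<le> M - k then s (M - k - l) else 0)))"
      using M by (intro sum.cong refl) (simp add: coeff_logderiv_poly cH)
    finally show ?thesis .
  qed
  have "(\<Sum>M\<le>K. (cmod (\<Sum>k=1..M. a k * (s (M - k) - (if l \<le> M - k then s (M - k - l) else 0))))^2)
      = (\<Sum>M\<le>K. (cmod (Polynomial.coeff (H * logderiv_poly a K) M))^2)"
    by (intro sum.cong refl) (simp only: cG atMost_iff)
  also have "\<dots> \<le> (B + 1)^2 * (\<Sum>i\<le>Polynomial.degree (logderiv_poly a K). (cmod (Polynomial.coeff (logderiv_poly a K) i))^2)"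
    by (rule poly_mult_coeff_norm_le[OF H])
  also have "(\<Sum>i\<le>Polynomial.degree (logderiv_poly a K). (cmod (Polynomial.coeff (logderiv_poly a K) i))^2)
      \<le> (\<Sum>i\<le>K. (cmod (Polynomial.coeff (logderiv_poly a K) i))^2)"
    using degree_logderiv_poly[of a K] by (intro sum_mono2) auto
  also have "\<dots> = (\<Sum>i=1..K. (cmod (Polynomial.coeff (logderiv_poly a K) i))^2)"
    by (intro sum.mono_neutral_right) (auto simp: coeff_logderiv_poly)
  also have "\<dots> \<le> (\<Sum>i=1..K. 1)"
    using a by (intro sum_mono) (auto simp: coeff_logderiv_poly power_le_one)
  finally show ?thesis by (simp add: mult_left_mono)
qed

text \<open>Cauchy--Schwarz: at most K weights 1/M^2, each at most 4/K^2, sum to 4/K, which cancels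
  the factor K of the mean square. The 2 is the square root of 4.\<close>

lemma sum_over_upper_half_le:
  fixes g :: "nat \<Rightarrow> real"
  assumes "K \<ge> 1" "(\<Sum>M\<le>K. (g M)^2) \<le> B^2 * real K" "B \<ge> 0"
  shows "(\<Sum>M\<in>{K div 2<..K}. \<bar>g M\<bar> / real M) \<le> 2 * B"
proof -
  let ?I = "{K div 2<..K}"
  have K: "real K > 0" using assms by simp
  have "(\<Sum>M\<in>?I. (1 / real M) * \<bar>g M\<bar>)^2 \<le> (\<Sum>M\<in>?I. (1 / real M)^2) * (\<Sum>M\<in>?I. \<bar>g M\<bar>^2)"
    by (rule Cauchy_Schwarz_ineq_sum)
  also have "\<dots> \<le> (4 / real K) * (B^2 * real K)"
  proof (intro mult_mono sum_nonneg)
    have "(\<Sum>M\<in>?I. (1 / real M)^2) \<le> (\<Sum>M\<in>?I. (2 / real K)^2)"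
    proof (intro sum_mono power_mono)
      fix M assume "M \<in> ?I"
      then have "real K \<le> 2 * real M" by auto
      then show "1 / real M \<le> 2 / real K" using K by (simp add: field_simps split: if_splits)
    qed auto
    also have "\<dots> \<le> real K * (2 / real K)^2"
      by (simp add: mult_right_mono)
    also have "\<dots> = 4 / real K" using K by (simp add: power2_eq_square)
    finally show "(\<Sum>M\<in>?I. (1 / real M)^2) \<le> 4 / real K" .
    have "(\<Sum>M\<in>?I. \<bar>g M\<bar>^2) \<le> (\<Sum>M\<le>K. \<bar>g M\<bar>^2)" by (intro sum_mono2) auto
    then show "(\<Sum>M\<in>?I. \<bar>g M\<bar>^2) \<le> B^2 * real K" using assms(2) by simp
  qed (use K in auto)
  also have "\<dots> = (2 * B)^2" using K by (simp add: power_mult_distrib)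
  finally have "(\<Sum>M\<in>?I. (1 / real M) * \<bar>g M\<bar>)^2 \<le> (2 * B)^2" .
  then have "(\<Sum>M\<in>?I. (1 / real M) * \<bar>g M\<bar>) \<le> 2 * B" using assms(3) by (rule_tac power2_le_imp_le) auto
  then show ?thesis by simp
qed

text \<open>Halving N removes one block and lowers the logarithm by at least 1. The induction stops
  once N div 2 \<le> l, when a single block covers the range.\<close>

lemma dyadic_sum_le:
  fixes g :: "nat \<Rightarrow> real"
  assumes "l \<ge> 1" "B \<ge> 0" "\<And>K. 1 \<le> K \<Longrightarrow> K \<le> N \<Longrightarrow> (\<Sum>M\<in>{K div 2<..K}. g M) \<le> B"
    and "\<And>M. g M \<ge> 0" and "N > l"
  shows "(\<Sum>M\<in>{l<..N}. g M) \<le> B * (log 2 (real N / real l) + 1)"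
  using assms(3,5)
proof (induction N rule: less_induct)
  case (less N)
  have N: "N \<ge> 2" using less.prems assms(1) by simp
  have blk: "(\<Sum>M\<in>{N div 2<..N}. g M) \<le> B" using less.prems N by simp
  show ?case
  proof (cases "N div 2 > l")
    case True
    have "{l<..N} = {l<..N div 2} \<union> {N div 2<..N}" using True N by auto
    then have "(\<Sum>M\<in>{l<..N}. g M) = (\<Sum>M\<in>{l<..N div 2}. g M) + (\<Sum>M\<in>{N div 2<..N}. g M)"
      by (simp only:) (rule sum.union_disjoint, auto)
    also have "\<dots> \<le> B * (log 2 (real (N div 2) / real l) + 1) + B"
    proof (intro add_mono blk less.IH)
      show "(\<Sum>M\<in>{K div 2<..K}. g M) \<le> B" if "1 \<le> K" "K \<le> N div 2" for K
        using less.prems(1)[of K] that by auto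
    qed (use True N in auto)
    also have "log 2 (real (N div 2) / real l) \<le> log 2 (real N / real l / 2)"
    proof -
      have "real (N div 2) \<le> real N / 2" by linarith
      then have "real (N div 2) / real l \<le> real N / 2 / real l" by (intro divide_right_mono) auto
      then have "real (N div 2) / real l \<le> real N / real l / 2" by simp
      moreover have "0 < real (N div 2) / real l" using True assms(1) by simp
      ultimately show ?thesis by (simp add: log_le_cancel_iff)
    qed
    also have "log 2 (real N / real l / 2) = log 2 (real N / real l) - 1"
    proof -
      have "0 < real N / real l" using N assms(1) by simp
      then show ?thesis by (subst log_divide) auto
    qed
    finally have "(\<Sum>M\<in>{l<..N}. g M) \<le> B * (log 2 (real N / real l) - 1 + 1) + B"
      using assms(2) by (simp add: mult_left_mono)
    then show ?thesis by (simp add: distrib_left)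
  next
    case False
    have "(\<Sum>M\<in>{l<..N}. g M) \<le> (\<Sum>M\<in>{N div 2<..N}. g M)"
      using False assms(4) by (intro sum_mono2) auto
    also have "\<dots> \<le> B * 1" using blk by simp
    also have "\<dots> \<le> B * (log 2 (real N / real l) + 1)"
      using assms(1,2) less.prems by (intro mult_left_mono) (auto simp: zero_le_log_cancel_iff)
    finally show ?thesis .
  qed
qed

lemma convolution_coeff_bounded:
  assumes a: "\<And>k. k \<ge> 1 \<Longrightarrow> cmod (a k) \<le> 1"
    and s0: "s 0 = 1" and rec: "\<And>N. N \<ge> 1 \<Longrightarrow> of_nat N * s N = (\<Sum>k=1..N. a k * s (N - k))"
  shows "cmod (s N) \<le> (1::real)"
proof (induction N rule: less_induct)
  case (less N)
  show ?case
  proof (cases "N = 0")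
    case False
    have "real N * cmod (s N) = cmod (\<Sum>k=1..N. a k * s (N - k))"
    proof -
      have "real N * cmod (s N) = cmod (of_nat N * s N)" by (simp add: norm_mult)
      also have "of_nat N * s N = (\<Sum>k=1..N. a k * s (N - k))" using rec[of N] False by simp
      finally show ?thesis .
    qed
    also have "\<dots> \<le> (\<Sum>k=1..N. 1)"
    proof (rule sum_norm_le)
      fix k assume k: "k \<in> {1..N}"
      then show "cmod (a k * s (N - k)) \<le> 1"
        unfolding norm_mult using a[of k] less[of "N - k"] by (intro mult_le_one) auto
    qed
    finally show ?thesis using False by simp
  qed (simp add: s0)
qed

text \<open>Let d be the coefficients of (1 - z^l) F and e their convolution with a. By the
  recurrence e(M) = M d(M) + l s(M - l) for M > l, and |e(M)| is at most the sum of |d| below M. The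
  latter is applied once, at M = n + l; the former then turns every |d(M)| with M > l into |e(M)| /
  M up to l/M, and the mean square of e is known on each block. At the end, n (s(n + l) - s(n)) is
  e(n + l) up to a term of size l.\<close>

lemma shifted_difference_bound:
  assumes a: "\<And>k. k \<ge> 1 \<Longrightarrow> cmod (a k) \<le> 1"
    and s0: "s 0 = 1" and rec: "\<And>N. N \<ge> 1 \<Longrightarrow> of_nat N * s N = (\<Sum>k=1..N. a k * s (N - k))"
    and n: "n \<ge> 2" and l: "1 \<le> l" "l \<le> n"
    and B: "\<And>w. cmod w = 1 \<Longrightarrow> cmod ((1 - w ^ l) * trunc_series a (n-1) w) \<le> B"
  shows "real n * cmod (s (n + l) - s n) \<le> 50 * exp 8 * (B + real l) * ln (2 * real n / real l)"
proof -
  define d where "d = (\<lambda>M. s M - (if l \<le> M then s (M - l) else 0))"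
  define e where "e = (\<lambda>M. \<Sum>k=1..M. a k * d (M - k))"
  note s1 = convolution_coeff_bounded[OF a s0 rec]
  have e_eq: "e M = of_nat M * s M - of_nat (M - l) * s (M - l)" if M: "M \<ge> 1" "M \<ge> l" for M
  proof -
    have "e M = (\<Sum>k=1..M. a k * s (M - k)) - (\<Sum>k=1..M. a k * (if l \<le> M - k then s (M - k - l) else 0))"
      by (simp add: e_def d_def right_diff_distrib sum_subtractf)
    also have "(\<Sum>k=1..M. a k * (if l \<le> M - k then s (M - k - l) else 0)) = (\<Sum>k=1..M-l. a k * s (M - l - k))"
      using l(1) by (intro sum.mono_neutral_cong_right) (auto simp: diff_commute add.commute)
    also have "\<dots> = of_nat (M - l) * s (M - l)"
      using rec[of "M - l"] by (cases "M - l = 0") simp_all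
    finally show ?thesis using rec[OF M(1)] by simp
  qed
  have d2: "cmod (d M) \<le> 2" for M
  proof -
    have "cmod (d M) \<le> cmod (s M) + cmod (if l \<le> M then s (M - l) else 0)"
      unfolding d_def by (rule norm_triangle_ineq4)
    also have "\<dots> \<le> 1 + 1" using s1 by (intro add_mono) auto
    finally show ?thesis by simp
  qed
  have de: "cmod (d M) \<le> cmod (e M) / real M + real l / real M" if M: "M > l" for M
  proof -
    have "of_nat M * d M = e M - of_nat l * s (M - l)"
      using M l e_eq[of M] by (simp add: d_def of_nat_diff algebra_simps)
    then have "real M * cmod (d M) = cmod (e M - of_nat l * s (M - l))"
      by (metis norm_mult norm_of_nat)
    also have "\<dots> \<le> cmod (e M) + cmod (of_nat l * s (M - l))" by (rule norm_triangle_ineq4)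
    also have "cmod (of_nat l * s (M - l)) \<le> real l * 1"
      unfolding norm_mult norm_of_nat using s1 by (intro mult_left_mono) auto
    finally show ?thesis using M by (simp add: field_simps)
  qed
  have B0: "0 \<le> B" using B[of 1] by simp
  define B' where "B' = exp 8 * (B + real l) + 1"
  have B'0: "B' \<ge> 0" using B0 by (simp add: B'_def)
  have blk: "(\<Sum>M\<in>{K div 2<..K}. cmod (e M) / real M + real l / real M) \<le> 2 * B' + 2 * real l"
    if K: "1 \<le> K" "K \<le> n + l" for K
  proof -
    have "cmod ((1 - z ^ l) * trunc_series a K z) \<le> exp 8 * (B + real l)" if "cmod z = 1" for z
      by (rule weighted_trunc_series_bound[OF a n l(1) B _ _ that]) (use K l n in auto)
    note convolution_norm_sum_le[OF a s0 rec this]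
    then have "(\<Sum>M\<le>K. (cmod (e M))^2) \<le> B'^2 * real K"
      unfolding e_def d_def B'_def .
    then have 1: "(\<Sum>M\<in>{K div 2<..K}. \<bar>cmod (e M)\<bar> / real M) \<le> 2 * B'"
      by (intro sum_over_upper_half_le K B'0)
    have "(\<Sum>M\<in>{K div 2<..K}. real l / real M) \<le> (\<Sum>M\<in>{K div 2<..K}. real l * (2 / real K))"
    proof (intro sum_mono)
      fix M assume "M \<in> {K div 2<..K}"
      then have "real K \<le> 2 * real M" "real M > 0" by auto
      then have "1 / real M \<le> 2 / real K" using K by (simp add: field_simps)
      then have "real l * (1 / real M) \<le> real l * (2 / real K)" by (rule mult_left_mono) simp
      then show "real l / real M \<le> real l * (2 / real K)" by simp
    qed
    also have "\<dots> = real (K - K div 2) * (real l * (2 / real K))"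
      by (simp only: sum_constant card_greaterThanAtMost)
    also have "\<dots> \<le> real K * (real l * (2 / real K))" by (intro mult_right_mono) auto
    also have "\<dots> = 2 * real l" using K by simp
    finally show ?thesis using 1 by (simp add: sum.distrib)
  qed
  have lg: "(\<Sum>M\<in>{l<..n+l}. cmod (e M) / real M + real l / real M) \<le> (2 * B' + 2 * real l) * (log 2 (real (n + l) / real l) + 1)"
    by (rule dyadic_sum_le) (use blk l n B'0 in auto)
  define L where "L = ln (2 * real n / real l)"
  have ln2: "ln 2 \<ge> (1/2::real)" using ln2_ge_two_thirds by linarith
  have "2 \<le> 2 * real n / real l" using l by (simp add: field_simps)
  then have "ln 2 \<le> L" unfolding L_def using l by (intro ln_mono) auto
  then have L: "L \<ge> 1/2" using ln2 by linarith
  have "real (n + l) / real l \<le> 2 * real n / real l" using l by (intro divide_right_mono) auto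
  then have "log 2 (real (n + l) / real l) \<le> log 2 (2 * real n / real l)"
    using l by (subst log_le_cancel_iff) auto
  also have "\<dots> = L / ln 2" by (simp add: log_def L_def)
  also have "\<dots> \<le> L / (1/2)" using L ln2 by (intro divide_left_mono) auto
  \<comment> \<open>The hypothesis l \<le> n gives L \<ge> ln 2 \<ge> 1/2, so the constant 1 is
    absorbed by 2L. The same lower bound later absorbs every term without L.\<close>
  finally have "log 2 (real (n + l) / real l) + 1 \<le> 4 * L" using L by simp
  then have lg2: "(\<Sum>M\<in>{l<..n+l}. cmod (e M) / real M + real l / real M) \<le> (2 * B' + 2 * real l) * (4 * L)"
    using B'0 by (intro order_trans[OF lg] mult_left_mono) auto
  have "cmod (e (n + l)) \<le> (\<Sum>k=1..n+l. cmod (d (n + l - k)))"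
    unfolding e_def
  proof (rule sum_norm_le)
    fix k assume "k \<in> {1..n+l}"
    then have "cmod (a k) * cmod (d (n + l - k)) \<le> 1 * cmod (d (n + l - k))"
      using a[of k] by (intro mult_right_mono) auto
    then show "cmod (a k * d (n + l - k)) \<le> cmod (d (n + l - k))" by (simp add: norm_mult)
  qed
  also have "\<dots> = (\<Sum>M<n+l. cmod (d M))"
    by (rule sum.reindex_bij_witness[where i = "\<lambda>M. n + l - M" and j = "\<lambda>k. n + l - k"]) auto
  \<comment> \<open>Up to l the trivial bound 2 is affordable, since an error O(l) is allowed; only
    the indices above l are treated by blocks.\<close>
  also have "\<dots> \<le> (\<Sum>M\<in>{..l} \<union> {l<..n+l}. cmod (d M))"
    by (intro sum_mono2) auto
  also have "\<dots> = (\<Sum>M\<le>l. cmod (d M)) + (\<Sum>M\<in>{l<..n+l}. cmod (d M))"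
    by (intro sum.union_disjoint) auto
  also have "\<dots> \<le> (\<Sum>M\<le>l. 2) + (\<Sum>M\<in>{l<..n+l}. cmod (e M) / real M + real l / real M)"
    using d2 de by (intro add_mono sum_mono) auto
  also have "(\<Sum>M\<le>l. 2) = 2 * real l + 2" by simp
  finally have en: "cmod (e (n + l)) \<le> 2 * real l + 2 + (2 * B' + 2 * real l) * (4 * L)"
    using lg2 by linarith
  have "of_nat n * (s (n + l) - s n) = e (n + l) - of_nat l * s (n + l)"
    using e_eq[of "n + l"] n by (simp add: algebra_simps)
  then have "real n * cmod (s (n + l) - s n) = cmod (e (n + l) - of_nat l * s (n + l))"
    by (metis norm_mult norm_of_nat)
  also have "\<dots> \<le> cmod (e (n + l)) + cmod (of_nat l * s (n + l))" by (rule norm_triangle_ineq4)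
  also have "cmod (of_nat l * s (n + l)) \<le> real l * 1"
    unfolding norm_mult norm_of_nat using s1 by (intro mult_left_mono) auto
  finally have "real n * cmod (s (n + l) - s n) \<le> 3 * real l + 2 + (2 * B' + 2 * real l) * (4 * L)"
    using en by linarith
  also have "\<dots> \<le> 50 * (exp 8 * (B + real l)) * L"
  proof -
    define Q where "Q = exp 8 * (B + real l)"
    have "1 * (B + real l) \<le> Q" unfolding Q_def using B0 by (intro mult_right_mono) auto
    then have Q: "real l \<le> Q" "1 \<le> Q" using B0 l by auto
    have "Q * (1/2) \<le> Q * L" using L Q by (intro mult_left_mono) auto
    moreover have "real l * L \<le> Q * L" "1 * L \<le> Q * L" using L Q by (intro mult_right_mono; auto)+
    moreover have "(2 * (Q + 1) + 2 * real l) * (4 * L) = 8 * (Q * L) + 8 * L + 8 * (real l * L)"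
      by (simp add: algebra_simps)
    ultimately have "3 * real l + 2 + (2 * (Q + 1) + 2 * real l) * (4 * L) \<le> 50 * (Q * L)"
      using Q by linarith
    then show ?thesis by (simp add: B'_def Q_def mult_ac)
  qed
  finally show ?thesis by (simp add: L_def mult_ac)
qed

text \<open>The theorem for abstract sequences, rotated so that the maximum is at 1. It rests only
  on |a| \<le> 1, the recurrence and that maximality. The exponent 3 is 2 from
  \<open>circle_bound\<close> plus 1 from ln (2n/l) \<le> 2 ln n.\<close>

lemma Lipschitz_sequence:
  "\<exists>C>0. \<forall>(a::nat \<Rightarrow> complex) s n l.
     (\<forall>k\<ge>1. cmod (a k) \<le> 1) \<and> s 0 = 1 \<and> (\<forall>N\<ge>1. of_nat N * s N = (\<Sum>k=1..N. a k * s (N - k))) \<and>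
     n \<ge> 2 \<and> 1 \<le> l \<and> l \<le> n \<and> (\<forall>w. cmod w = 1 \<longrightarrow> cmod (trunc_series a (n-1) w) \<le> cmod (trunc_series a (n-1) 1)) \<longrightarrow>
     cmod (s (n + l) - s n) \<le> C * ((real l / real n) powr (1 - 2 / pi) * ln (2 * real n / real l)
                       + ln (real n) powr 3 / real n powr (1 - c_const (least_odd_nondivisor l)))"
proof -
  obtain C1 where C1: "C1 > 0" and C1': "\<And>n l \<phi>. n \<ge> 2 \<Longrightarrow> 1 \<le> l \<Longrightarrow>
     cmod (1 - cis (2 * pi * real l * \<phi>)) * exp (\<Sum>k=1..n-1. \<bar>cos (pi * \<phi> * real k)\<bar> / real k)
     \<le> C1 * (real n powr (2/pi) * real l powr (1 - 2/pi)
            + ln (real n) ^ 2 * real n powr c_const (least_odd_nondivisor l))"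
    using circle_bound by blast
  \<comment> \<open>100 is 50 from \<open>shifted_difference_bound\<close> times the 2 in ln (2n/l)
    \<le> 2 ln n; the +1 absorbs the term l, since l \<le> U for l \<le> n.\<close>
  define C where "C = 100 * exp 8 * (C1 + 1)"
  have "cmod (s (n + l) - s n) \<le> C * ((real l / real n) powr (1 - 2 / pi) * ln (2 * real n / real l)
                       + ln (real n) powr 3 / real n powr (1 - c_const (least_odd_nondivisor l)))"
    if a: "\<forall>k\<ge>1. cmod (a k) \<le> 1" and s0: "s 0 = 1" and rec: "\<forall>N\<ge>1. of_nat N * s N = (\<Sum>k=1..N. a k * s (N - k))"
      and n: "n \<ge> 2" and l: "1 \<le> l" "l \<le> n"
      and max: "\<forall>w. cmod w = 1 \<longrightarrow> cmod (trunc_series a (n-1) w) \<le> cmod (trunc_series a (n-1) 1)"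
    for a s :: "nat \<Rightarrow> complex" and n l :: nat
  proof -
    define c where "c = c_const (least_odd_nondivisor l)"
    define U where "U = real n powr (2/pi) * real l powr (1 - 2/pi)"
    define V where "V = ln (real n) ^ 2 * real n powr c"
    define L where "L = ln (2 * real n / real l)"
    have UV: "U \<ge> 0" "V \<ge> 0" by (auto simp: U_def V_def)
    have lU: "real l \<le> U"
    proof -
      have "real l = real l powr (2/pi) * real l powr (1 - 2/pi)" using l by (simp add: powr_add[symmetric])
      also have "\<dots> \<le> U" unfolding U_def using l by (intro mult_right_mono powr_mono2) auto
      finally show ?thesis .
    qed
    have B: "cmod ((1 - w ^ l) * trunc_series a (n-1) w) \<le> C1 * (U + V)" if w: "cmod w = 1" for w
    proof -
      define \<phi> where "\<phi> = Arg w / (2 * pi)"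
      have we: "w = cis (2 * pi * \<phi>)" using w by (simp add: \<phi>_def) (metis cis_Arg_unique rcis_cmod_Arg rcis_def mult_1 of_real_1)
      have "w ^ l = cis (2 * pi * real l * \<phi>)" by (simp add: we Complex.DeMoivre mult_ac)
      moreover have "cmod (trunc_series a (n-1) w) \<le> exp (\<Sum>k=1..n-1. \<bar>cos (pi * \<phi> * real k)\<bar> / real k)"
        unfolding we by (rule norm_trunc_series_le_sqrt) (use a max in auto)
      ultimately have "cmod ((1 - w ^ l) * trunc_series a (n-1) w) \<le>
          cmod (1 - cis (2 * pi * real l * \<phi>)) * exp (\<Sum>k=1..n-1. \<bar>cos (pi * \<phi> * real k)\<bar> / real k)"
        unfolding norm_mult by (simp add: mult_left_mono)
      also have "\<dots> \<le> C1 * (U + V)" using C1'[OF n l(1)] by (simp add: U_def V_def c_def)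
      finally show ?thesis .
    qed
    have "real n * cmod (s (n + l) - s n) \<le> 50 * exp 8 * (C1 * (U + V) + real l) * L"
      unfolding L_def by (rule shifted_difference_bound) (use a s0 rec n l B in auto)
    also have "2 \<le> 2 * real n / real l" using l by (simp add: field_simps)
    then have L0: "L \<ge> 0" unfolding L_def by (intro ln_ge_zero) auto
    have "50 * exp 8 * (C1 * (U + V) + real l) * L \<le> 50 * exp 8 * (C1 * (U + V) + (U + V)) * L"
      using lU UV L0 by (intro mult_right_mono mult_left_mono add_left_mono) auto
    also have "\<dots> = 50 * exp 8 * (C1 + 1) * (U * L + V * L)" by (simp add: algebra_simps)
    \<comment> \<open>The logarithm is kept next to U, where the theorem has it, and enlarged to 2
      ln n only next to V.\<close>
    also have "\<dots> \<le> 50 * exp 8 * (C1 + 1) * (2 * (U * L) + V * (2 * ln (real n)))"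
    proof (intro mult_left_mono add_mono)
      have "2 * real n / real l \<le> 2 * real n" using l by (simp add: divide_le_eq mult_le_cancel_left1)
      also have "\<dots> \<le> real n * real n" using n by (intro mult_right_mono) auto
      finally have "L \<le> ln (real n * real n)" unfolding L_def using l by (intro ln_mono) auto
      then show "L \<le> 2 * ln (real n)" using n by (simp add: ln_mult)
    qed (use UV L0 C1 in auto)
    also have "\<dots> = C * (U * L + V * ln (real n))" by (simp add: C_def algebra_simps)
    finally have "cmod (s (n + l) - s n) \<le> C * (U * L + V * ln (real n)) / real n"
      using n by (simp add: field_simps)
    also have "\<dots> = C * (U / real n * L + V * ln (real n) / real n)"
      using n by (simp add: field_simps)
    also have "U / real n = (real l / real n) powr (1 - 2 / pi)"
    proof -
      have "(real l / real n) powr (1 - 2 / pi) = real l powr (1 - 2/pi) / real n powr (1 - 2/pi)"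
        by (simp add: powr_divide)
      also have "real n powr (1 - 2/pi) = real n / real n powr (2/pi)" using n by (simp add: powr_diff)
      finally show ?thesis by (simp add: U_def)
    qed
    also have "V * ln (real n) / real n = ln (real n) powr 3 / real n powr (1 - c)"
    proof -
      have "ln (real n) > 0" using n by (intro ln_gt_zero) auto
      then have "ln (real n) powr 3 = ln (real n) ^ 2 * ln (real n)"
        by (simp add: powr_numeral power3_eq_cube power2_eq_square)
      moreover have "real n powr (1 - c) = real n / real n powr c" using n by (simp add: powr_diff)
      ultimately show ?thesis by (simp add: V_def)
    qed
    finally show ?thesis by (simp add: L_def c_def)
  qed
  moreover have "C > 0" using C1 by (simp add: C_def)
  ultimately show ?thesis by blast
qed

section \<open>Multiplicative functions on monic polynomials\<close>

context field
begin

lemma poly_ring_domain: "domain (poly_ring R)"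
  using univ_poly_is_domain[OF carrier_is_subring] .

lemma monic_mult:
  assumes "F \<in> monic_polys R" "G \<in> monic_polys R"
  shows "F \<otimes>\<^bsub>poly_ring R\<^esub> G \<in> monic_polys R"
    and "Polynomials.degree (F \<otimes>\<^bsub>poly_ring R\<^esub> G) = Polynomials.degree F + Polynomials.degree G"
proof -
  interpret UP: domain "poly_ring R" by (rule poly_ring_domain)
  have FG: "F \<in> carrier (poly_ring R)" "G \<in> carrier (poly_ring R)" "F \<noteq> []" "G \<noteq> []"
      "lead_coeff F = \<one>" "lead_coeff G = \<one>"
    using assms by (auto simp: monic_polys_def)
  then have p: "polynomial (carrier R) F" "polynomial (carrier R) G" by (auto simp: univ_poly_carrier)
  have "F \<otimes>\<^bsub>poly_ring R\<^esub> G \<noteq> []"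
    using UP.integral[of F G] FG by (auto simp: univ_poly_zero)
  moreover have "lead_coeff (F \<otimes>\<^bsub>poly_ring R\<^esub> G) = \<one>"
    using poly_mult_lead_coeff[OF carrier_is_subring p] FG by (simp add: univ_poly_mult)
  ultimately show "F \<otimes>\<^bsub>poly_ring R\<^esub> G \<in> monic_polys R"
    using FG by (simp add: monic_polys_def)
  show "Polynomials.degree (F \<otimes>\<^bsub>poly_ring R\<^esub> G) = Polynomials.degree F + Polynomials.degree G"
    using poly_mult_degree_eq[OF carrier_is_subring p] FG by (simp add: univ_poly_mult)
qed

lemma monic_one: "\<one>\<^bsub>poly_ring R\<^esub> \<in> monic_polys R" "Polynomials.degree (\<one>\<^bsub>poly_ring R\<^esub>) = 0"
proof -
  interpret UP: domain "poly_ring R" by (rule poly_ring_domain)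
  show "\<one>\<^bsub>poly_ring R\<^esub> \<in> monic_polys R"
    using UP.one_closed by (auto simp: monic_polys_def univ_poly_one)
qed (simp add: univ_poly_one)

lemma monic_carrier: "F \<in> monic_polys R \<Longrightarrow> F \<in> carrier (poly_ring R)"
  by (simp add: monic_polys_def)

lemma monic_nonzero: "F \<in> monic_polys R \<Longrightarrow> F \<noteq> \<zero>\<^bsub>poly_ring R\<^esub>"
  by (simp add: monic_polys_def univ_poly_zero)

lemma monic_irreducible_monic: "P \<in> monic_irreducibles R \<Longrightarrow> P \<in> monic_polys R"
  by (simp add: monic_irreducibles_def)

lemma monic_power: "P \<in> monic_polys R \<Longrightarrow> P [^]\<^bsub>poly_ring R\<^esub> (k::nat) \<in> monic_polys R"
proof (induction k)
  case (Suc k)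
  interpret UP: domain "poly_ring R" by (rule poly_ring_domain)
  show ?case using monic_mult(1)[OF Suc.IH[OF Suc.prems] Suc.prems] by simp
qed (simp add: monic_one)

lemma monic_power_degree:
  "P \<in> monic_polys R \<Longrightarrow> Polynomials.degree (P [^]\<^bsub>poly_ring R\<^esub> (k::nat)) = k * Polynomials.degree P"
  using polynomial_pow_degree[OF monic_carrier] by simp

lemma monic_cofactor:
  assumes "F \<in> monic_polys R" "G \<in> carrier (poly_ring R)" "F \<otimes>\<^bsub>poly_ring R\<^esub> G \<in> monic_polys R"
  shows "G \<in> monic_polys R"
proof -
  interpret UP: domain "poly_ring R" by (rule poly_ring_domain)
  have F: "polynomial (carrier R) F" "polynomial (carrier R) G" "F \<noteq> []" "lead_coeff F = \<one>" "F \<in> carrier (poly_ring R)"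
    using assms by (auto simp: monic_polys_def univ_poly_carrier)
  have G: "G \<noteq> []"
  proof
    assume "G = []"
    then have "F \<otimes>\<^bsub>poly_ring R\<^esub> G = \<zero>\<^bsub>poly_ring R\<^esub>"
      using UP.r_null[OF F(5)] by (simp add: univ_poly_zero)
    then show False using assms(3) monic_nonzero by blast
  qed
  then have "lead_coeff G \<in> carrier R" using F(2) by (auto simp: polynomial_def)
  moreover have "\<one> = lead_coeff F \<otimes> lead_coeff G"
    using poly_mult_lead_coeff[OF carrier_is_subring F(1,2)] F G assms(3)
    by (simp add: univ_poly_mult monic_polys_def)
  ultimately show ?thesis using F G assms(2) by (simp add: monic_polys_def)
qed

lemma monic_degree_zero:
  assumes "F \<in> monic_polys R" "Polynomials.degree F = 0"
  shows "F = \<one>\<^bsub>poly_ring R\<^esub>"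
proof -
  have "length F = 1" using assms by (cases F) (auto simp: monic_polys_def)
  then obtain x where "F = [x]" by (auto simp: length_Suc_conv)
  then show ?thesis using assms by (simp add: monic_polys_def univ_poly_one)
qed

text \<open>An irreducible divisor Q exists in the principal ideal domain; below, \<open>c\<close>
  is its leading coefficient as a constant polynomial and \<open>k\<close> the inverse unit, so that
  P = k Q is monic and still irreducible.\<close>

lemma exists_monic_irreducible_divisor:
  assumes "F \<in> carrier (poly_ring R)" "F \<noteq> []" "Polynomials.degree F \<noteq> 0"
  obtains P where "P \<in> monic_irreducibles R" "P pdivides F"
proof -
  interpret UP: principal_domain "poly_ring R"
    using univ_poly_is_principal[OF carrier_is_subfield] .
  have "F \<notin> Units (poly_ring R)" using univ_poly_units'[OF carrier_is_subfield, of F] assms by simp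
  moreover have "F \<in> carrier (poly_ring R) - {\<zero>\<^bsub>poly_ring R\<^esub>}" using assms by (simp add: univ_poly_zero)
  ultimately obtain Q where Q: "Q \<in> carrier (poly_ring R)" "pirreducible (carrier R) Q" "Q divides\<^bsub>poly_ring R\<^esub> F"
    using UP.exists_irreducible_divisor by metis
  have Q0: "Q \<noteq> []" using pirreducibleE(1)[OF carrier_is_subring Q(1,2)] .
  have lQ: "lead_coeff Q \<in> carrier R - {\<zero>}"
    using Q(1)[folded univ_poly_carrier] Q0 unfolding polynomial_def by auto
  define c where "c = [lead_coeff Q]"
  define k where "k = [inv (lead_coeff Q)]"
  have ck: "c \<in> Units (poly_ring R)" "k \<in> Units (poly_ring R)"
    using lQ field_Units Units_inv_Units unfolding univ_poly_carrier_units c_def k_def by fastforce+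
  have ck1: "k \<otimes>\<^bsub>poly_ring R\<^esub> c = \<one>\<^bsub>poly_ring R\<^esub>"
    using lQ field_Units by (simp add: c_def k_def univ_poly_mult univ_poly_one)
  have ckc: "c \<in> carrier (poly_ring R)" "k \<in> carrier (poly_ring R)" using ck by auto
  define P where "P = k \<otimes>\<^bsub>poly_ring R\<^esub> Q"
  have P: "P \<in> carrier (poly_ring R)" using ckc Q by (simp add: P_def)
  have Qc: "Q = c \<otimes>\<^bsub>poly_ring R\<^esub> P"
  proof -
    have "c \<otimes>\<^bsub>poly_ring R\<^esub> P = (c \<otimes>\<^bsub>poly_ring R\<^esub> k) \<otimes>\<^bsub>poly_ring R\<^esub> Q"
      unfolding P_def using ckc Q(1) by (rule_tac UP.m_assoc[symmetric])
    also have "c \<otimes>\<^bsub>poly_ring R\<^esub> k = \<one>\<^bsub>poly_ring R\<^esub>" using ck1 UP.m_comm[OF ckc] by simp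
    finally show ?thesis using UP.l_one[OF Q(1)] by simp
  qed
  have P0: "P \<noteq> []" using Qc Q0 UP.r_null[OF ckc(1)] by (auto simp: univ_poly_zero)
  have "lead_coeff P = \<one>"
  proof -
    have "lead_coeff P = lead_coeff k \<otimes> lead_coeff Q"
      unfolding P_def univ_poly_mult
      by (rule poly_mult_lead_coeff[OF carrier_is_subring]) (use ckc Q(1) Q0 in \<open>auto simp: univ_poly_carrier k_def\<close>)
    then show ?thesis using lQ field_Units by (simp add: k_def)
  qed
  moreover have "pirreducible (carrier R) P"
  proof (rule pirreducibleI[OF carrier_is_subring P P0])
    show "P \<notin> Units (poly_ring R)"
    proof
      assume "P \<in> Units (poly_ring R)"
      then have "Q \<in> Units (poly_ring R)" unfolding Qc using ck by auto
      then show False using pirreducibleE(2)[OF carrier_is_subring Q(1,2)] by simp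
    qed
    fix q r assume qr: "q \<in> carrier (poly_ring R)" "r \<in> carrier (poly_ring R)" "P = q \<otimes>\<^bsub>poly_ring R\<^esub> r"
    then have "Q = (c \<otimes>\<^bsub>poly_ring R\<^esub> q) \<otimes>\<^bsub>poly_ring R\<^esub> r"
      using Qc ckc by (simp add: UP.m_assoc)
    then have "c \<otimes>\<^bsub>poly_ring R\<^esub> q \<in> Units (poly_ring R) \<or> r \<in> Units (poly_ring R)"
      using pirreducibleE(3)[OF carrier_is_subring Q(1,2)] qr ckc by auto
    moreover have "q = k \<otimes>\<^bsub>poly_ring R\<^esub> (c \<otimes>\<^bsub>poly_ring R\<^esub> q)"
      using ck1 ckc qr by (simp add: UP.m_assoc[symmetric])
    ultimately show "q \<in> Units (poly_ring R) \<or> r \<in> Units (poly_ring R)"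
      using ck by (metis UP.Units_m_closed)
  qed
  ultimately have "P \<in> monic_irreducibles R"
    using P P0 by (simp add: monic_irreducibles_def monic_polys_def)
  moreover have "P pdivides F"
  proof -
    have "P divides\<^bsub>poly_ring R\<^esub> Q" unfolding Qc using ckc P by (subst UP.m_comm) (auto intro: UP.divides_prod_r)
    then show ?thesis unfolding pdivides_def using Q(3) P by (rule UP.divides_trans)
  qed
  ultimately show ?thesis by (rule that)
qed

lemma monic_irreducible_dvd_eq:
  assumes "P \<in> monic_irreducibles R" "Q \<in> monic_irreducibles R" "P pdivides Q"
  shows "P = Q"
proof -
  have P: "P \<in> monic_polys R" "Q \<in> monic_polys R" "pirreducible (carrier R) P" "pirreducible (carrier R) Q"
     "P \<in> carrier (poly_ring R)" "Q \<in> carrier (poly_ring R)"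
    using assms by (auto simp: monic_irreducibles_def monic_polys_def)
  obtain C where C: "C \<in> carrier (poly_ring R)" "Q = P \<otimes>\<^bsub>poly_ring R\<^esub> C"
    using assms(3) by (auto simp: pdivides_def factor_def)
  then have "C \<in> Units (poly_ring R)"
    using pirreducibleE(3)[OF carrier_is_subring P(6,4,5) C(1)] pirreducibleE(2)[OF carrier_is_subring P(5,3)] by simp
  then show ?thesis using monic_associated_imp_eq[OF P(1,2)] C by blast
qed

lemma irreducible_power_split:
  assumes P: "P \<in> monic_irreducibles R" and "N \<in> monic_polys R"
  obtains e N' where "N = P [^]\<^bsub>poly_ring R\<^esub> (e::nat) \<otimes>\<^bsub>poly_ring R\<^esub> N'" "N' \<in> monic_polys R" "\<not> P pdivides N'"
proof -
  interpret UP: domain "poly_ring R" by (rule poly_ring_domain)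
  have Pm: "P \<in> monic_polys R" "P \<in> carrier (poly_ring R)" "Polynomials.degree P \<ge> 1"
    using P monic_irreducible_monic monic_irreducible_degree by auto
  have "\<exists>e N'. N = P [^]\<^bsub>poly_ring R\<^esub> (e::nat) \<otimes>\<^bsub>poly_ring R\<^esub> N' \<and> N' \<in> monic_polys R \<and> \<not> P pdivides N'"
    using assms(2)
  proof (induction "Polynomials.degree N" arbitrary: N rule: less_induct)
    case less
    show ?case
    proof (cases "P pdivides N")
      case False
      then show ?thesis using less.prems monic_carrier by (intro exI[of _ 0] exI[of _ N]) simp
    next
      case True
      then obtain G where G: "G \<in> carrier (poly_ring R)" "N = P \<otimes>\<^bsub>poly_ring R\<^esub> G"
        by (auto simp: pdivides_def factor_def)
      then have Gm: "G \<in> monic_polys R" using monic_cofactor Pm less.prems by blast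
      have "Polynomials.degree G < Polynomials.degree N" using monic_mult(2)[OF Pm(1) Gm] Pm G by simp
      then obtain e N' where eN: "G = P [^]\<^bsub>poly_ring R\<^esub> (e::nat) \<otimes>\<^bsub>poly_ring R\<^esub> N'" "N' \<in> monic_polys R" "\<not> P pdivides N'"
        using less.hyps Gm by blast
      have "N = P [^]\<^bsub>poly_ring R\<^esub> (Suc e) \<otimes>\<^bsub>poly_ring R\<^esub> N'"
      proof -
        have c: "P [^]\<^bsub>poly_ring R\<^esub> e \<in> carrier (poly_ring R)" "N' \<in> carrier (poly_ring R)"
          using Pm(2) monic_carrier[OF eN(2)] by auto
        have "N = (P \<otimes>\<^bsub>poly_ring R\<^esub> P [^]\<^bsub>poly_ring R\<^esub> e) \<otimes>\<^bsub>poly_ring R\<^esub> N'"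
          unfolding G(2) eN(1) by (rule UP.m_assoc[OF Pm(2) c, symmetric])
        then show ?thesis using UP.m_comm[OF Pm(2) c(1)] by simp
      qed
      then show ?thesis using eN by blast
    qed
  qed
  then show ?thesis using that by blast
qed

text \<open>A nonconstant common divisor would have a monic irreducible factor; dividing a power of
  P, that factor equals P, and P does not divide N.\<close>

lemma poly_coprime_power:
  fixes e :: nat
  assumes P: "P \<in> monic_irreducibles R" and N: "N \<in> monic_polys R" "\<not> P pdivides N"
  shows "poly_coprime R (P [^]\<^bsub>poly_ring R\<^esub> e) N"
proof -
  interpret UP: domain "poly_ring R" by (rule poly_ring_domain)
  have Pm: "P \<in> monic_polys R" "P \<in> carrier (poly_ring R)" "pirreducible (carrier R) P"
    using P by (auto simp: monic_irreducibles_def monic_polys_def)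
  have "y divides\<^bsub>poly_ring R\<^esub> \<one>\<^bsub>poly_ring R\<^esub>"
    if y: "y \<in> carrier (poly_ring R)" "y divides\<^bsub>poly_ring R\<^esub> P [^]\<^bsub>poly_ring R\<^esub> e" "y divides\<^bsub>poly_ring R\<^esub> N" for y
  proof -
    have y0: "y \<noteq> []"
    proof
      assume "y = []"
      then have "N = []" using y(3) zero_pdivides[of N] by (simp add: pdivides_def)
      then show False using N(1) by (simp add: monic_polys_def)
    qed
    have "Polynomials.degree y = 0"
    proof (rule ccontr)
      assume "Polynomials.degree y \<noteq> 0"
      then obtain Q where Q: "Q \<in> monic_irreducibles R" "Q pdivides y"
        using exists_monic_irreducible_divisor[OF y(1) y0] by blast
      have Qc: "Q \<in> carrier (poly_ring R)" "pirreducible (carrier R) Q"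
        using Q by (auto simp: monic_irreducibles_def monic_polys_def)
      have "Q pdivides (P [^]\<^bsub>poly_ring R\<^esub> e)"
        using Q(2) y(2) Qc unfolding pdivides_def by (metis UP.divides_trans)
      then have "Q pdivides P" using pirreducible_dvd_power[OF Qc(1) Pm(2) Qc(2)] by blast
      then have "Q = P" using monic_irreducible_dvd_eq Q P by blast
      moreover have "Q pdivides N" using Q(2) y(3) Qc unfolding pdivides_def by (metis UP.divides_trans)
      ultimately show False using N by simp
    qed
    then have "y \<in> Units (poly_ring R)"
      using univ_poly_units'[OF carrier_is_subfield] y(1) y0 by blast
    then show ?thesis using UP.divides_one[OF y(1)] by simp
  qed
  then show ?thesis
    unfolding poly_coprime_def isgcd_def
    using UP.one_divides[OF UP.nat_pow_closed[OF Pm(2)]] UP.one_divides[OF monic_carrier[OF N(1)]] by blast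
qed

end

text \<open>This is g' = (log g)' g for the local factor g = 1 + b, compared at the coefficient of
  z^(e deg P). Both series are supported on multiples of deg P, so the convolution reduces to a sum
  over exponents of P.\<close>

lemma local_series_log_deriv:
  assumes "e \<ge> 1"
    and P: "field R" "P \<in> monic_irreducibles R"
    and one: "f \<one>\<^bsub>poly_ring R\<^esub> = 1"
  shows "of_nat (e * Polynomials.degree P) * f (P [^]\<^bsub>poly_ring R\<^esub> e) =
     (\<Sum>k=1..e. mangoldt_of R f (P [^]\<^bsub>poly_ring R\<^esub> k) * f (P [^]\<^bsub>poly_ring R\<^esub> (e - k)))"
proof -
  interpret field R by fact
  interpret UP: domain "poly_ring R" by (rule poly_ring_domain)
  define d where "d = Polynomials.degree P"
  have d: "d \<ge> 1" using monic_irreducible_degree(1)[OF P(2)] by (simp add: d_def)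
  define b where "b = local_series R f P"
  define g where "g = 1 + b"
  define h where "h = fps_ln 1 oo b"
  have b0: "fps_nth b 0 = 0" by (simp add: b_def local_series_def)
  have g0: "fps_nth g 0 = 1" by (simp add: g_def b0)
  have "fps_deriv h = (fps_deriv (fps_ln 1) oo b) * fps_deriv b"
    unfolding h_def by (rule fps_compose_deriv[OF b0])
  also have "fps_deriv (fps_ln 1) oo b = inverse g"
    by (simp add: fps_ln_deriv g_def fps_inverse_compose[OF b0] fps_compose_add_distrib fps_X_fps_compose_startby0[OF b0])
  finally have "fps_deriv h * g = (inverse g * g) * fps_deriv b" by (simp only: mult_ac)
  also have "inverse g * g = 1" using g0 by (intro inverse_mult_eq_1) simp
  finally have "fps_deriv h * g = fps_deriv b" by simp
  also have "fps_deriv b = fps_deriv g" by (simp add: g_def)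
  finally have der: "fps_deriv g = fps_deriv h * g" ..
  \<comment> \<open>The constant term 1 of g fits the common formula because f is 1 at the unit
    polynomial.\<close>
  have g_nth: "fps_nth g j = (if d dvd j then f (P [^]\<^bsub>poly_ring R\<^esub> (j div d)) else 0)" for j
    using one by (cases "j = 0") (auto simp: g_def b_def local_series_def d_def)
  have h_nth: "of_nat j * fps_nth h j = (if d dvd j then mangoldt_of R f (P [^]\<^bsub>poly_ring R\<^esub> (j div d)) else 0)" if "j \<ge> 1" for j
    unfolding h_def b_def using log_local_series[OF P(2), of f] that by (simp add: d_def)
  define n where "n = e * d"
  have n: "n \<ge> 1" using assms(1) d by (simp add: n_def)
  have "of_nat n * fps_nth g n = fps_nth (fps_deriv g) (n - 1)" using n by simp
  also have "\<dots> = (\<Sum>i=0..n-1. fps_nth (fps_deriv h) i * fps_nth g (n - 1 - i))"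
    unfolding der fps_mult_nth ..
  also have "\<dots> = (\<Sum>j=1..n. of_nat j * fps_nth h j * fps_nth g (n - j))"
    using n by (intro sum.reindex_bij_witness[where i = "\<lambda>j. j - 1" and j = "\<lambda>i. i + 1"]) auto
  also have "\<dots> = (\<Sum>j\<in>(\<lambda>k. k * d) ` {1..e}. of_nat j * fps_nth h j * fps_nth g (n - j))"
  proof (rule sum.mono_neutral_right)
    show "(\<lambda>k. k * d) ` {1..e} \<subseteq> {1..n}" using d by (auto simp: n_def)
    show "\<forall>j\<in>{1..n} - (\<lambda>k. k * d) ` {1..e}. of_nat j * fps_nth h j * fps_nth g (n - j) = 0"
    proof
      fix j assume j: "j \<in> {1..n} - (\<lambda>k. k * d) ` {1..e}"
      have "\<not> d dvd j"
      proof
        assume "d dvd j"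
        then obtain k where k: "j = k * d" by (metis dvd_def mult.commute)
        then have "k \<in> {1..e}" using j d by (auto simp: n_def)
        then show False using j k by blast
      qed
      then show "of_nat j * fps_nth h j * fps_nth g (n - j) = 0" using h_nth[of j] j by simp
    qed
  qed simp
  also have "\<dots> = (\<Sum>k=1..e. of_nat (k * d) * fps_nth h (k * d) * fps_nth g (n - k * d))"
    using d by (subst sum.reindex) (auto simp: inj_on_def)
  also have "\<dots> = (\<Sum>k=1..e. mangoldt_of R f (P [^]\<^bsub>poly_ring R\<^esub> k) * f (P [^]\<^bsub>poly_ring R\<^esub> (e - k)))"
  proof (intro sum.cong refl)
    fix k assume k: "k \<in> {1..e}"
    have "n - k * d = (e - k) * d" by (simp add: n_def diff_mult_distrib)
    then have "fps_nth g (n - k * d) = f (P [^]\<^bsub>poly_ring R\<^esub> (e - k))" using d by (simp add: g_nth)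
    moreover have "of_nat (k * d) * fps_nth h (k * d) = mangoldt_of R f (P [^]\<^bsub>poly_ring R\<^esub> k)"
      using h_nth[of "k * d"] k d by simp
    ultimately show "of_nat (k * d) * fps_nth h (k * d) * fps_nth g (n - k * d) =
        mangoldt_of R f (P [^]\<^bsub>poly_ring R\<^esub> k) * f (P [^]\<^bsub>poly_ring R\<^esub> (e - k))" by simp
  qed
  finally have "of_nat n * fps_nth g n = (\<Sum>k=1..e. mangoldt_of R f (P [^]\<^bsub>poly_ring R\<^esub> k) * f (P [^]\<^bsub>poly_ring R\<^esub> (e - k)))" .
  moreover have "fps_nth g n = f (P [^]\<^bsub>poly_ring R\<^esub> e)" using d by (simp add: g_nth n_def)
  ultimately show ?thesis unfolding n_def d_def by (simp only:)
qed

text \<open>The index set of the Dirichlet convolution of \<open>mangoldt_of R f\<close> with f at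
  M, restricted to the pairs whose first entry can contribute.\<close>

definition prime_power_factorizations :: "('a, 'b) ring_scheme \<Rightarrow> 'a list \<Rightarrow> ('a list \<times> 'a list) set" where
  "prime_power_factorizations R M = {(F, G). G \<in> monic_polys R \<and> (\<exists>Q. power_of_irreducible R Q F) \<and> F \<otimes>\<^bsub>poly_ring R\<^esub> G = M}"

section \<open>Dirichlet convolution of \<open>mangoldt_of\<close> with f\<close>

context field
begin

lemma power_of_irreducible_monic:
  assumes "power_of_irreducible R Q F"
  shows "F \<in> monic_polys R" "Polynomials.degree F \<ge> 1"
proof -
  obtain k :: nat where k: "Q \<in> monic_irreducibles R" "1 \<le> k" "F = Q [^]\<^bsub>poly_ring R\<^esub> k"
    using assms by (auto simp: power_of_irreducible_def)
  have Q: "Q \<in> monic_polys R" "Polynomials.degree Q \<ge> 1"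
    using k monic_irreducible_monic monic_irreducible_degree(1) by auto
  show "F \<in> monic_polys R" using k monic_power[OF Q(1)] by simp
  have "1 * 1 \<le> k * Polynomials.degree Q" using k(2) Q(2) by (rule mult_le_mono)
  then show "Polynomials.degree F \<ge> 1" using k(3) monic_power_degree[OF Q(1), of k] by simp
qed

text \<open>A power of an irreducible dividing P^e N is either a power of P, then at most P^e since
  P does not divide N, or a power of another irreducible, which then divides N. In both cases
  cancellation determines the cofactor.\<close>

lemma prime_power_factorizations_split:
  fixes e :: nat
  assumes P: "P \<in> monic_irreducibles R" and N: "N \<in> monic_polys R" "\<not> P pdivides N"
  defines "Pe \<equiv> \<lambda>k::nat. P [^]\<^bsub>poly_ring R\<^esub> k"
  shows "prime_power_factorizations R (Pe e \<otimes>\<^bsub>poly_ring R\<^esub> N) =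
     (\<lambda>k. (Pe k, Pe (e - k) \<otimes>\<^bsub>poly_ring R\<^esub> N)) ` {1..e} \<union>
     (\<lambda>(F, G). (F, Pe e \<otimes>\<^bsub>poly_ring R\<^esub> G)) ` prime_power_factorizations R N" (is "?L = ?A \<union> ?B")
proof -
  interpret UP: domain "poly_ring R" by (rule poly_ring_domain)
  have Pm: "P \<in> monic_polys R" "P \<in> carrier (poly_ring R)" "pirreducible (carrier R) P" "Polynomials.degree P \<ge> 1"
    using P monic_irreducible_degree(1) by (auto simp: monic_irreducibles_def monic_polys_def)
  have Nc: "N \<in> carrier (poly_ring R)" using N monic_carrier by blast
  have Pem: "Pe k \<in> monic_polys R" "Pe k \<in> carrier (poly_ring R)" for k
    using monic_power[OF Pm(1)] monic_carrier by (auto simp: Pe_def)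
  have Pe_add: "Pe i \<otimes>\<^bsub>poly_ring R\<^esub> Pe j = Pe (i + j)" for i j
    unfolding Pe_def using Pm by (simp add: UP.nat_pow_mult)
  show ?thesis
  proof (intro equalityI subsetI)
    fix x assume "x \<in> ?L"
    then obtain F G Q where x: "x = (F, G)" "G \<in> monic_polys R" "power_of_irreducible R Q F"
      "F \<otimes>\<^bsub>poly_ring R\<^esub> G = Pe e \<otimes>\<^bsub>poly_ring R\<^esub> N"
      by (auto simp: prime_power_factorizations_def)
    have Gc: "G \<in> carrier (poly_ring R)" using x monic_carrier by blast
    obtain k :: nat where k: "Q \<in> monic_irreducibles R" "1 \<le> k" "F = Q [^]\<^bsub>poly_ring R\<^esub> k"
      using x(3) by (auto simp: power_of_irreducible_def)
    have Qm: "Q \<in> monic_polys R" "Q \<in> carrier (poly_ring R)" "pirreducible (carrier R) Q"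
      using k(1) by (auto simp: monic_irreducibles_def monic_polys_def)
    have Fm: "F \<in> monic_polys R" "F \<in> carrier (poly_ring R)"
      using power_of_irreducible_monic(1)[OF x(3)] monic_carrier by auto
    have div: "F pdivides (Pe e \<otimes>\<^bsub>poly_ring R\<^esub> N)"
      unfolding pdivides_def factor_def using Gc x(4) by metis
    show "x \<in> ?A \<union> ?B"
    proof (cases "Q = P")
      case True
      then have F: "F = Pe k" using k by (simp add: Pe_def)
      have "Pe k pdivides (N \<otimes>\<^bsub>poly_ring R\<^esub> Pe e)"
        using div unfolding F by (simp only: UP.m_comm[OF Nc Pem(2)])
      then have "Pe k pdivides Pe e"
        using pirreducible_pow_pdivides_iff[OF carrier_is_subfield Pm(2) Nc Pem(2) Pm(3) N(2)]
        unfolding Pe_def by blast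
      then have "Polynomials.degree (Pe k) \<le> Polynomials.degree (Pe e)"
        using Pem by (intro pdivides_imp_degree_le[OF carrier_is_subring]) (auto simp: monic_polys_def)
      then have ke: "k \<le> e" using monic_power_degree[OF Pm(1)] Pm(4) by (simp add: Pe_def)
      have "Pe k \<otimes>\<^bsub>poly_ring R\<^esub> G = (Pe k \<otimes>\<^bsub>poly_ring R\<^esub> Pe (e - k)) \<otimes>\<^bsub>poly_ring R\<^esub> N"
        using x(4) ke by (simp add: F Pe_add)
      also have "\<dots> = Pe k \<otimes>\<^bsub>poly_ring R\<^esub> (Pe (e - k) \<otimes>\<^bsub>poly_ring R\<^esub> N)"
        by (rule UP.m_assoc[OF Pem(2) Pem(2) Nc])
      finally have "G = Pe (e - k) \<otimes>\<^bsub>poly_ring R\<^esub> N"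
        using UP.m_lcancel[OF monic_nonzero[OF Pem(1)] Pem(2) Gc UP.m_closed[OF Pem(2) Nc]] by blast
      then show ?thesis using x(1) F ke k(2) by auto
    next
      case False
      have nd: "\<not> Q pdivides Pe e"
        using pirreducible_dvd_power[OF Qm(2) Pm(2) Qm(3)] monic_irreducible_dvd_eq[OF k(1) P] False
        unfolding Pe_def by blast
      have "F pdivides N"
        using pirreducible_pow_pdivides_iff[OF carrier_is_subfield Qm(2) Pem(2) Nc Qm(3) nd] div k(3) by blast
      then obtain G' where G': "G' \<in> carrier (poly_ring R)" "N = F \<otimes>\<^bsub>poly_ring R\<^esub> G'"
        by (auto simp: pdivides_def factor_def)
      then have G'm: "G' \<in> monic_polys R" using monic_cofactor Fm N by blast
      have "F \<otimes>\<^bsub>poly_ring R\<^esub> G = (Pe e \<otimes>\<^bsub>poly_ring R\<^esub> F) \<otimes>\<^bsub>poly_ring R\<^esub> G'"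
        using x(4) G' Fm Pem(2) by (simp add: UP.m_assoc)
      also have "\<dots> = F \<otimes>\<^bsub>poly_ring R\<^esub> (Pe e \<otimes>\<^bsub>poly_ring R\<^esub> G')"
        using UP.m_comm[OF Pem(2) Fm(2)] UP.m_assoc[OF Fm(2) Pem(2) G'(1)] by simp
      finally have "G = Pe e \<otimes>\<^bsub>poly_ring R\<^esub> G'"
        using UP.m_lcancel[OF monic_nonzero[OF Fm(1)] Fm(2) Gc UP.m_closed[OF Pem(2) G'(1)]] by blast
      moreover have "(F, G') \<in> prime_power_factorizations R N"
        using G'm x(3) G'(2) by (auto simp: prime_power_factorizations_def)
      ultimately show ?thesis using x(1) by force
    qed
  next
    fix x assume "x \<in> ?A \<union> ?B"
    then show "x \<in> ?L"
    proof
      assume "x \<in> ?A"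
      then obtain k where k: "1 \<le> k" "k \<le> e" "x = (Pe k, Pe (e - k) \<otimes>\<^bsub>poly_ring R\<^esub> N)" by auto
      have "Pe k \<otimes>\<^bsub>poly_ring R\<^esub> (Pe (e - k) \<otimes>\<^bsub>poly_ring R\<^esub> N) = Pe e \<otimes>\<^bsub>poly_ring R\<^esub> N"
        using UP.m_assoc[OF Pem(2) Pem(2) Nc, of k "e - k"] k by (simp add: Pe_add)
      moreover have "power_of_irreducible R P (Pe k)" using P k by (auto simp: power_of_irreducible_def Pe_def)
      ultimately show "x \<in> ?L" using k monic_mult(1)[OF Pem(1) N(1)]
        by (auto simp: prime_power_factorizations_def)
    next
      assume "x \<in> ?B"
      then obtain F G Q where x: "x = (F, Pe e \<otimes>\<^bsub>poly_ring R\<^esub> G)" "G \<in> monic_polys R"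
          "power_of_irreducible R Q F" "F \<otimes>\<^bsub>poly_ring R\<^esub> G = N"
        by (auto simp: prime_power_factorizations_def)
      have c: "F \<in> carrier (poly_ring R)" "G \<in> carrier (poly_ring R)"
        using power_of_irreducible_monic(1)[OF x(3)] x(2) monic_carrier by auto
      have "F \<otimes>\<^bsub>poly_ring R\<^esub> (Pe e \<otimes>\<^bsub>poly_ring R\<^esub> G) = Pe e \<otimes>\<^bsub>poly_ring R\<^esub> N"
        using UP.m_lcomm[OF c(1) Pem(2) c(2)] x(4) by simp
      then show "x \<in> ?L" using x monic_mult(1)[OF Pem(1) x(2)]
        by (auto simp: prime_power_factorizations_def)
    qed
  qed
qed

lemma finite_monic_polys_deg:
  assumes "finite (carrier R)"
  shows "finite (monic_polys_deg R n)" "card (monic_polys_deg R n) = card (carrier R) ^ n"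
proof -
  have "monic_polys_deg R n = (\<lambda>xs. \<one> # xs) ` {xs. set xs \<subseteq> carrier R \<and> length xs = n}"
  proof (intro equalityI subsetI)
    fix F assume F: "F \<in> monic_polys_deg R n"
    then have m: "F \<in> carrier (poly_ring R)" "F \<noteq> []" "lead_coeff F = \<one>" "Polynomials.degree F = n"
      by (auto simp: monic_polys_deg_def monic_polys_def)
    then have "F = \<one> # tl F" "length (tl F) = n" by (cases F; simp)+
    moreover have "set F \<subseteq> carrier R" using m(1)[folded univ_poly_carrier] by (auto simp: polynomial_def)
    then have "set (tl F) \<subseteq> carrier R" by (meson list.set_sel(2) m(2) subset_iff)
    ultimately show "F \<in> (\<lambda>xs. \<one> # xs) ` {xs. set xs \<subseteq> carrier R \<and> length xs = n}" by blast
  next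
    fix F assume "F \<in> (\<lambda>xs. \<one> # xs) ` {xs. set xs \<subseteq> carrier R \<and> length xs = n}"
    then obtain xs where xs: "F = \<one> # xs" "set xs \<subseteq> carrier R" "length xs = n" by auto
    then have "polynomial (carrier R) F" by (auto simp: polynomial_def)
    then show "F \<in> monic_polys_deg R n"
      using xs unfolding univ_poly_carrier by (simp add: monic_polys_deg_def monic_polys_def)
  qed
  moreover have "inj_on (\<lambda>xs. \<one> # xs) {xs. set xs \<subseteq> carrier R \<and> length xs = n}" by (auto simp: inj_on_def)
  ultimately show "finite (monic_polys_deg R n)" "card (monic_polys_deg R n) = card (carrier R) ^ n"
    using finite_lists_length_eq[OF assms, of n] card_lists_length_eq[OF assms, of n] by (auto simp: card_image)
qed

lemma finite_prime_power_factorizations: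
  assumes "finite (carrier R)" "M \<in> monic_polys R"
  shows "finite (prime_power_factorizations R M)"
proof (rule finite_subset)
  let ?S = "\<Union>k\<le>Polynomials.degree M. monic_polys_deg R k"
  show "prime_power_factorizations R M \<subseteq> ?S \<times> ?S"
  proof
    fix x assume "x \<in> prime_power_factorizations R M"
    then obtain F G Q where x: "x = (F, G)" "G \<in> monic_polys R" "power_of_irreducible R Q F" "F \<otimes>\<^bsub>poly_ring R\<^esub> G = M"
      by (auto simp: prime_power_factorizations_def)
    have F: "F \<in> monic_polys R" by (rule power_of_irreducible_monic(1)[OF x(3)])
    show "x \<in> ?S \<times> ?S" using monic_mult(2)[OF F x(2)] x F by (auto simp: monic_polys_deg_def)
  qed
  show "finite (?S \<times> ?S)" using finite_monic_polys_deg(1)[OF assms(1)] by simp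
qed

text \<open>One irreducible P is split off completely, M = P^e N. The pairs with F a power of P give
  deg (P^e) f(P^e) f(N) by the local identity; the others give f(P^e) times the convolution at N,
  known by induction. Multiplicativity and additivity of degrees combine the two.\<close>

lemma multiplicative_log_convolution:
  assumes fin: "finite (carrier R)" and f: "multiplicative R f" "f \<one>\<^bsub>poly_ring R\<^esub> = 1"
    and "M \<in> monic_polys R"
  shows "(\<Sum>(F, G)\<in>prime_power_factorizations R M. mangoldt_of R f F * f G) = of_nat (Polynomials.degree M) * f M"
  using assms(4)
proof (induction "Polynomials.degree M" arbitrary: M rule: less_induct)
  case less
  interpret UP: domain "poly_ring R" by (rule poly_ring_domain)
  show ?case
  proof (cases "Polynomials.degree M = 0")
    case True
    have "prime_power_factorizations R M = {}"
    proof (rule ccontr)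
      assume "prime_power_factorizations R M \<noteq> {}"
      then obtain F G Q where x: "G \<in> monic_polys R" "power_of_irreducible R Q F" "F \<otimes>\<^bsub>poly_ring R\<^esub> G = M"
        by (auto simp: prime_power_factorizations_def)
      show False using monic_mult(2)[OF power_of_irreducible_monic(1)[OF x(2)] x(1)]
          power_of_irreducible_monic(2)[OF x(2)] x(3) True by simp
    qed
    then show ?thesis using True by simp
  next
    case False
    obtain P where P: "P \<in> monic_irreducibles R" "P pdivides M"
      using exists_monic_irreducible_divisor[of M] False less.prems by (auto simp: monic_polys_def)
    have Pm: "P \<in> monic_polys R" "P \<in> carrier (poly_ring R)" "Polynomials.degree P \<ge> 1"
      using P monic_irreducible_degree(1) by (auto simp: monic_irreducibles_def monic_polys_def)
    obtain e N where eN: "M = P [^]\<^bsub>poly_ring R\<^esub> (e::nat) \<otimes>\<^bsub>poly_ring R\<^esub> N" "N \<in> monic_polys R" "\<not> P pdivides N"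
      by (rule irreducible_power_split[OF P(1) less.prems])
    define Pe where "Pe = (\<lambda>k::nat. P [^]\<^bsub>poly_ring R\<^esub> k)"
    have Pem: "Pe k \<in> monic_polys R" "Polynomials.degree (Pe k) = k * Polynomials.degree P" for k
      using monic_power[OF Pm(1)] monic_power_degree[OF Pm(1)] by (auto simp: Pe_def)
    have M: "M = Pe e \<otimes>\<^bsub>poly_ring R\<^esub> N" using eN by (simp add: Pe_def)
    have e: "e \<ge> 1"
    proof (rule ccontr)
      assume "\<not> e \<ge> 1"
      then have "e = 0" by simp
      then have "M = N" using M monic_carrier[OF eN(2)] by (simp add: Pe_def)
      then show False using P eN by simp
    qed
    have dM: "Polynomials.degree M = e * Polynomials.degree P + Polynomials.degree N"
      unfolding M using monic_mult(2)[OF Pem(1) eN(2)] Pem(2) by simp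
    have "e * Polynomials.degree P > 0" using e Pm(3) by (intro mult_pos_pos) linarith+
    then have dN: "Polynomials.degree N < Polynomials.degree M" unfolding dM by linarith
    have cop: "f (Pe k \<otimes>\<^bsub>poly_ring R\<^esub> G) = f (Pe k) * f G" if "G \<in> monic_polys R" "\<not> P pdivides G" for k G
      using f(1) Pem(1) that poly_coprime_power[OF P(1) that, of k] unfolding multiplicative_def Pe_def by blast
    define h where "h = (\<lambda>(F, G). mangoldt_of R f F * f G)"
    let ?A = "(\<lambda>k. (Pe k, Pe (e - k) \<otimes>\<^bsub>poly_ring R\<^esub> N)) ` {1..e}"
    let ?B = "(\<lambda>(F, G). (F, Pe e \<otimes>\<^bsub>poly_ring R\<^esub> G)) ` prime_power_factorizations R N"
    have spl: "prime_power_factorizations R M = ?A \<union> ?B"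
      unfolding M Pe_def by (rule prime_power_factorizations_split[OF P(1) eN(2,3)])
    have disj: "?A \<inter> ?B = {}"
    proof (rule ccontr)
      assume "?A \<inter> ?B \<noteq> {}"
      then obtain k F G Q where k: "k \<in> {1..e}" "Pe k = F" "G \<in> monic_polys R" "F \<otimes>\<^bsub>poly_ring R\<^esub> G = N"
        by (fastforce simp: prime_power_factorizations_def)
      have "P divides\<^bsub>poly_ring R\<^esub> Pe k"
        using polynomial_pow_division[OF Pm(2), of 1 k] k(1) Pm(2) by (simp add: Pe_def pdivides_def)
      then have "P divides\<^bsub>poly_ring R\<^esub> (Pe k \<otimes>\<^bsub>poly_ring R\<^esub> G)"
        using Pm(2) monic_carrier[OF Pem(1)] monic_carrier[OF k(3)] by (intro UP.divides_prod_r)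
      then show False using k eN(3) by (simp add: pdivides_def)
    qed
    have injA: "inj_on (\<lambda>k. (Pe k, Pe (e - k) \<otimes>\<^bsub>poly_ring R\<^esub> N)) {1..e}"
    proof (rule inj_onI)
      fix i j assume "(Pe i, Pe (e - i) \<otimes>\<^bsub>poly_ring R\<^esub> N) = (Pe j, Pe (e - j) \<otimes>\<^bsub>poly_ring R\<^esub> N)"
      then have "Polynomials.degree (Pe i) = Polynomials.degree (Pe j)" by simp
      then have "i * Polynomials.degree P = j * Polynomials.degree P" unfolding Pem(2) .
      moreover have "Polynomials.degree P \<noteq> 0" using Pm(3) by linarith
      ultimately show "i = j" using mult_right_cancel by blast
    qed
    have injB: "inj_on (\<lambda>(F, G). (F, Pe e \<otimes>\<^bsub>poly_ring R\<^esub> G)) (prime_power_factorizations R N)"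
    proof (rule inj_onI)
      fix x y assume xy: "x \<in> prime_power_factorizations R N" "y \<in> prime_power_factorizations R N"
        and eq: "(case x of (F, G) \<Rightarrow> (F, Pe e \<otimes>\<^bsub>poly_ring R\<^esub> G)) = (case y of (F, G) \<Rightarrow> (F, Pe e \<otimes>\<^bsub>poly_ring R\<^esub> G))"
      obtain F G F' G' where FG: "x = (F, G)" "y = (F', G')" by (cases x, cases y)
      then have "G \<in> carrier (poly_ring R)" "G' \<in> carrier (poly_ring R)"
        using xy monic_carrier by (auto simp: prime_power_factorizations_def)
      then have "G = G'"
        using UP.m_lcancel[OF monic_nonzero[OF Pem(1)] monic_carrier[OF Pem(1)]] eq FG by simp
      then show "x = y" using eq FG by simp
    qed
    have "sum h ?A = (\<Sum>k=1..e. mangoldt_of R f (Pe k) * f (Pe (e - k))) * f N"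
      unfolding sum.reindex[OF injA] o_def using cop[OF eN(2,3)]
      by (simp add: h_def sum_distrib_right mult.assoc)
    also have "(\<Sum>k=1..e. mangoldt_of R f (Pe k) * f (Pe (e - k))) = of_nat (e * Polynomials.degree P) * f (Pe e)"
      unfolding Pe_def by (rule local_series_log_deriv[where f = f, OF e field_axioms P(1) f(2), symmetric])
    finally have SA: "sum h ?A = of_nat (e * Polynomials.degree P) * f (Pe e) * f N" .
    have "sum h ?B = (\<Sum>(F, G)\<in>prime_power_factorizations R N. f (Pe e) * (mangoldt_of R f F * f G))"
      unfolding sum.reindex[OF injB] o_def
    proof (intro sum.cong refl)
      fix x assume "x \<in> prime_power_factorizations R N"
      then obtain F G Q where x: "x = (F, G)" "G \<in> monic_polys R" "power_of_irreducible R Q F" "F \<otimes>\<^bsub>poly_ring R\<^esub> G = N"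
        by (auto simp: prime_power_factorizations_def)
      have "\<not> P pdivides G"
      proof
        assume "P pdivides G"
        then have "P divides\<^bsub>poly_ring R\<^esub> (F \<otimes>\<^bsub>poly_ring R\<^esub> G)"
          using Pm(2) monic_carrier[OF power_of_irreducible_monic(1)[OF x(3)]] monic_carrier[OF x(2)]
          unfolding pdivides_def by (intro UP.divides_prod_l)
        then show False using x(4) eN(3) by (simp add: pdivides_def)
      qed
      then show "h (case x of (F, G) \<Rightarrow> (F, Pe e \<otimes>\<^bsub>poly_ring R\<^esub> G)) = (case x of (F, G) \<Rightarrow> f (Pe e) * (mangoldt_of R f F * f G))"
        using cop[OF x(2)] x(1) by (simp add: h_def)
    qed
    also have "\<dots> = f (Pe e) * (\<Sum>(F, G)\<in>prime_power_factorizations R N. mangoldt_of R f F * f G)"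
      by (simp add: sum_distrib_left case_prod_unfold)
    also have "\<dots> = f (Pe e) * (of_nat (Polynomials.degree N) * f N)"
      using less.hyps[OF dN eN(2)] by simp
    finally have SB: "sum h ?B = f (Pe e) * (of_nat (Polynomials.degree N) * f N)" .
    have "sum h (prime_power_factorizations R M) = sum h ?A + sum h ?B"
      unfolding spl using finite_prime_power_factorizations[OF fin eN(2)]
      by (intro sum.union_disjoint disj) auto
    also have "\<dots> = of_nat (Polynomials.degree M) * (f (Pe e) * f N)"
      unfolding SA SB dM by (simp add: algebra_simps)
    also have "f (Pe e) * f N = f M" unfolding M by (rule cop[OF eN(2,3), symmetric])
    finally show ?thesis by (simp add: h_def)
  qed
qed

text \<open>The pointwise identity is summed over M and the pairs are regrouped by deg F. The full
  product sets may be used on the right because \<open>mangoldt_of\<close> vanishes off powers of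
  irreducibles.\<close>

lemma mean_value_convolution:
  assumes fin: "finite (carrier R)" and f: "multiplicative R f" "f \<one>\<^bsub>poly_ring R\<^esub> = 1"
  shows "of_nat n * (\<Sum>M\<in>monic_polys_deg R n. f M) =
     (\<Sum>k=1..n. (\<Sum>F\<in>monic_polys_deg R k. mangoldt_of R f F) * (\<Sum>G\<in>monic_polys_deg R (n - k). f G))"
proof -
  define h where "h = (\<lambda>(F, G). mangoldt_of R f F * f G)"
  let ?D = "\<lambda>k. monic_polys_deg R k"
  have finD: "finite (?D k)" for k by (rule finite_monic_polys_deg(1)[OF fin])
  have "of_nat n * (\<Sum>M\<in>?D n. f M) = (\<Sum>M\<in>?D n. sum h (prime_power_factorizations R M))"
    unfolding h_def sum_distrib_left
    by (intro sum.cong refl) (auto simp: monic_polys_deg_def multiplicative_log_convolution[OF fin f])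
  also have "\<dots> = sum h (\<Union>M\<in>?D n. prime_power_factorizations R M)"
  proof (rule sum.UNION_disjoint[symmetric])
    show "\<forall>M\<in>?D n. finite (prime_power_factorizations R M)"
      using finite_prime_power_factorizations[OF fin] by (auto simp: monic_polys_deg_def)
    show "\<forall>M\<in>?D n. \<forall>M'\<in>?D n. M \<noteq> M' \<longrightarrow> prime_power_factorizations R M \<inter> prime_power_factorizations R M' = {}"
      by (auto simp: prime_power_factorizations_def)
  qed (rule finD)
  also have "\<dots> = sum h (\<Union>k\<in>{1..n}. ?D k \<times> ?D (n - k))"
  proof (rule sum.mono_neutral_left)
    show "finite (\<Union>k\<in>{1..n}. ?D k \<times> ?D (n - k))" using finD by blast
    show "(\<Union>M\<in>?D n. prime_power_factorizations R M) \<subseteq> (\<Union>k\<in>{1..n}. ?D k \<times> ?D (n - k))"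
    proof
      fix x assume "x \<in> (\<Union>M\<in>?D n. prime_power_factorizations R M)"
      then obtain F G Q where x: "x = (F, G)" "G \<in> monic_polys R" "power_of_irreducible R Q F" "F \<otimes>\<^bsub>poly_ring R\<^esub> G \<in> ?D n"
        by (auto simp: prime_power_factorizations_def)
      note F = power_of_irreducible_monic[OF x(3)]
      have "Polynomials.degree F + Polynomials.degree G = n"
        using monic_mult(2)[OF F(1) x(2)] x(4) by (simp add: monic_polys_deg_def)
      then have "Polynomials.degree F \<in> {1..n}" "x \<in> ?D (Polynomials.degree F) \<times> ?D (n - Polynomials.degree F)"
        using F x by (auto simp: monic_polys_deg_def)
      then show "x \<in> (\<Union>k\<in>{1..n}. ?D k \<times> ?D (n - k))" by blast
    qed
    show "\<forall>x\<in>(\<Union>k\<in>{1..n}. ?D k \<times> ?D (n - k)) - (\<Union>M\<in>?D n. prime_power_factorizations R M). h x = 0"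
    proof
      fix x assume x: "x \<in> (\<Union>k\<in>{1..n}. ?D k \<times> ?D (n - k)) - (\<Union>M\<in>?D n. prime_power_factorizations R M)"
      then obtain k F G where k: "k \<in> {1..n}" "x = (F, G)" "F \<in> monic_polys R" "G \<in> monic_polys R"
         "Polynomials.degree F = k" "Polynomials.degree G = n - k"
        by (auto simp: monic_polys_deg_def)
      have "F \<otimes>\<^bsub>poly_ring R\<^esub> G \<in> ?D n"
        using monic_mult[OF k(3,4)] k by (simp add: monic_polys_deg_def)
      then have "\<not> (\<exists>Q. power_of_irreducible R Q F)"
        using x k by (auto simp: prime_power_factorizations_def)
      then show "h x = 0" using k by (simp add: h_def mangoldt_of_def)
    qed
  qed
  also have "\<dots> = (\<Sum>k=1..n. sum h (?D k \<times> ?D (n - k)))"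
    using finD by (intro sum.UNION_disjoint) (auto simp: monic_polys_deg_def)
  also have "\<dots> = (\<Sum>k=1..n. (\<Sum>F\<in>?D k. mangoldt_of R f F) * (\<Sum>G\<in>?D (n - k). f G))"
    by (simp add: h_def sum.cartesian_product[symmetric] sum_product)
  finally show ?thesis .
qed

end

section \<open>The case f = 1 and the normalized means\<close>

context field
begin

lemma mangoldt_irreducible_power:
  assumes "P \<in> monic_irreducibles R" "k \<ge> 1"
  shows "mangoldt R (P [^]\<^bsub>poly_ring R\<^esub> (k::nat)) = real (Polynomials.degree P)"
proof -
  have p: "power_of_irreducible R P (P [^]\<^bsub>poly_ring R\<^esub> k)"
    using assms by (auto simp: power_of_irreducible_def)
  then show ?thesis using irreducible_base_eq[OF p] by (auto simp: mangoldt_def)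
qed

text \<open>For f = 1 the local identity says that the first e values sum to e deg P, for every e;
  differences of consecutive e isolate a single value.\<close>

lemma mangoldt_of_one_irreducible_power:
  assumes P: "P \<in> monic_irreducibles R" and k: "k \<ge> 1"
  shows "mangoldt_of R (\<lambda>_. 1) (P [^]\<^bsub>poly_ring R\<^esub> (k::nat)) = of_nat (Polynomials.degree P)"
proof -
  define T where "T = (\<lambda>k::nat. mangoldt_of R (\<lambda>_. 1) (P [^]\<^bsub>poly_ring R\<^esub> k))"
  define d where "d = Polynomials.degree P"
  have S: "of_nat e * of_nat d = (\<Sum>k=1..e. T k)" if "e \<ge> 1" for e
    using local_series_log_deriv[where f = "\<lambda>_. 1", OF that field_axioms P]
    unfolding d_def[symmetric] by (simp add: T_def)
  obtain j where j: "k = Suc j" using k by (cases k) auto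
  have "(\<Sum>k=1..Suc j. T k) = (\<Sum>k=1..j. T k) + T (Suc j)" by simp
  moreover have "(\<Sum>k=1..j. T k) = of_nat j * of_nat d"
    using S[of j] by (cases "j = 0") simp_all
  ultimately have "T k = of_nat d" using S[of "Suc j"] j by (simp add: algebra_simps)
  then show ?thesis by (simp only: T_def d_def)
qed

lemma mangoldt_of_one: "mangoldt_of R (\<lambda>_. 1) F = of_real (mangoldt R F)"
proof (cases "\<exists>P. power_of_irreducible R P F")
  case True
  then obtain P and k :: nat where "P \<in> monic_irreducibles R" "1 \<le> k" "F = P [^]\<^bsub>poly_ring R\<^esub> k"
    by (auto simp: power_of_irreducible_def)
  then show ?thesis by (simp add: mangoldt_of_one_irreducible_power mangoldt_irreducible_power)
qed (simp add: mangoldt_of_def mangoldt_def)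

text \<open>The exact prime polynomial theorem. For f = 1 the convolution identity reads n q^n = sum
  of \<psi>(k) q^(n - k) over k from 1 to n; by induction each k < n contributes q^n, which leaves
  q^n for \<psi>(n).\<close>

lemma sum_mangoldt:
  assumes fin: "finite (carrier R)" and "n \<ge> 1"
  shows "(\<Sum>F\<in>monic_polys_deg R n. mangoldt R F) = real (card (carrier R)) ^ n"
  using assms(2)
proof (induction n rule: less_induct)
  case (less n)
  define q where "q = real (card (carrier R))"
  define \<psi> where "\<psi> = (\<lambda>k. \<Sum>F\<in>monic_polys_deg R k. mangoldt R F)"
  have "of_nat n * (\<Sum>M\<in>monic_polys_deg R n. 1) =
     (\<Sum>k=1..n. (\<Sum>F\<in>monic_polys_deg R k. mangoldt_of R (\<lambda>_. 1) F) * (\<Sum>G\<in>monic_polys_deg R (n - k). (1::complex)))"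
    by (rule mean_value_convolution[OF fin]) (simp_all add: multiplicative_def)
  then have "complex_of_real (real n * q ^ n) = of_real (\<Sum>k=1..n. \<psi> k * q ^ (n - k))"
    by (simp add: mangoldt_of_one finite_monic_polys_deg[OF fin] q_def \<psi>_def)
  then have "real n * q ^ n = (\<Sum>k=1..n. \<psi> k * q ^ (n - k))" by (simp only: of_real_eq_iff)
  also have "\<dots> = (\<Sum>k=1..n-1. \<psi> k * q ^ (n - k)) + \<psi> n"
    using less.prems by (cases n) auto
  also have "(\<Sum>k=1..n-1. \<psi> k * q ^ (n - k)) = (\<Sum>k=1..n-1. q ^ n)"
    using less.IH by (intro sum.cong refl) (auto simp: \<psi>_def q_def simp flip: power_add)
  finally have "real n * q ^ n = real (n - 1) * q ^ n + \<psi> n" by simp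
  then show ?case using less.prems by (simp add: \<psi>_def q_def of_nat_diff algebra_simps)
qed

lemma card_carrier_pos: "finite (carrier R) \<Longrightarrow> card (carrier R) > 0"
  by (auto simp: card_gt_0_iff)

lemma prime_mean_value_le:
  assumes fin: "finite (carrier R)" and f: "f \<in> class_C R 1" and k: "k \<ge> 1"
  shows "cmod (prime_mean_value R f k) \<le> 1"
proof -
  have "cmod (\<Sum>F\<in>monic_polys_deg R k. mangoldt_of R f F) \<le> (\<Sum>F\<in>monic_polys_deg R k. mangoldt R F)"
    using f by (intro sum_norm_le) (auto simp: class_C_def monic_polys_deg_def)
  also have "\<dots> = real (card (carrier R)) ^ k" by (rule sum_mangoldt[OF fin k])
  finally show ?thesis
    using card_carrier_pos[OF fin] by (simp add: prime_mean_value_def norm_divide norm_power divide_le_eq)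
qed

lemma mean_value_recurrence:
  assumes fin: "finite (carrier R)" and f: "f \<in> class_C R \<kappa>"
  shows "of_nat n * mean_value R f n = (\<Sum>k=1..n. prime_mean_value R f k * mean_value R f (n - k))"
proof -
  define q where "q = (of_nat (card (carrier R)) :: complex)"
  have q: "q \<noteq> 0" using card_carrier_pos[OF fin] by (simp add: q_def)
  have "of_nat n * mean_value R f n =
     (\<Sum>k=1..n. (\<Sum>F\<in>monic_polys_deg R k. mangoldt_of R f F) * (\<Sum>G\<in>monic_polys_deg R (n - k). f G)) / q ^ n"
    using mean_value_convolution[OF fin, of f n] f by (simp add: mean_value_def q_def class_C_def)
  also have "\<dots> = (\<Sum>k=1..n. prime_mean_value R f k * mean_value R f (n - k))"
  proof (subst sum_divide_distrib, intro sum.cong refl)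
    fix k assume "k \<in> {1..n}"
    then have "q ^ n = q ^ k * q ^ (n - k)" by (metis atLeastAtMost_iff le_add_diff_inverse power_add)
    then show "(\<Sum>F\<in>monic_polys_deg R k. mangoldt_of R f F) * (\<Sum>G\<in>monic_polys_deg R (n - k). f G) / q ^ n =
       prime_mean_value R f k * mean_value R f (n - k)"
      unfolding prime_mean_value_def mean_value_def q_def[symmetric] by (simp only: times_divide_times_eq)
  qed
  finally show ?thesis .
qed

lemma mean_value_0:
  assumes "f \<in> class_C R \<kappa>"
  shows "mean_value R f 0 = 1"
proof -
  have "monic_polys_deg R 0 = {\<one>\<^bsub>poly_ring R\<^esub>}"
  proof (intro equalityI subsetI)
    fix F assume "F \<in> monic_polys_deg R 0"
    then have "F \<in> monic_polys R" "Polynomials.degree F = 0" unfolding monic_polys_deg_def by blast+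
    then show "F \<in> {\<one>\<^bsub>poly_ring R\<^esub>}" using monic_degree_zero by blast
  next
    fix F assume "F \<in> {\<one>\<^bsub>poly_ring R\<^esub>}"
    then show "F \<in> monic_polys_deg R 0" unfolding monic_polys_deg_def using monic_one by blast
  qed
  moreover have "f \<one>\<^bsub>poly_ring R\<^esub> = 1" using assms unfolding class_C_def by blast
  ultimately show ?thesis unfolding mean_value_def by simp
qed

end

section \<open>Rotation to the maximum and conclusion\<close>

lemma unit_exp_cis: "unit_exp t = cis (2 * pi * t)"
  by (simp add: unit_exp_def cis_conv_exp mult_ac)

text \<open>Maximality of \<theta> is given for parameters in [0,1), while
  \<open>Lipschitz_sequence\<close> asks for every point of the circle. Reducing the argument modulo
  1 by \<open>frac\<close> connects the two.\<close>

lemma unit_circle_unit_exp: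
  assumes "cmod w = 1"
  obtains t where "t \<in> {0..<1}" "w = unit_exp (- t)"
proof
  define x where "x = - Arg w / (2 * pi)"
  have "cis (2 * pi * - frac x) = cis (Arg w) * cis (2 * pi * of_int \<lfloor>x\<rfloor>)"
    unfolding cis_mult frac_def x_def by (rule arg_cong[of _ _ cis]) (simp add: field_simps)
  also have "cis (2 * pi * of_int \<lfloor>x\<rfloor>) = 1" by (rule cis_multiple_2pi) simp
  also have "w \<noteq> 0" using assms by auto
  then have "cis (Arg w) = w" using assms by (simp add: cis_Arg sgn_eq)
  finally show "w = unit_exp (- frac x)" by (simp add: unit_exp_cis)
  show "frac x \<in> {0..<1}" by (simp add: frac_lt_1)
qed

lemma F_perp_trunc_series:
  assumes "card (carrier R) > 0"
  shows "F_perp R f n (unit_exp (- t) / of_nat (card (carrier R))) = trunc_series (prime_mean_value R f) (n - 1) (unit_exp (- t))"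
  using assms by (simp add: F_perp_def trunc_series_def)

theorem theorem2:
  shows "\<exists>C A :: real. C > 0 \<and> A > 0 \<and>
    (\<forall>(R :: nat ring) (f :: nat list \<Rightarrow> complex) (n :: nat) (\<theta> :: real).
       field R \<and> finite (carrier R) \<and> f \<in> class_C R 1 \<and> 2 \<le> n \<and> \<theta> \<in> {0..<1} \<and>
       (\<forall>t\<in>{0..<1}. cmod (F_perp R f n (unit_exp (- t) / of_nat (card (carrier R))))
                     \<le> cmod (F_perp R f n (unit_exp (- \<theta>) / of_nat (card (carrier R)))))
       \<longrightarrow> (\<forall>l::nat. 1 \<le> l \<and> l \<le> n \<longrightarrow>
             cmod (twisted_mean_value R f \<theta> (n + l) - twisted_mean_value R f \<theta> n)
               \<le> C * ((real l / real n) powr (1 - 2 / pi) * ln (2 * real n / real l)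
                       + ln (real n) powr A
                           / real n powr (1 - c_const (least_odd_nondivisor l)))))"
proof -
  obtain C where C: "C > 0" "\<And>(a::nat \<Rightarrow> complex) s n l.
     (\<forall>k\<ge>1. cmod (a k) \<le> 1) \<and> s 0 = 1 \<and> (\<forall>N\<ge>1. of_nat N * s N = (\<Sum>k=1..N. a k * s (N - k))) \<and>
     n \<ge> 2 \<and> 1 \<le> l \<and> l \<le> n \<and> (\<forall>w. cmod w = 1 \<longrightarrow> cmod (trunc_series a (n-1) w) \<le> cmod (trunc_series a (n-1) 1)) \<longrightarrow>
     cmod (s (n + l) - s n) \<le> C * ((real l / real n) powr (1 - 2 / pi) * ln (2 * real n / real l)
                       + ln (real n) powr 3 / real n powr (1 - c_const (least_odd_nondivisor l)))"
    using Lipschitz_sequence by blast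
  have "cmod (twisted_mean_value R f \<theta> (n + l) - twisted_mean_value R f \<theta> n)
               \<le> C * ((real l / real n) powr (1 - 2 / pi) * ln (2 * real n / real l)
                       + ln (real n) powr 3 / real n powr (1 - c_const (least_odd_nondivisor l)))"
    if R: "field R" and fin: "finite (carrier R)" and f: "f \<in> class_C R 1" and n: "2 \<le> n"
      and max: "\<forall>t\<in>{0..<1}. cmod (F_perp R f n (unit_exp (- t) / of_nat (card (carrier R))))
                     \<le> cmod (F_perp R f n (unit_exp (- \<theta>) / of_nat (card (carrier R))))"
      and l: "1 \<le> l" "l \<le> n"
    for R :: "nat ring" and f :: "nat list \<Rightarrow> complex" and n l :: nat and \<theta> :: real
  proof -
    interpret field R by fact
    define u where "u = unit_exp (- \<theta>)"
    have u: "cmod u = 1" "u \<noteq> 0" by (auto simp: u_def unit_exp_cis)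
    have uk: "unit_exp (- (real k * \<theta>)) = u ^ k" for k
      by (simp add: u_def unit_exp_cis Complex.DeMoivre mult_ac)
    define a where "a = (\<lambda>k. prime_mean_value R f k * u ^ k)"
    define s where "s = twisted_mean_value R f \<theta>"
    have s: "s k = mean_value R f k * u ^ k" for k
      by (simp add: s_def twisted_mean_value_def uk)
    \<comment> \<open>Twisting both sequences by u^k preserves the recurrence and rotates the
      variable, so that the maximum at u moves to 1.\<close>
    have tr: "trunc_series a (n-1) w = trunc_series (prime_mean_value R f) (n-1) (u * w)" for w
      by (simp add: trunc_series_def a_def power_mult_distrib mult_ac)
    have q: "card (carrier R) > 0" by (rule card_carrier_pos[OF fin])
    have "cmod (s (n + l) - s n) \<le> C * ((real l / real n) powr (1 - 2 / pi) * ln (2 * real n / real l)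
                       + ln (real n) powr 3 / real n powr (1 - c_const (least_odd_nondivisor l)))"
    proof (rule C(2)[rule_format, of a], intro conjI allI impI)
      show "cmod (a k) \<le> 1" if "k \<ge> 1" for k
        using prime_mean_value_le[OF fin f that] u by (simp add: a_def norm_mult norm_power)
      show "s 0 = 1" using mean_value_0[OF f] by (simp add: s)
      show "of_nat N * s N = (\<Sum>k=1..N. a k * s (N - k))" if "N \<ge> 1" for N
      proof -
        have "of_nat N * s N = (\<Sum>k=1..N. prime_mean_value R f k * mean_value R f (N - k)) * u ^ N"
          using mean_value_recurrence[OF fin f, of N] by (simp add: s mult.assoc[symmetric])
        also have "\<dots> = (\<Sum>k=1..N. a k * s (N - k))"
          unfolding sum_distrib_right
        proof (intro sum.cong refl)
          fix k assume "k \<in> {1..N}"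
          then have uN: "u ^ N = u ^ k * u ^ (N - k)" by (metis atLeastAtMost_iff le_add_diff_inverse power_add)
          show "prime_mean_value R f k * mean_value R f (N - k) * u ^ N = a k * s (N - k)"
            unfolding a_def s uN by (simp only: mult_ac)
        qed
        finally show ?thesis .
      qed
      show "cmod (trunc_series a (n-1) w) \<le> cmod (trunc_series a (n-1) 1)" if w: "cmod w = 1" for w
      proof -
        have "cmod (u * w) = 1" using u w by (simp add: norm_mult)
        then obtain t where t: "t \<in> {0..<1}" "u * w = unit_exp (- t)" by (rule unit_circle_unit_exp)
        show ?thesis
          using max[rule_format, OF t(1)] unfolding F_perp_trunc_series[OF q] tr t(2) by (simp add: u_def)
      qed
    qed (use n l in auto)
    then show ?thesis by (simp add: s_def)
  qed
  then show ?thesis using C(1) by (intro exI[of _ C] exI[of _ 3]) auto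
qed

end
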